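(* Let $\Omega\subset\mathbb{R}^n$ be a domain and let $F:\Omega\to\mathbb{R}^2$ be a smooth map whose graph $\Sigma=\{(x,F(x)):x\in\Omega\}$ is a minimal submanifold of $\mathbb{R}^{n+2}$. Suppose that $F$ is area-non-increasing, i.e. at every point of $\Omega$ $$\lambda_1\lambda_2\le 1,$$ where $\lambda_1,\lambda_2\ge 0$ are the singular values of $\mathrm{d}F$ at that point. Then $\Sigma$ is calibrated by the $n$-form $\Theta(F)$ on $\Omega\times\mathbb{R}^2$; that is, $\Theta(F)$ is closed, has comass at most one at every point of $\Omega\times\mathbb{R}^2$, and restricts on $\Sigma$ to the induced volume form $\operatorname{vol}_\Sigma$.
   Context: Minimal means that the mean curvature vector vanishes identically. Singular values are the eigenvalues of $\sqrt{(\mathrm{d}F)^*\mathrm{d}F}$, listed in decreasing order, with the convention that missing ones are $0$. Comass and calibrations. The comass of an $n$-form at a point is the supremum of its values on all oriented unit $n$-planes (i.e. on all orthonormal $n$-tuples). A calibration is a closed form whose comass is at most one at every point. An oriented submanifold $\Sigma$ is calibrated by a calibration $\Theta$ if $\Theta|_\Sigma=\operatorname{vol}_\Sigma$. Definition of $\Theta(F)$ for a smooth map $F:\Omega\subset\mathbb{R}^n\to\mathbb{R}^m$ (here $m=2$). Fix the standard orientation of $\mathbb{R}^n$; orient the graph $\Sigma$ so that the projection $\pi_1:\Sigma\to\Omega$ preserves orientation, and let $\operatorname{vol}_\Sigma$ be the induced volume form. For $p\in\Sigma$ put $D=\mathrm{d}F|_{\pi_1(p)}:\mathbb{R}^n\to\mathbb{R}^m$,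 $G=\mathbf{I}_n+D^*D$, $H=\mathbf{I}_m+DD^*$. Define isometric isomorphisms $L_p:\mathbb{R}^n\to T_p\Sigma$, $L_p(v)=(G^{-1/2}v,\,DG^{-1/2}v)$, and $L_p^\perp:\mathbb{R}^m\to N_p\Sigma$, $L_p^\perp(w)=(-D^*H^{-1/2}w,\,H^{-1/2}w)$, onto the tangent and normal spaces, and set $J_p=L_p^\perp\circ D\circ L_p^{-1}:T_p\Sigma\to N_p\Sigma$. For $\xi\in\Lambda^k(\mathbb{R}^n\times\mathbb{R}^m)^*$ at $p$ put $\Psi(\xi)=\sum_{i=1}^n (J_p(e_i))^\flat\wedge\iota_{e_i}\xi$, where $e_1,\dots,e_n$ is any orthonormal basis of $T_p\Sigma$ (the result is independent of the basis), $\iota$ is interior multiplication, and $\flat$ is the metric dual. View $\operatorname{vol}_\Sigma$ at $p$ as the $n$-form on $\mathbb{R}^{n+m}$ that vanishes when contracted with normal vectors, and set $\Psi^\ell(F)=\Psi^{\ell}(\operatorname{vol}_\Sigma)$ ($\ell$-fold iterate). This is defined along $\Sigma$ and is extended to an $n$-form on $\Omega\times\mathbb{R}^m$ by parallel transport along the $\mathbb{R}^m$ factor, i.e. its value at $(x,y)$ is its value at $(x,F(x))$. Finally $$\Theta(F)=\Psi^0(F)-\sum_{\ell\ge1}(-1)^\ell\,\frac{\ell-1}{\ell!}\,\Psi^\ell(F).$$ *)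

theory Defs
  imports "HOL-Analysis.Analysis"
begin

section \<open>Smooth maps\<close>

primrec times_differentiable_on ::
    "nat \<Rightarrow> ('a::real_normed_vector \<Rightarrow> 'b::real_normed_vector) \<Rightarrow> 'a set \<Rightarrow> bool" where
  "times_differentiable_on 0 f S \<longleftrightarrow> continuous_on S f"
| "times_differentiable_on (Suc k) f S \<longleftrightarrow>
     (\<forall>x\<in>S. f differentiable (at x)) \<and>
     (\<forall>v. times_differentiable_on k (\<lambda>x. frechet_derivative f (at x) v) S)"

text \<open>Meant for open \<open>S\<close>: the derivatives are two-sided.\<close>

definition smooth_on :: "('a::real_normed_vector \<Rightarrow> 'b::real_normed_vector) \<Rightarrow> 'a set \<Rightarrow> bool" where
  "smooth_on f S \<longleftrightarrow> (\<forall>k. times_differentiable_on k f S)"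


section \<open>Singular values\<close>

definition op_sqrt :: "('a::real_inner \<Rightarrow> 'a) \<Rightarrow> 'a \<Rightarrow> 'a" where
  "op_sqrt A = (THE B. linear B \<and> (\<forall>u v. B u \<bullet> v = u \<bullet> B v) \<and> (\<forall>v. 0 \<le> B v \<bullet> v) \<and> B \<circ> B = A)"

definition eigenspace :: "('a::euclidean_space \<Rightarrow> 'a) \<Rightarrow> real \<Rightarrow> 'a set" where
  "eigenspace A \<mu> = {v. A v = \<mu> *\<^sub>R v}"

text \<open>The eigenvalues of a self-adjoint operator in decreasing order, repeated according to
  multiplicity.\<close>

definition eigenvalue_list :: "('a::euclidean_space \<Rightarrow> 'a) \<Rightarrow> real list" where
  "eigenvalue_list A =
     concat (map (\<lambda>\<mu>. replicate (dim (eigenspace A \<mu>)) \<mu>)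
       (rev (sorted_list_of_set {\<mu>. \<exists>v. v \<noteq> 0 \<and> A v = \<mu> *\<^sub>R v})))"

text \<open>Counted from \<open>1\<close>; the missing singular values are \<open>0\<close>.\<close>

definition singular_value ::
    "('a::euclidean_space \<Rightarrow> 'b::euclidean_space) \<Rightarrow> nat \<Rightarrow> real" where
  "singular_value D k =
     (let s = eigenvalue_list (op_sqrt (adjoint D \<circ> D))
      in if 1 \<le> k \<and> k \<le> length s then s ! (k - 1) else 0)"


section \<open>Minimal immersions\<close>

definition tangent_space ::
    "('a::real_normed_vector \<Rightarrow> 'b::real_normed_vector) \<Rightarrow> 'a \<Rightarrow> 'b set" where
  "tangent_space X x = range (frechet_derivative X (at x))"

definition normal_part :: "'b::euclidean_space set \<Rightarrow> 'b \<Rightarrow> 'b" where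
  "normal_part T w = (THE z. z \<in> orthogonal_comp T \<and> w - z \<in> T)"

definition first_fundamental_form ::
    "(real^'n \<Rightarrow> 'b::euclidean_space) \<Rightarrow> real^'n \<Rightarrow> real^'n^'n" where
  "first_fundamental_form X x =
     (\<chi> i j. frechet_derivative X (at x) (axis i 1) \<bullet> frechet_derivative X (at x) (axis j 1))"

text \<open>The tangent vectors are given by their coordinates \<open>u\<close>, \<open>v\<close> in the parameter domain.\<close>

definition second_fundamental_form ::
    "(real^'n \<Rightarrow> 'b::euclidean_space) \<Rightarrow> real^'n \<Rightarrow> real^'n \<Rightarrow> real^'n \<Rightarrow> 'b" where
  "second_fundamental_form X x u v =
     normal_part (tangent_space X x)
       (frechet_derivative (\<lambda>y. frechet_derivative X (at y) v) (at x) u)"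

definition mean_curvature :: "(real^'n \<Rightarrow> 'b::euclidean_space) \<Rightarrow> real^'n \<Rightarrow> 'b" where
  "mean_curvature X x =
     (\<Sum>i\<in>UNIV. \<Sum>j\<in>UNIV. matrix_inv (first_fundamental_form X x) $ i $ j *\<^sub>R
        second_fundamental_form X x (axis i 1) (axis j 1))"

definition minimal_on :: "(real^'n) set \<Rightarrow> (real^'n \<Rightarrow> 'b::euclidean_space) \<Rightarrow> bool" where
  "minimal_on U X \<longleftrightarrow> (\<forall>x\<in>U. mean_curvature X x = 0)"


section \<open>Alternating forms and calibrations\<close>

text \<open>A \<open>k\<close>-form on \<open>'v\<close> is a function of sequences that only reads the entries
  \<open>0, \<dots>, k - 1\<close>.\<close>

definition alternating_form :: "nat \<Rightarrow> ((nat \<Rightarrow> 'v::real_vector) \<Rightarrow> real) \<Rightarrow> bool" where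
  "alternating_form k \<xi> \<longleftrightarrow>
     (\<forall>v w. (\<forall>i<k. v i = w i) \<longrightarrow> \<xi> v = \<xi> w) \<and>
     (\<forall>v. \<forall>i<k. linear (\<lambda>x. \<xi> (v(i := x)))) \<and>
     (\<forall>v. \<forall>i<k. \<forall>j<k. i \<noteq> j \<longrightarrow> v i = v j \<longrightarrow> \<xi> v = 0)"

definition omit :: "nat \<Rightarrow> (nat \<Rightarrow> 'v) \<Rightarrow> nat \<Rightarrow> 'v" where
  "omit i v = (\<lambda>j. if j < i then v j else v (Suc j))"

definition interior_mult ::
    "'v \<Rightarrow> ((nat \<Rightarrow> 'v) \<Rightarrow> real) \<Rightarrow> (nat \<Rightarrow> 'v) \<Rightarrow> real" where
  "interior_mult e \<xi> v = \<xi> (case_nat e v)"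

text \<open>The wedge product of a covector with a form of degree \<open>k - 1\<close>, a form of degree \<open>k\<close>;
  normalised so that \<open>(\<alpha> \<and> \<beta>) (u, v) = \<alpha> u * \<beta> v - \<alpha> v * \<beta> u\<close>.\<close>

definition covector_wedge ::
    "nat \<Rightarrow> ('v \<Rightarrow> real) \<Rightarrow> ((nat \<Rightarrow> 'v) \<Rightarrow> real) \<Rightarrow> (nat \<Rightarrow> 'v) \<Rightarrow> real" where
  "covector_wedge k \<alpha> \<eta> v = (\<Sum>i<k. (-1) ^ i * \<alpha> (v i) * \<eta> (omit i v))"

definition flat :: "'v::real_inner \<Rightarrow> 'v \<Rightarrow> real" where
  "flat u = (\<lambda>w. u \<bullet> w)"

definition differential_form ::
    "nat \<Rightarrow> 'v::real_normed_vector set \<Rightarrow> ('v \<Rightarrow> (nat \<Rightarrow> 'v) \<Rightarrow> real) \<Rightarrow> bool" where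
  "differential_form k U \<omega> \<longleftrightarrow>
     (\<forall>p\<in>U. alternating_form k (\<omega> p)) \<and> (\<forall>v. smooth_on (\<lambda>p. \<omega> p v) U)"

definition exterior_derivative ::
    "nat \<Rightarrow> ('v::real_normed_vector \<Rightarrow> (nat \<Rightarrow> 'v) \<Rightarrow> real) \<Rightarrow> 'v \<Rightarrow> (nat \<Rightarrow> 'v) \<Rightarrow> real" where
  "exterior_derivative k \<omega> p v =
     (\<Sum>i\<le>k. (-1) ^ i * frechet_derivative (\<lambda>q. \<omega> q (omit i v)) (at p) (v i))"

definition closed_form ::
    "nat \<Rightarrow> 'v::real_normed_vector set \<Rightarrow> ('v \<Rightarrow> (nat \<Rightarrow> 'v) \<Rightarrow> real) \<Rightarrow> bool" where
  "closed_form k U \<omega> \<longleftrightarrow>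
     differential_form k U \<omega> \<and> (\<forall>p\<in>U. \<forall>v. exterior_derivative k \<omega> p v = 0)"

definition orthonormal_tuple :: "nat \<Rightarrow> (nat \<Rightarrow> 'v::real_inner) \<Rightarrow> bool" where
  "orthonormal_tuple k v \<longleftrightarrow> (\<forall>i<k. \<forall>j<k. v i \<bullet> v j = (if i = j then 1 else 0))"

definition comass :: "nat \<Rightarrow> ((nat \<Rightarrow> 'v::real_inner) \<Rightarrow> real) \<Rightarrow> ereal" where
  "comass k \<xi> = (SUP v\<in>{v. orthonormal_tuple k v}. ereal (\<xi> v))"

definition calibration ::
    "nat \<Rightarrow> 'v::real_inner set \<Rightarrow> ('v \<Rightarrow> (nat \<Rightarrow> 'v) \<Rightarrow> real) \<Rightarrow> bool" where
  "calibration k U \<omega> \<longleftrightarrow> closed_form k U \<omega> \<and> (\<forall>p\<in>U. comass k (\<omega> p) \<le> 1)"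


section \<open>The form \<open>\<Theta>(F)\<close> of a graph\<close>

text \<open>The point \<open>p = (x, F x)\<close> of the graph is represented by \<open>x\<close>.\<close>

definition graph_map :: "('a \<Rightarrow> 'b) \<Rightarrow> 'a \<Rightarrow> 'a \<times> 'b" where
  "graph_map F = (\<lambda>x. (x, F x))"

text \<open>The order of the index type lists the coordinates of \<open>real^'n\<close>, and hence fixes the standard
  orientation; \<open>index_pos\<close> counts from \<open>0\<close>.\<close>

definition index_pos :: "'n::{finite,linorder} \<Rightarrow> nat" where
  "index_pos i = card {j. j < i}"

definition positive_frame ::
    "(real^'n \<Rightarrow> real^'m) \<Rightarrow> real^'n \<Rightarrow> ('n \<Rightarrow> (real^'n) \<times> (real^'m)) \<Rightarrow> bool" where
  "positive_frame F x e \<longleftrightarrow>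
     (\<forall>i. e i \<in> tangent_space (graph_map F) x) \<and>
     (\<forall>i j. e i \<bullet> e j = (if i = j then 1 else 0)) \<and>
     det (\<chi> i. fst (e i)) > 0"

text \<open>For a positively oriented orthonormal frame \<open>e\<close> of the tangent space, the volume form is
  \<open>e\<^sub>1\<^sup>\<flat> \<and> \<dots> \<and> e\<^sub>n\<^sup>\<flat>\<close>. As a form on the ambient space it vanishes
  when contracted with a normal vector.\<close>

definition graph_vol ::
    "(real^'n::{finite,linorder} \<Rightarrow> real^'m) \<Rightarrow> real^'n::_ \<Rightarrow>
     (nat \<Rightarrow> (real^'n::_) \<times> (real^'m)) \<Rightarrow> real" where
  "graph_vol F x v =
     (let e = (SOME e. positive_frame F x e) in det (\<chi> i j. e i \<bullet> v (index_pos j)))"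

definition G_op :: "('a::euclidean_space \<Rightarrow> 'b::euclidean_space) \<Rightarrow> 'a \<Rightarrow> 'a" where
  "G_op D = (\<lambda>v. v + adjoint D (D v))"

definition H_op :: "('a::euclidean_space \<Rightarrow> 'b::euclidean_space) \<Rightarrow> 'b \<Rightarrow> 'b" where
  "H_op D = (\<lambda>w. w + D (adjoint D w))"

definition L_tan :: "('a::euclidean_space \<Rightarrow> 'b::euclidean_space) \<Rightarrow> 'a \<Rightarrow> 'a \<times> 'b" where
  "L_tan D v = (inv (op_sqrt (G_op D)) v, D (inv (op_sqrt (G_op D)) v))"

definition L_nor :: "('a::euclidean_space \<Rightarrow> 'b::euclidean_space) \<Rightarrow> 'b \<Rightarrow> 'a \<times> 'b" where
  "L_nor D w = (- adjoint D (inv (op_sqrt (H_op D)) w), inv (op_sqrt (H_op D)) w)"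

text \<open>Only meaningful on the tangent space \<open>range (L_tan D)\<close>.\<close>

definition J_op ::
    "('a::euclidean_space \<Rightarrow> 'b::euclidean_space) \<Rightarrow> 'a \<times> 'b \<Rightarrow> 'a \<times> 'b" where
  "J_op D = L_nor D \<circ> D \<circ> inv (L_tan D)"

definition some_onb :: "'v::euclidean_space set \<Rightarrow> 'v set" where
  "some_onb T = (SOME B. pairwise orthogonal B \<and> (\<forall>b\<in>B. norm b = 1) \<and> span B = T)"

definition Psi ::
    "(real^'n \<Rightarrow> real^'m) \<Rightarrow> real^'n \<Rightarrow> nat \<Rightarrow>
     ((nat \<Rightarrow> (real^'n) \<times> (real^'m)) \<Rightarrow> real) \<Rightarrow>
     (nat \<Rightarrow> (real^'n) \<times> (real^'m)) \<Rightarrow> real" where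
  "Psi F x k \<xi> v =
     (\<Sum>e\<in>some_onb (tangent_space (graph_map F) x).
        covector_wedge k (flat (J_op (frechet_derivative F (at x)) e)) (interior_mult e \<xi>) v)"

definition Psi_pow ::
    "(real^'n::{finite,linorder} \<Rightarrow> real^'m) \<Rightarrow> nat \<Rightarrow> real^'n::_ \<Rightarrow>
     (nat \<Rightarrow> (real^'n::_) \<times> (real^'m)) \<Rightarrow> real" where
  "Psi_pow F l x = (Psi F x CARD('n) ^^ l) (graph_vol F x)"

text \<open>The value at \<open>(x, y)\<close> is the one at \<open>(x, F x)\<close>. The sum has finitely many nonzero
  terms, because \<open>Psi\<close> exchanges a tangential factor for a normal one.\<close>

definition Theta ::
    "(real^'n::{finite,linorder} \<Rightarrow> real^'m) \<Rightarrow> (real^'n::_) \<times> (real^'m) \<Rightarrow>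
     (nat \<Rightarrow> (real^'n::_) \<times> (real^'m)) \<Rightarrow> real" where
  "Theta F p v =
     Psi_pow F 0 (fst p) v -
     (\<Sum>\<^sub>\<infinity>l\<in>{1..}. (-1) ^ l * ((real l - 1) / fact l) * Psi_pow F l (fst p) v)"

definition calibrates_graph ::
    "((real^'n::{finite,linorder}) \<times> (real^'m) \<Rightarrow> (nat \<Rightarrow> (real^'n::_) \<times> (real^'m)) \<Rightarrow> real) \<Rightarrow>
     (real^'n::_) set \<Rightarrow> (real^'n::_ \<Rightarrow> real^'m) \<Rightarrow> bool" where
  "calibrates_graph \<omega> U F \<longleftrightarrow>
     calibration CARD('n) (U \<times> UNIV) \<omega> \<and>
     (\<forall>x\<in>U. \<forall>v. (\<forall>i<CARD('n). v i \<in> tangent_space (graph_map F) x) \<longrightarrow>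
        \<omega> (x, F x) v = graph_vol F x v)"

end

theory Submission
  imports Defs
begin

text \<open>
  At a point of the graph, \<open>\<Psi>\<close> is the derivation of the exterior algebra that replaces a covector by
  its image under the adjoint of \<open>J\<close>, and this adjoint squares to zero. Hence
  \<open>q(t) = \<Sum>\<^sub>\<ell> t^\<ell> \<Psi>^\<ell>(vol) / \<ell>!\<close> is a determinant whose entries are linear in \<open>t\<close>, and
  \<open>\<Theta> = q(-1) + q'(-1)\<close>. For two-dimensional targets, write \<open>d\<^sub>\<alpha>\<close> for the gradients of the components,
  \<open>g\<close> for the Gram determinant of the graph and \<open>\<delta>\<close> for the Gram determinant of \<open>d\<^sub>1, d\<^sub>2\<close>. Expanding gives
  \<open>\<Theta> = (1 - \<delta>) / \<surd>g dx + \<Sum>\<^sub>\<alpha> dy\<^sub>\<alpha> \<and> \<iota>(V\<^sub>\<alpha>) dx\<close> with \<open>V\<^sub>\<alpha> = \<surd>g g\<^sup>i\<^sup>j \<partial>\<^sub>jF\<^sup>\<alpha>\<close>.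

  This form is closed exactly when the fields \<open>V\<^sub>\<alpha>\<close> are divergence free, which is the minimal surface
  system. On an \<open>n\<close>-plane that is the graph of a linear map with rows \<open>z\<^sub>1, z\<^sub>2\<close>, the bound on the comass
  becomes an inequality for bivectors in the normal directions; it follows from Wirtinger's inequality
  because the squared area factor \<open>\<delta> = (\<lambda>\<^sub>1\<lambda>\<^sub>2)\<^sup>2\<close> is at most one. The remaining planes are limits of
  such graphs. On tangent vectors the adjoint of \<open>J\<close> vanishes, so \<open>q\<close> is constant and equal to the volume
  form.
\<close>

section \<open>Self-adjoint operators and their square roots\<close>

text \<open>Why -1, and why a derivative: the weight \<open>-(-1)^l (l - 1)\<close> in
  \<open>Theta\<close> equals \<open>(-1)^l + l (-1)^(l - 1)\<close>, and it is 1 for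
  \<open>l = 0\<close>, so the leading term \<open>Psi_pow F 0\<close> obeys the same rule as the
  series. At \<open>t = -1\<close> each row of the determinant becomes
  \<open>tan_pairing D w - nor_pairing D w\<close>, in which the vertical part of \<open>w\<close>
  cancels. Hence q(-1) contains no dy and q'(-1) at most one dy in each term; this is what makes the
  form affine in the vertical covectors and its closedness a first-order divergence condition. The
  definitions contain square roots of operators and arbitrary choices (a frame, an orthonormal
  basis) that depend on the point and give no access to derivatives. They are eliminated pointwise,
  before any differentiation; what remains of the roots is the scalar \<open>1 / sqrt g\<close>. The
  comass bound is obtained as an inequality between a square and a Gram determinant for arbitrary
  tuples, because the perturbation that turns a plane into a graph does not preserve
  orthonormality.\<close>

lemma quadratic_nonneg_imp_linear_zero:
  fixes a c :: real
  assumes "\<And>t. 0 \<le> - 2 * t * a + t\<^sup>2 * c" and "0 \<le> a"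
  shows "a = 0"
proof (rule ccontr)
  assume "a \<noteq> 0"
  then have a: "a > 0" using assms by simp
  \<comment> \<open>Small enough that \<open>t * c \<le> a\<close>, which pushes the quadratic down
    to at most \<open>- t * a < 0\<close>; the summand 1 covers \<open>c = 0\<close>.\<close>
  define t where "t = a / (\<bar>c\<bar> + 1)"
  have t: "t > 0" using a by (simp add: t_def)
  have "t * c \<le> t * (\<bar>c\<bar> + 1)" using t by (intro mult_left_mono) auto
  also have "\<dots> = a" by (simp add: t_def)
  finally have "t * c \<le> a" .
  then have "t * (t * c) \<le> t * a" using t by (intro mult_left_mono) auto
  then have "- 2 * t * a + t\<^sup>2 * c \<le> - t * a" by (simp add: power2_eq_square algebra_simps)
  moreover have "- t * a < 0" using t a by simp
  ultimately show False using assms(1)[of t] by linarith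
qed

text \<open>A maximiser of the Rayleigh quotient on the unit sphere of \<open>S\<close> is an
  eigenvector, because the first variation vanishes there.\<close>

lemma selfadjoint_eigenvector:
  fixes A :: "'a::euclidean_space \<Rightarrow> 'a"
  assumes A: "linear A" and sym: "\<And>u v. A u \<bullet> v = u \<bullet> A v"
    and S: "subspace S" "A ` S \<subseteq> S" "S \<noteq> {0}"
  obtains u where "u \<in> S" "norm u = 1" "A u = (A u \<bullet> u) *\<^sub>R u"
proof -
  interpret A: linear A by fact
  have "compact (S \<inter> sphere 0 1)"
    using closed_subspace[OF S(1)] by (intro closed_Int_compact) auto
  moreover obtain x where "x \<in> S" "x \<noteq> 0" using S subspace_0 by blast
  then have "x /\<^sub>R norm x \<in> S \<inter> sphere 0 1" using S(1) by (auto simp: subspace_def)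
  then have "S \<inter> sphere 0 1 \<noteq> {}" by blast
  moreover have "continuous_on (S \<inter> sphere 0 1) (\<lambda>v. A v \<bullet> v)"
    using A by (intro continuous_intros linear_continuous_on) (simp add: linear_conv_bounded_linear)
  ultimately obtain u where u: "u \<in> S \<inter> sphere 0 1"
    and max: "\<And>v. v \<in> S \<inter> sphere 0 1 \<Longrightarrow> A v \<bullet> v \<le> A u \<bullet> u"
    using continuous_attains_sup by meson
  define \<mu> where "\<mu> = A u \<bullet> u"
  have uu: "u \<bullet> u = 1" using u by (simp add: dot_square_norm)
  have nonneg: "0 \<le> \<mu> * (v \<bullet> v) - A v \<bullet> v" if "v \<in> S" for v
  proof (cases "v = 0")
    case False
    then have "v /\<^sub>R norm v \<in> S \<inter> sphere 0 1" using S(1) that by (auto simp: subspace_def)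
    from max[OF this] have "(A v \<bullet> v) / (norm v)\<^sup>2 \<le> \<mu>"
      by (simp add: \<mu>_def A.scaleR power2_eq_square divide_inverse mult_ac)
    with False show ?thesis by (simp add: field_simps dot_square_norm)
  qed simp
  \<comment> \<open>The residual is used as its own direction of variation: the linear coefficient
    is then \<open>w \<bullet> w\<close>.\<close>
  define w where "w = A u - \<mu> *\<^sub>R u"
  have w: "w \<in> S" using u S by (auto simp: w_def intro!: subspace_diff subspace_scale)
  have "0 \<le> - 2 * t * (w \<bullet> w) + t\<^sup>2 * (\<mu> * (w \<bullet> w) - A w \<bullet> w)" for t
  proof -
    have "u + t *\<^sub>R w \<in> S" using u w S by (auto intro!: subspace_add subspace_scale)
    from nonneg[OF this]
    have "0 \<le> \<mu> * ((u + t *\<^sub>R w) \<bullet> (u + t *\<^sub>R w)) - A (u + t *\<^sub>R w) \<bullet> (u + t *\<^sub>R w)" .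
    also have "\<dots> = - 2 * t * ((A u - \<mu> *\<^sub>R u) \<bullet> w) + t\<^sup>2 * (\<mu> * (w \<bullet> w) - A w \<bullet> w)"
      using sym[of w u] uu inner_commute[of w u] inner_commute[of w "A u"]
      by (simp add: A.add A.scaleR inner_add_left inner_add_right inner_diff_left \<mu>_def[symmetric]
          algebra_simps power2_eq_square)
    finally show ?thesis by (simp add: w_def)
  qed
  from quadratic_nonneg_imp_linear_zero[OF this] have "w = 0" by simp
  then show ?thesis using u that by (auto simp: w_def \<mu>_def)
qed

text \<open>Symmetry keeps the orthogonal complement of an eigenvector inside \<open>S\<close>
  invariant, so the induction on the dimension needs the claim for all invariant subspaces.\<close>

lemma selfadjoint_eigenbasis_subspace:
  fixes A :: "'a::euclidean_space \<Rightarrow> 'a"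
  assumes A: "linear A" and sym: "\<And>u v. A u \<bullet> v = u \<bullet> A v"
  shows "subspace S \<Longrightarrow> A ` S \<subseteq> S \<Longrightarrow>
    \<exists>B. finite B \<and> pairwise orthogonal B \<and> span B = S \<and>
      (\<forall>b\<in>B. norm b = 1 \<and> A b = (A b \<bullet> b) *\<^sub>R b)"
proof (induction "dim S" arbitrary: S rule: less_induct)
  case less
  show ?case
  proof (cases "S = {0}")
    case True
    then show ?thesis by (intro exI[of _ "{}"]) auto
  next
    case False
    obtain u where u: "u \<in> S" "norm u = 1" "A u = (A u \<bullet> u) *\<^sub>R u"
      using selfadjoint_eigenvector[OF A sym less.prems False] by blast
    have uu: "u \<bullet> u = 1" using u by (simp add: dot_square_norm)
    define T where "T = S \<inter> {v. u \<bullet> v = 0}"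
    have T: "subspace T" unfolding T_def
      using less.prems(1) by (intro subspace_inter) (auto simp: subspace_hyperplane)
    have AT: "A ` T \<subseteq> T"
    proof -
      have "u \<bullet> A v = 0" if "u \<bullet> v = 0" for v
        using sym[of u v] u(3) that by (metis inner_scaleR_left mult_zero_right)
      then show ?thesis using less.prems(2) by (auto simp: T_def)
    qed
    have "u \<notin> T" using uu by (simp add: T_def)
    then have "T \<subset> S" using u(1) by (force simp: T_def)
    then have "dim T < dim S" using T less.prems(1)
      by (metis dim_psubset span_eq_iff)
    from less.hyps[OF this T AT] obtain B where B: "finite B" "pairwise orthogonal B"
      "span B = T" "\<forall>b\<in>B. norm b = 1 \<and> A b = (A b \<bullet> b) *\<^sub>R b" by blast
    have BT: "B \<subseteq> T" using B(3) span_superset by blast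
    have "span (insert u B) = S"
    proof (intro equalityI span_minimal less.prems(1))
      show "insert u B \<subseteq> S" using u BT by (auto simp: T_def)
      show "S \<subseteq> span (insert u B)"
      proof
        fix v assume v: "v \<in> S"
        have "v - (u \<bullet> v) *\<^sub>R u \<in> T"
          using v u uu less.prems(1) by (auto simp: T_def inner_diff intro!: subspace_diff subspace_scale)
        then show "v \<in> span (insert u B)" unfolding span_insert using B(3) by auto
      qed
    qed
    moreover have "pairwise orthogonal (insert u B)"
      using B(2) BT by (auto simp: pairwise_insert orthogonal_def T_def inner_commute)
    ultimately show ?thesis using B u by (intro exI[of _ "insert u B"]) auto
  qed
qed

definition eigenbasis :: "('a::euclidean_space \<Rightarrow> 'a) \<Rightarrow> 'a set \<Rightarrow> bool" where
  "eigenbasis A B \<longleftrightarrow> finite B \<and> pairwise orthogonal B \<and> span B = UNIV \<and>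
     (\<forall>b\<in>B. b \<bullet> b = 1 \<and> A b = (A b \<bullet> b) *\<^sub>R b)"

lemma selfadjoint_eigenbasis:
  fixes A :: "'a::euclidean_space \<Rightarrow> 'a"
  assumes "linear A" and "\<And>u v. A u \<bullet> v = u \<bullet> A v"
  obtains B where "eigenbasis A B"
  using selfadjoint_eigenbasis_subspace[OF assms, of UNIV] unfolding eigenbasis_def
  by (metis norm_eq_1 subset_UNIV subspace_UNIV)

lemma orthonormal_expand:
  fixes B :: "'a::euclidean_space set"
  assumes "finite B" "pairwise orthogonal B" "\<forall>b\<in>B. b \<bullet> b = 1" "v \<in> span B"
  shows "v = (\<Sum>b\<in>B. (b \<bullet> v) *\<^sub>R b)"
  using orthonormal_basis_expand[OF assms(2) _ assms(4,1)] assms(3)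
  by (simp add: norm_eq_sqrt_inner inner_commute)

definition psd :: "('a::real_inner \<Rightarrow> 'a) \<Rightarrow> bool" where
  "psd B \<longleftrightarrow> linear B \<and> (\<forall>u v. B u \<bullet> v = u \<bullet> B v) \<and> (\<forall>v. 0 \<le> B v \<bullet> v)"

lemma psd_sqrt_exists:
  fixes A :: "'a::euclidean_space \<Rightarrow> 'a"
  assumes "psd A"
  shows "\<exists>R. psd R \<and> R \<circ> R = A"
proof -
  have A: "linear A" "\<And>u v. A u \<bullet> v = u \<bullet> A v" "\<And>v. 0 \<le> A v \<bullet> v"
    using assms by (auto simp: psd_def)
  interpret A: linear A by fact
  obtain B where "eigenbasis A B" using selfadjoint_eigenbasis[OF A(1,2)] by blast
  then have B: "finite B" "pairwise orthogonal B" "span B = UNIV" "\<forall>b\<in>B. b \<bullet> b = 1"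
    and eig: "\<forall>b\<in>B. A b = (A b \<bullet> b) *\<^sub>R b" by (auto simp: eigenbasis_def)
  define \<mu> where "\<mu> = (\<lambda>b. A b \<bullet> b)"
  define R where "R v = (\<Sum>b\<in>B. (sqrt (\<mu> b) * (b \<bullet> v)) *\<^sub>R b)" for v
  have bb: "b \<bullet> c = (if b = c then 1 else 0)" if "b \<in> B" "c \<in> B" for b c
    using B that by (auto simp: pairwise_def orthogonal_def)
  have "linear R"
    by (intro linearI) (simp_all add: R_def inner_add algebra_simps sum.distrib scaleR_sum_right)
  moreover have "R u \<bullet> v = u \<bullet> R v" for u v
    by (simp add: R_def inner_sum_left inner_sum_right inner_commute mult_ac)
  moreover have "0 \<le> R v \<bullet> v" for v
    unfolding R_def inner_sum_left using A(3)
    by (intro sum_nonneg) (simp add: \<mu>_def mult.assoc)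
  moreover have "R \<circ> R = A"
  proof
    fix v
    have Rb: "b \<bullet> R v = sqrt (\<mu> b) * (b \<bullet> v)" if "b \<in> B" for b
      using that B(1) by (simp add: R_def inner_sum_right bb if_distrib sum.delta cong: if_cong)
    have "R (R v) = (\<Sum>b\<in>B. (\<mu> b * (b \<bullet> v)) *\<^sub>R b)"
      unfolding R_def[of "R v"]
      using A(3) by (intro sum.cong refl) (simp add: Rb \<mu>_def flip: mult.assoc)
    also have "\<dots> = (\<Sum>b\<in>B. (b \<bullet> v) *\<^sub>R A b)"
      using eig by (intro sum.cong refl) (metis \<mu>_def mult.commute scaleR_scaleR)
    also have "\<dots> = A (\<Sum>b\<in>B. (b \<bullet> v) *\<^sub>R b)" by (simp add: A.sum A.scaleR)
    also have "\<dots> = A v" using orthonormal_expand[of B v] B by simp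
    finally show "(R \<circ> R) v = A v" by simp
  qed
  ultimately show ?thesis by (auto simp: psd_def)
qed

text \<open>If \<open>R u = \<rho> u\<close>, then \<open>w = (D R - S D) u\<close> satisfies \<open>S w = - \<rho> w\<close>, which forces \<open>w = 0\<close>.
  Both the uniqueness of square roots and \<open>D \<surd>G = \<surd>H D\<close> are instances.\<close>

lemma psd_intertwine:
  fixes R :: "'a::euclidean_space \<Rightarrow> 'a" and S :: "'b::euclidean_space \<Rightarrow> 'b"
  assumes R: "psd R" and S: "psd S" and D: "linear D"
    and comm: "\<And>v. D (R (R v)) = S (S (D v))"
  shows "D (R v) = S (D v)"
proof -
  have R': "linear R" "\<And>u v. R u \<bullet> v = u \<bullet> R v" "\<And>v. 0 \<le> R v \<bullet> v"
    and S': "linear S" "\<And>u v. S u \<bullet> v = u \<bullet> S v" "\<And>v. 0 \<le> S v \<bullet> v"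
    using R S by (auto simp: psd_def)
  interpret D: linear D by fact
  interpret R: linear R by fact
  interpret S: linear S by fact
  obtain B where "eigenbasis R B" using selfadjoint_eigenbasis[OF R'(1,2)] by blast
  then have B: "span B = UNIV" and eig: "\<forall>b\<in>B. R b = (R b \<bullet> b) *\<^sub>R b" by (auto simp: eigenbasis_def)
  have "D (R b) = S (D b)" if "b \<in> B" for b
  proof -
    define \<rho> where "\<rho> = R b \<bullet> b"
    have Rb: "R b = \<rho> *\<^sub>R b" using eig that by (simp add: \<rho>_def)
    have \<rho>: "0 \<le> \<rho>" using R'(3) by (simp add: \<rho>_def)
    define w where "w = \<rho> *\<^sub>R D b - S (D b)"
    have SS: "S (S (D b)) = (\<rho> * \<rho>) *\<^sub>R D b"
      using comm[of b] by (simp add: Rb R.scaleR D.scaleR)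
    have Sw: "S w = - \<rho> *\<^sub>R w"
      by (simp add: w_def S.diff S.scaleR SS algebra_simps)
    have "w = 0"
    proof (cases "\<rho> = 0")
      \<comment> \<open>Here \<open>S w = - \<rho> w\<close> carries no sign. Instead
        \<open>w = - S (D b)\<close> lies both in the kernel and in the range of the symmetric
        \<open>S\<close>, hence is orthogonal to itself.\<close>
      case True
      then have "S w = 0" using Sw by simp
      then have "S (D b) \<bullet> w = 0" using S'(2)[of "D b" w] by simp
      then have "w \<bullet> w = 0" by (simp add: w_def True)
      then show ?thesis by simp
    next
      case False
      have "0 \<le> - (\<rho> * (w \<bullet> w))" using S'(3)[of w] by (simp add: Sw)
      moreover have "0 \<le> w \<bullet> w" by simp
      ultimately have "w \<bullet> w = 0" using False \<rho>
        by (smt (verit) mult_pos_pos)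
      then show ?thesis by simp
    qed
    then show ?thesis by (simp add: w_def Rb D.scaleR)
  qed
  moreover have "linear (\<lambda>v. D (R v))" "linear (\<lambda>v. S (D v))"
    using linear_compose[OF R'(1) D] linear_compose[OF D S'(1)] by (simp_all add: o_def)
  ultimately show ?thesis using linear_eq_on_span[of "\<lambda>v. D (R v)" "\<lambda>v. S (D v)" B v] B by simp
qed

text \<open>Justifies the definite description in \<open>op_sqrt\<close>: uniqueness is the
  intertwining lemma for two roots and the identity map.\<close>

lemma op_sqrt:
  fixes A :: "'a::euclidean_space \<Rightarrow> 'a"
  assumes "psd A"
  shows psd_op_sqrt: "psd (op_sqrt A)" and op_sqrt_op_sqrt: "op_sqrt A (op_sqrt A v) = A v"
proof -
  obtain R where R: "psd R" "R \<circ> R = A" using psd_sqrt_exists[OF assms] by blast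
  have eq: "op_sqrt A = R"
    unfolding op_sqrt_def
  proof (rule the_equality)
    show "linear R \<and> (\<forall>u v. R u \<bullet> v = u \<bullet> R v) \<and> (\<forall>v. 0 \<le> R v \<bullet> v) \<and> R \<circ> R = A"
      using R unfolding psd_def by blast
    fix T assume "linear T \<and> (\<forall>u v. T u \<bullet> v = u \<bullet> T v) \<and> (\<forall>v. 0 \<le> T v \<bullet> v) \<and> T \<circ> T = A"
    then have T: "psd T" "T \<circ> T = A" unfolding psd_def by blast+
    have "R (R v) = T (T v)" for v
      using fun_cong[OF R(2), of v] fun_cong[OF T(2), of v] by simp
    then show "T = R"
      by (intro ext psd_intertwine[OF R(1) T(1) linear_ident, symmetric])
  qed
  show "psd (op_sqrt A)" using R(1) by (simp add: eq)
  show "op_sqrt A (op_sqrt A v) = A v" using fun_cong[OF R(2), of v] by (simp add: eq)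
qed

lemma adjoint_inner:
  fixes D :: "'a::euclidean_space \<Rightarrow> 'b::euclidean_space"
  assumes "linear D"
  shows "u \<bullet> adjoint D w = D u \<bullet> w" "adjoint D w \<bullet> u = w \<bullet> D u"
  using adjoint_works[OF assms] by (simp_all add: inner_commute)

lemma psd_adjoint_comp:
  fixes D :: "'a::euclidean_space \<Rightarrow> 'b::euclidean_space"
  assumes "linear D"
  shows "psd (adjoint D \<circ> D)" "psd (D \<circ> adjoint D)"
  using linear_compose[OF assms adjoint_linear[OF assms]]
    linear_compose[OF adjoint_linear[OF assms] assms]
  by (simp_all add: psd_def adjoint_inner[OF assms])
     (simp_all flip: adjoint_inner[OF assms])

lemma psd_add_ident:
  fixes A :: "'a::euclidean_space \<Rightarrow> 'a"
  assumes "psd A"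
  shows "psd (\<lambda>v. v + A v)"
  using assms linear_compose_add[OF linear_ident, of A]
  by (auto simp: psd_def inner_add_left inner_add_right)

lemma bij_op_sqrt_add_ident:
  fixes A :: "'a::euclidean_space \<Rightarrow> 'a"
  assumes "psd A"
  shows "bij (op_sqrt (\<lambda>v. v + A v))"
proof -
  let ?R = "op_sqrt (\<lambda>v. v + A v)"
  have R: "linear ?R" using psd_op_sqrt[OF psd_add_ident[OF assms]] by (simp add: psd_def)
  have "v = 0" if "?R v = 0" for v
  proof -
    have "v + A v = 0"
      using op_sqrt_op_sqrt[OF psd_add_ident[OF assms], of v] linear_0[OF R] that by simp
    then have "v \<bullet> v + A v \<bullet> v = 0" by (metis inner_add_left inner_zero_left)
    moreover have "0 \<le> A v \<bullet> v" using assms unfolding psd_def by blast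
    ultimately show ?thesis by (smt (verit) inner_ge_zero inner_eq_zero_iff)
  qed
  then have "inj ?R" using linear_injective_0[OF R] by blast
  then show ?thesis using linear_injective_imp_surjective[OF R] by (simp add: bij_def)
qed

text \<open>All square roots cancel. With \<open>R\<close>, \<open>S\<close> the roots of
  \<open>G_op D\<close>, \<open>H_op D\<close>, the tangent vector \<open>(u, D u)\<close> is
  \<open>L_tan D (R u)\<close>, and \<open>D (R u) = S (D u)\<close> feeds \<open>L_nor\<close> an
  argument that its inverse root undoes.\<close>

lemma J_op_graph:
  fixes D :: "'a::euclidean_space \<Rightarrow> 'b::euclidean_space"
  assumes D: "linear D"
  shows "J_op D (u, D u) = (- adjoint D (D u), D u)"
proof -
  define R where "R = op_sqrt (G_op D)"
  define S where "S = op_sqrt (H_op D)"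
  have G: "G_op D = (\<lambda>v. v + (adjoint D \<circ> D) v)" and H: "H_op D = (\<lambda>w. w + (D \<circ> adjoint D) w)"
    by (auto simp: G_op_def H_op_def)
  note psd = psd_adjoint_comp[OF D]
  have bR: "bij R" and bS: "bij S" unfolding R_def S_def G H
    using bij_op_sqrt_add_ident psd by blast+
  have RR: "R (R v) = v + adjoint D (D v)" for v
    using op_sqrt_op_sqrt[OF psd_add_ident[OF psd(1)], of v] by (simp add: R_def G)
  have SS: "S (S w) = w + D (adjoint D w)" for w
    using op_sqrt_op_sqrt[OF psd_add_ident[OF psd(2)], of w] by (simp add: S_def H)
  have "psd R" "psd S" unfolding R_def S_def G H
    using psd_op_sqrt[OF psd_add_ident] psd by blast+
  then have DR: "D (R u) = S (D u)"
    by (rule psd_intertwine[OF _ _ D]) (simp add: RR SS linear_add[OF D])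
  have "L_tan D (R u) = (u, D u)"
    using bR by (simp add: L_tan_def R_def[symmetric] bij_is_inj)
  moreover have "inj (L_tan D)"
    using bij_imp_bij_inv[OF bR]
    by (auto intro!: injI simp: L_tan_def R_def[symmetric] bij_def dest: injD)
  ultimately have "inv (L_tan D) (u, D u) = R u" by (metis inv_f_f)
  then show ?thesis
    using bS by (simp add: J_op_def DR L_nor_def S_def[symmetric] bij_is_inj)
qed

section \<open>Singular values\<close>

lemma sorted_wrt_concat_replicate:
  fixes xs :: "'a::linorder list"
  assumes "sorted_wrt (\<ge>) xs"
  shows "sorted_wrt (\<ge>) (concat (map (\<lambda>x. replicate (m x) x) xs))"
  using assms
proof (induction xs)
  case (Cons x xs)
  have "sorted_wrt (\<ge>) (replicate k x)" for k by (induction k) auto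
  with Cons show ?case by (auto simp: sorted_wrt_append)
qed simp

lemma sorted_desc_first_two:
  fixes s :: "'a::linorder list"
  assumes s: "sorted_wrt (\<ge>) s" and ij: "i < length s" "j < length s" "i \<noteq> j"
    and ab: "s ! i = a" "s ! j = b" "b \<le> a"
  shows "2 \<le> length s" "a \<le> s ! 0" "b \<le> s ! 1"
proof -
  have mono: "s ! l \<le> s ! k" if "k \<le> l" "l < length s" for k l
    using s that by (cases "k = l") (auto simp: sorted_wrt_iff_nth_less)
  show "2 \<le> length s" using ij by linarith
  show "a \<le> s ! 0" using mono[of 0 i] ij ab by simp
  show "b \<le> s ! 1"
  proof (cases "1 \<le> j")
    case True
    then show ?thesis using mono[of 1 j] ij ab by simp
  next
    case False
    then have "1 \<le> i" using ij by linarith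
    then show ?thesis using mono[of 1 i] ij ab by simp
  qed
qed

text \<open>Needed because \<open>sorted_list_of_set\<close> inside \<open>eigenvalue_list\<close>
  is meaningful on finite sets only. An eigenvector is not orthogonal to every element of an
  eigenbasis, and symmetry makes the two eigenvalues agree.\<close>

lemma finite_eigenvalues:
  fixes R :: "'a::euclidean_space \<Rightarrow> 'a"
  assumes "linear R" "\<And>u v. R u \<bullet> v = u \<bullet> R v"
  shows "finite {\<mu>. \<exists>v. v \<noteq> 0 \<and> R v = \<mu> *\<^sub>R v}"
proof -
  obtain B where "eigenbasis R B" using selfadjoint_eigenbasis[OF assms] by blast
  then have B: "finite B" "span B = UNIV" and eig: "\<forall>b\<in>B. R b = (R b \<bullet> b) *\<^sub>R b"
    by (auto simp: eigenbasis_def)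
  have "\<mu> \<in> (\<lambda>b. R b \<bullet> b) ` B" if v: "v \<noteq> 0" "R v = \<mu> *\<^sub>R v" for \<mu> v
  proof -
    obtain b where b: "b \<in> B" "b \<bullet> v \<noteq> 0"
    proof (rule ccontr)
      assume "\<not> thesis"
      with that have "\<forall>b\<in>B. orthogonal v b" by (auto simp: orthogonal_def inner_commute)
      then have "orthogonal v v" using orthogonal_to_span[of v B v] B(2) by (simp add: orthogonal_commute)
      with v(1) show False by (simp add: orthogonal_def)
    qed
    have "(R b \<bullet> b) * (b \<bullet> v) = \<mu> * (b \<bullet> v)"
      using assms(2)[of b v] eig b(1) v(2) by (metis inner_scaleR_left inner_scaleR_right)
    with b show ?thesis by auto
  qed
  then have "{\<mu>. \<exists>v. v \<noteq> 0 \<and> R v = \<mu> *\<^sub>R v} \<subseteq> (\<lambda>b. R b \<bullet> b) ` B" by blast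
  with B(1) show ?thesis using finite_surj by blast
qed

text \<open>Lower bounds on two entries suffice, so the list is never computed. Distinct eigenvalues
  sit at distinct positions; a repeated one has an eigenspace of dimension at least 2 and therefore
  occurs in two adjacent positions.\<close>

lemma eigenvalue_list_first_two:
  fixes R :: "'a::euclidean_space \<Rightarrow> 'a"
  assumes R: "linear R" "\<And>u v. R u \<bullet> v = u \<bullet> R v"
    and e: "R e\<^sub>1 = \<nu>\<^sub>1 *\<^sub>R e\<^sub>1" "R e\<^sub>2 = \<nu>\<^sub>2 *\<^sub>R e\<^sub>2" "e\<^sub>1 \<noteq> 0" "e\<^sub>2 \<noteq> 0" "e\<^sub>1 \<bullet> e\<^sub>2 = 0"
    and le: "\<nu>\<^sub>2 \<le> \<nu>\<^sub>1"
  defines "s \<equiv> eigenvalue_list R"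
  shows "2 \<le> length s" "\<nu>\<^sub>1 \<le> s ! 0" "\<nu>\<^sub>2 \<le> s ! 1"
proof -
  define E where "E = {\<mu>. \<exists>v. v \<noteq> 0 \<and> R v = \<mu> *\<^sub>R v}"
  define xs where "xs = rev (sorted_list_of_set E)"
  define m where "m \<mu> = dim (eigenspace R \<mu>)" for \<mu>
  have fin: "finite E" unfolding E_def by (rule finite_eigenvalues[OF R])
  have xs: "set xs = E" "sorted_wrt (\<ge>) xs" using fin by (auto simp: xs_def sorted_wrt_rev)
  have s: "s = concat (map (\<lambda>\<mu>. replicate (m \<mu>) \<mu>) xs)"
    by (simp add: s_def eigenvalue_list_def xs_def E_def m_def)
  have sorted: "sorted_wrt (\<ge>) s" unfolding s by (rule sorted_wrt_concat_replicate[OF xs(2)])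
  have E: "\<nu>\<^sub>1 \<in> E" "\<nu>\<^sub>2 \<in> E" using e by (auto simp: E_def)
  have card_le: "card B \<le> m \<mu>" if "B \<subseteq> eigenspace R \<mu>" "pairwise orthogonal B" "0 \<notin> B" for B \<mu>
    unfolding m_def using that pairwise_orthogonal_independent independent_card_le_dim by blast
  have m1: "1 \<le> m \<nu>\<^sub>1" using card_le[of "{e\<^sub>1}" \<nu>\<^sub>1] e by (simp add: eigenspace_def)
  have m2: "1 \<le> m \<nu>\<^sub>2" using card_le[of "{e\<^sub>2}" \<nu>\<^sub>2] e by (simp add: eigenspace_def)
  obtain i j where "i < length s" "j < length s" "i \<noteq> j" "s ! i = \<nu>\<^sub>1" "s ! j = \<nu>\<^sub>2"
  proof (cases "\<nu>\<^sub>1 = \<nu>\<^sub>2")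
    case False
    have "\<nu>\<^sub>1 \<in> set s" "\<nu>\<^sub>2 \<in> set s" using E xs(1) m1 m2 by (force simp: s)+
    then show ?thesis using that False by (metis in_set_conv_nth)
  next
    case True
    have "e\<^sub>1 \<noteq> e\<^sub>2" using e by auto
    then have "card {e\<^sub>1, e\<^sub>2} = 2" by simp
    then have "2 \<le> m \<nu>\<^sub>1"
      using card_le[of "{e\<^sub>1, e\<^sub>2}" \<nu>\<^sub>1] e True
      by (auto simp: eigenspace_def pairwise_insert orthogonal_def inner_commute)
    then obtain k where k: "m \<nu>\<^sub>1 = Suc (Suc k)" by (metis add_2_eq_Suc le_Suc_ex)
    obtain ys zs where "xs = ys @ \<nu>\<^sub>1 # zs" using E xs(1) by (metis in_set_conv_decomp)
    then obtain us vs where "s = us @ \<nu>\<^sub>1 # \<nu>\<^sub>1 # vs" by (auto simp: s k)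
    then show ?thesis using that[of "length us" "Suc (length us)"] True
      by (simp add: nth_append)
  qed
  from sorted_desc_first_two[OF sorted this le]
  show "2 \<le> length s" "\<nu>\<^sub>1 \<le> s ! 0" "\<nu>\<^sub>2 \<le> s ! 1" .
qed

text \<open>The intertwining lemma again, now between multiplication by \<open>sqrt \<kappa>\<close>
  on the real line and \<open>R\<close>, along the map that sends \<open>t\<close> to
  \<open>t\<close> times \<open>e\<close>.\<close>

lemma psd_eigenvector_sqrt:
  fixes R :: "'a::euclidean_space \<Rightarrow> 'a"
  assumes "psd R" "R (R e) = \<kappa> *\<^sub>R e" "0 \<le> \<kappa>"
  shows "R e = sqrt \<kappa> *\<^sub>R e"
proof -
  have R: "linear R" using assms(1) by (simp add: psd_def)
  have "0 \<le> (sqrt \<kappa> * t) * t" for t using assms(3) by (simp add: mult.assoc)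
  then have "psd (\<lambda>t. sqrt \<kappa> * t)" by (auto simp: psd_def linear_iff algebra_simps)
  moreover have "linear (\<lambda>t. t *\<^sub>R e)" by (simp add: linear_iff algebra_simps)
  moreover have "(sqrt \<kappa> * (sqrt \<kappa> * t)) *\<^sub>R e = R (R (t *\<^sub>R e))" for t
    using assms(2,3) by (simp add: linear_scale[OF R] flip: mult.assoc)
  ultimately have "(sqrt \<kappa> * 1) *\<^sub>R e = R (1 *\<^sub>R e)"
    using psd_intertwine[of "\<lambda>t. sqrt \<kappa> * t" R "\<lambda>t. t *\<^sub>R e" 1] assms(1) by blast
  then show ?thesis by simp
qed

text \<open>The Gram determinant is the determinant of \<open>D \<circ> adjoint D\<close> on the
  plane, the product of its eigenvalues. If it exceeded 1, both would be positive, so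
  \<open>adjoint D f\<close> and \<open>adjoint D g\<close> would be nonzero orthogonal eigenvectors
  of the root of \<open>adjoint D \<circ> D\<close>, with eigenvalues whose product exceeds 1.
  Arguing by contradiction avoids the degenerate ranks, where these vectors may vanish.\<close>

lemma area_non_increasing_gram:
  fixes D :: "'a::euclidean_space \<Rightarrow> real^2"
  assumes D: "linear D" and le: "singular_value D 1 * singular_value D 2 \<le> 1"
  defines "d \<equiv> \<lambda>i. adjoint D (axis i 1)"
  shows "(d 1 \<bullet> d 1) * (d 2 \<bullet> d 2) - (d 1 \<bullet> d 2)\<^sup>2 \<le> 1"
proof -
  define K where "K = D \<circ> adjoint D"
  have D': "linear (adjoint D)" by (rule adjoint_linear[OF D])
  have K: "psd K" unfolding K_def by (rule psd_adjoint_comp[OF D])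
  then obtain B where "eigenbasis K B"
    using selfadjoint_eigenbasis[of K] by (auto simp: psd_def)
  then have B: "finite B" "pairwise orthogonal B" "span B = UNIV" "\<forall>b\<in>B. b \<bullet> b = 1"
    and eig: "\<forall>b\<in>B. K b = (K b \<bullet> b) *\<^sub>R b" by (auto simp: eigenbasis_def)
  have "0 \<notin> B" using B(4) by force
  then have "independent B" using B(2) by (rule pairwise_orthogonal_independent[rotated])
  then have "card B = 2" using B(3) dim_span_eq_card_independent[of B] by simp
  then obtain f g where fg: "B = {f, g}" "f \<noteq> g" by (meson card_2_iff)
  define \<kappa> where "\<kappa> b = K b \<bullet> b" for b
  have Kb: "K b = \<kappa> b *\<^sub>R b" if "b \<in> B" for b using eig that by (simp add: \<kappa>_def)
  have "\<exists>f g. B = {f, g} \<and> f \<noteq> g \<and> \<kappa> g \<le> \<kappa> f"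
  proof (cases "\<kappa> g \<le> \<kappa> f")
    case True with fg show ?thesis by blast
  next
    case False with fg show ?thesis by (intro exI[of _ g] exI[of _ f]) auto
  qed
  then obtain f g where fg: "B = {f, g}" "f \<noteq> g" "\<kappa> g \<le> \<kappa> f" by blast
  have on: "f \<bullet> f = 1" "g \<bullet> g = 1" "f \<bullet> g = 0"
    using B(2,4) fg by (auto simp: pairwise_def orthogonal_def)
  have inner: "adjoint D b \<bullet> adjoint D c = K b \<bullet> c" for b c
    by (simp add: K_def adjoint_inner(1)[OF D])
  have ff: "adjoint D f \<bullet> adjoint D f = \<kappa> f" "adjoint D g \<bullet> adjoint D g = \<kappa> g"
    "adjoint D f \<bullet> adjoint D g = 0"
    using on fg by (simp_all add: inner Kb)
  have expand: "adjoint D b = (b $ 1) *\<^sub>R d 1 + (b $ 2) *\<^sub>R d 2" for b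
  proof -
    have "b = (b $ 1) *\<^sub>R axis 1 1 + (b $ 2) *\<^sub>R axis 2 1"
      by (simp add: vec_eq_iff forall_2 axis_def)
    then show ?thesis unfolding d_def by (metis linear_add[OF D'] linear_scale[OF D'])
  qed
  \<comment> \<open>The determinant of the change from the standard basis to \<open>f\<close>,
    \<open>g\<close>; it is 1 or -1, and Gram determinants are multiplied by its square.\<close>
  define \<delta> where "\<delta> = f $ 1 * g $ 2 - f $ 2 * g $ 1"
  have "\<delta>\<^sup>2 = (f \<bullet> f) * (g \<bullet> g) - (f \<bullet> g)\<^sup>2"
    by (simp add: \<delta>_def inner_vec_def sum_2) algebra
  then have \<delta>: "\<delta>\<^sup>2 = 1" using on by simp
  have "\<kappa> f * \<kappa> g = (adjoint D f \<bullet> adjoint D f) * (adjoint D g \<bullet> adjoint D g) - (adjoint D f \<bullet> adjoint D g)\<^sup>2"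
    by (simp add: ff)
  also have "\<dots> = \<delta>\<^sup>2 * ((d 1 \<bullet> d 1) * (d 2 \<bullet> d 2) - (d 1 \<bullet> d 2)\<^sup>2)"
    unfolding expand \<delta>_def inner_add_left inner_add_right inner_scaleR_left inner_scaleR_right
      inner_commute[of "d 2" "d 1"]
    by algebra
  finally have prod: "\<kappa> f * \<kappa> g = (d 1 \<bullet> d 1) * (d 2 \<bullet> d 2) - (d 1 \<bullet> d 2)\<^sup>2" using \<delta> by simp
  show ?thesis
  proof (rule ccontr)
    assume "\<not> ?thesis"
    then have gt: "\<kappa> f * \<kappa> g > 1" using prod by simp
    have nn: "0 \<le> \<kappa> f" "0 \<le> \<kappa> g" using ff(1,2) inner_ge_zero by metis+
    with gt have pos: "0 < \<kappa> f" "0 < \<kappa> g" by (auto simp: order_less_le)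
    define R where "R = op_sqrt (adjoint D \<circ> D)"
    have R: "psd R" and RR: "R (R v) = adjoint D (D v)" for v
      using psd_op_sqrt op_sqrt_op_sqrt psd_adjoint_comp(1)[OF D] by (fastforce simp: R_def)+
    have Re: "R (adjoint D b) = sqrt (\<kappa> b) *\<^sub>R adjoint D b" if "b \<in> B" for b
    proof (rule psd_eigenvector_sqrt[OF R])
      have "D (adjoint D b) = \<kappa> b *\<^sub>R b" using Kb[OF that] by (simp add: K_def)
      then show "R (R (adjoint D b)) = \<kappa> b *\<^sub>R adjoint D b"
        by (simp add: RR linear_scale[OF D'])
      show "0 \<le> \<kappa> b" using that nn fg by auto
    qed
    define s where "s = eigenvalue_list R"
    have R': "linear R" "\<And>u v. R u \<bullet> v = u \<bullet> R v" using R unfolding psd_def by blast+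
    have "2 \<le> length s \<and> sqrt (\<kappa> f) \<le> s ! 0 \<and> sqrt (\<kappa> g) \<le> s ! 1"
      unfolding s_def
      using eigenvalue_list_first_two[OF R' Re[of f] Re[of g]] fg pos ff by force
    then have s: "2 \<le> length s" "sqrt (\<kappa> f) \<le> s ! 0" "sqrt (\<kappa> g) \<le> s ! 1" by auto
    have "sqrt (\<kappa> f) * sqrt (\<kappa> g) \<le> s ! 0 * s ! 1"
      using s nn by (intro mult_mono) (auto intro: order_trans[rotated])
    also have "\<dots> \<le> 1" using le s(1) by (simp add: singular_value_def s_def R_def Let_def)
    finally have "sqrt (\<kappa> f * \<kappa> g) \<le> 1" by (simp add: real_sqrt_mult)
    with gt show False by simp
  qed
qed

section \<open>Alternating forms and determinants\<close>

lemma alternating_form_swap: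
  assumes \<xi>: "alternating_form k \<xi>" and ij: "i < k" "j < k" "i \<noteq> j"
  shows "\<xi> (v(i := v j, j := v i)) = - \<xi> v"
proof -
  define h where "h x y = \<xi> (v(i := x, j := y))" for x y
  have "linear (h x)" for x
    using \<xi> ij unfolding alternating_form_def h_def by blast
  then have right: "h x (y + z) = h x y + h x z" for x y z by (rule linear_add)
  have h: "h x y = \<xi> ((v(j := y))(i := x))" for x y
    using ij by (simp add: h_def fun_upd_twist)
  have "linear (\<lambda>x. h x y)" for y
    using \<xi> ij unfolding alternating_form_def h by blast
  then have left: "h (x + y) z = h x z + h y z" for x y z by (rule linear_add)
  have diag: "h x x = 0" for x
  proof -
    have "(v(i := x, j := x)) i = (v(i := x, j := x)) j" by simp
    then show ?thesis using \<xi> ij unfolding alternating_form_def h_def by blast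
  qed
  have "h (v i + v j) (v i + v j) = 0" by (rule diag)
  then have "h (v i) (v j) + h (v j) (v i) = 0" unfolding left right by (simp add: diag)
  then show ?thesis using ij by (simp add: h_def)
qed

text \<open>Moving \<open>e\<close> from the front into slot \<open>i\<close> takes \<open>i\<close>
  adjacent transpositions.\<close>

lemma alternating_form_case_nat_omit:
  assumes \<xi>: "alternating_form k \<xi>"
  shows "i < k \<Longrightarrow> \<xi> (case_nat e (omit i v)) = (-1) ^ i * \<xi> (v(i := e))"
proof (induction i arbitrary: v)
  case 0
  have "case_nat e (omit 0 v) = v(0 := e)"
    by (rule ext) (auto simp: omit_def split: nat.split)
  then show ?case by simp
next
  case (Suc i)
  let ?u = "v(Suc i := e)"
  let ?v = "v(i := v (Suc i), Suc i := v i)"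
  have "case_nat e (omit (Suc i) v) = case_nat e (omit i ?v)"
    by (rule ext) (auto simp: omit_def less_Suc_eq split: nat.split)
  then have "\<xi> (case_nat e (omit (Suc i) v)) = (-1) ^ i * \<xi> (?v(i := e))"
    using Suc.IH[of ?v] Suc.prems by (simp only: Suc_lessD)
  also have "?v(i := e) = ?u(i := ?u (Suc i), Suc i := ?u i)" by (rule ext) auto
  also have "\<xi> \<dots> = - \<xi> ?u"
    using Suc.prems by (intro alternating_form_swap[OF \<xi>]) auto
  finally show ?case by (simp only: power_Suc mult_minus_right mult_minus_left mult_1_left)
qed

text \<open>The sign of the wedge product cancels the sign of moving \<open>e\<close> into slot
  \<open>i\<close>. What remains is a sign-free substitution formula, the working form of
  \<open>Psi\<close> from here on.\<close>

lemma covector_wedge_interior_mult: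
  assumes "alternating_form k \<xi>"
  shows "covector_wedge k \<alpha> (interior_mult e \<xi>) v = (\<Sum>i<k. \<alpha> (v i) * \<xi> (v(i := e)))"
  unfolding covector_wedge_def interior_mult_def
proof (rule sum.cong[OF refl])
  fix i assume "i \<in> {..<k}"
  moreover have "(-1::real) ^ i * (-1) ^ i = 1" by (simp flip: power_add mult_2)
  ultimately show "(-1) ^ i * \<alpha> (v i) * \<xi> (case_nat e (omit i v)) = \<alpha> (v i) * \<xi> (v(i := e))"
    using alternating_form_case_nat_omit[OF assms, of i e v]
    by (simp add: algebra_simps)
qed

lemma covector_wedge_anticommute:
  "covector_wedge (Suc k) \<alpha> (covector_wedge k \<beta> \<eta>) v =
    - covector_wedge (Suc k) \<beta> (covector_wedge k \<alpha> \<eta>) v"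
proof -
  let ?I = "{..<Suc k} \<times> {..<k}"
  define f where "f \<alpha> \<beta> = (\<lambda>(i, j). (-1) ^ (i + j) * \<alpha> (v i) * \<beta> (omit i v j) * \<eta> (omit j (omit i v)))"
    for \<alpha> \<beta> :: "'a \<Rightarrow> real"
  have expand: "covector_wedge (Suc k) \<alpha> (covector_wedge k \<beta> \<eta>) v = sum (f \<alpha> \<beta>) ?I" for \<alpha> \<beta>
    unfolding covector_wedge_def f_def sum.cartesian_product[symmetric]
    by (intro sum.cong refl) (simp add: sum_distrib_left power_add mult_ac del: sum.lessThan_Suc)
  \<comment> \<open>Pairs record which argument is removed first and which second. The map exchanges
    the order of removal; \<open>i - 1\<close> and \<open>Suc j\<close> account for the shift caused
    by the first removal, and the parity of \<open>i + j\<close> flips.\<close>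
  define \<sigma> where "\<sigma> = (\<lambda>(i, j). if j < i then (j, i - 1) else (Suc j, i))"
  have "sum (f \<alpha> \<beta>) ?I = (\<Sum>p\<in>?I. - f \<beta> \<alpha> p)"
  proof (rule sum.reindex_bij_witness[of _ \<sigma> \<sigma>])
    fix p assume p: "p \<in> ?I"
    obtain i j where [simp]: "p = (i, j)" by (cases p)
    show "\<sigma> (\<sigma> p) = p" "\<sigma> p \<in> ?I" using p by (auto simp: \<sigma>_def)
    show "- f \<beta> \<alpha> (\<sigma> p) = f \<alpha> \<beta> p"
    proof (cases "j < i")
      case True
      then obtain l where i: "i = Suc l" by (cases i) auto
      have "omit l (omit j v) = omit j (omit i v)"
        using True i by (auto simp: omit_def)
      then show ?thesis using True i by (simp add: f_def \<sigma>_def omit_def[of _ v] mult_ac add.commute)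
    next
      case False
      then have "omit i (omit (Suc j) v) = omit j (omit i v)"
        by (auto simp: omit_def)
      then show ?thesis using False by (simp add: f_def \<sigma>_def omit_def[of _ v] mult_ac add.commute)
    qed
  qed (auto simp: \<sigma>_def split: if_splits)
  then show ?thesis by (simp add: expand sum_negf)
qed

lemma strict_mono_index_pos: "strict_mono (index_pos :: 'n::{finite,linorder} \<Rightarrow> nat)"
  by (intro strict_monoI) (auto simp: index_pos_def intro!: psubset_card_mono)

lemma index_pos_less: "index_pos (i :: 'n::{finite,linorder}) < CARD('n)"
  unfolding index_pos_def by (rule psubset_card_mono) auto

lemma bij_betw_index_pos:
  "bij_betw index_pos (UNIV :: 'n::{finite,linorder} set) {..<CARD('n)}"
proof -
  have inj: "inj (index_pos :: 'n \<Rightarrow> nat)" using strict_mono_index_pos strict_mono_imp_inj_on by blast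
  moreover have "range (index_pos :: 'n \<Rightarrow> nat) = {..<CARD('n)}"
    by (rule card_subset_eq) (auto simp: index_pos_less card_image inj)
  ultimately show ?thesis by (simp add: bij_betw_def)
qed

lemma index_pos_eq_iff [simp]: "index_pos i = index_pos j \<longleftrightarrow> i = (j :: 'n::{finite,linorder})"
  using strict_mono_index_pos strict_mono_eq by blast

lemma index_pos_surj:
  "\<exists>j :: 'n::{finite,linorder}. i = index_pos j" if "i < CARD('n)"
  using that bij_betw_index_pos[where 'n='n] by (metis bij_betw_imp_surj_on imageE lessThan_iff)

lemma sum_index_pos:
  "(\<Sum>j\<in>(UNIV :: 'n::{finite,linorder} set). f (index_pos j)) = (\<Sum>i<CARD('n). f i)"
  using sum.reindex_bij_betw[OF bij_betw_index_pos[where 'n='n], of f] by simp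

section \<open>Determinants whose entries are linear in a parameter\<close>

lemma pderiv_det:
  fixes M :: "real poly^'n^'n"
  shows "pderiv (det M) = (\<Sum>k\<in>UNIV. det (\<chi> j. if j = k then (\<chi> i. pderiv (M $ j $ i)) else M $ j))"
proof -
  have prod: "(\<Prod>j\<in>UNIV. (\<chi> j. if j = k then (\<chi> i. pderiv (M $ j $ i)) else M $ j) $ j $ p j) =
      prod (\<lambda>j. M $ j $ p j) (UNIV - {k}) * pderiv (M $ k $ p k)" for k :: 'n and p
    by (subst prod.remove[of _ k]) (auto intro!: prod.cong)
  have of_int: "pderiv (of_int s * q) = of_int s * pderiv q" for s and q :: "real poly"
    by (simp add: pderiv_mult of_int_poly pderiv_smult)
  have "pderiv (det M) = (\<Sum>p | p permutes UNIV. of_int (sign p) *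
      (\<Sum>k\<in>UNIV. prod (\<lambda>j. M $ j $ p j) (UNIV - {k}) * pderiv (M $ k $ p k)))"
    by (simp add: det_def higher_pderiv_sum[of 1, simplified] of_int pderiv_prod)
  also have "\<dots> = (\<Sum>k\<in>UNIV. det (\<chi> j. if j = k then (\<chi> i. pderiv (M $ j $ i)) else M $ j))"
    unfolding det_def prod sum_distrib_left by (rule sum.swap)
  finally show ?thesis .
qed

lemma poly_det: "poly (det M) t = det (\<chi> j i. poly (M $ j $ i) t)"
  by (simp add: det_def poly_sum poly_prod)

text \<open>The determinant with rows \<open>P (v j) + t Q (v j)\<close>, kept as a formal
  polynomial in \<open>t\<close> so that iterates of \<open>Psi\<close> can be read off as
  coefficients.\<close>

definition pdet ::
    "('v \<Rightarrow> real^'n::{finite,linorder}) \<Rightarrow> ('v \<Rightarrow> real^'n::_) \<Rightarrow> (nat \<Rightarrow> 'v) \<Rightarrow> real poly" where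
  "pdet P Q v = det (\<chi> j i. [:P (v (index_pos j)) $ i, Q (v (index_pos j)) $ i:])"

lemma pdet_upd:
  "pdet P Q (v(index_pos k := x)) =
    det (\<chi> j. if j = k then (\<chi> i. [:P x $ i, Q x $ i:])
             else (\<chi> i. [:P (v (index_pos j)) $ i, Q (v (index_pos j)) $ i:]))"
  unfolding pdet_def by (rule arg_cong[where f=det]) (simp add: vec_eq_iff)

lemma poly_pdet: "poly (pdet P Q v) t = det (\<chi> j. P (v (index_pos j)) + t *\<^sub>R Q (v (index_pos j)))"
  unfolding pdet_def poly_det by (rule arg_cong[where f=det]) (simp add: vec_eq_iff)

text \<open>Substituting \<open>A w\<close> for \<open>w\<close> turns the row
  \<open>P w + t Q w\<close> into \<open>Q w\<close>, which is its derivative in \<open>t\<close>;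
  the right-hand side is thus the product rule over the rows.\<close>

lemma pderiv_pdet:
  fixes P :: "'v \<Rightarrow> real^'n::{finite,linorder}"
  assumes "\<And>w. P (A w) = Q w" "\<And>w. Q (A w) = 0"
  shows "pderiv (pdet P Q v) = (\<Sum>i<CARD('n). pdet P Q (v(i := A (v i))))"
  unfolding sum_index_pos[symmetric] pdet_upd assms
  unfolding pdet_def pderiv_det
  by (intro sum.cong refl arg_cong[where f=det])
     (simp add: vec_eq_iff pderiv_pCons)

text \<open>Stated for any linear functional \<open>\<phi>\<close> on polynomials, so that it serves
  for coefficients, for values at a point and for the combination of a value and a derivative that
  defines \<open>Theta\<close>.\<close>

lemma alternating_form_pdet:
  fixes P :: "'v::real_vector \<Rightarrow> real^'n::{finite,linorder}" and \<phi> :: "real poly \<Rightarrow> real"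
  assumes lin: "linear P" "linear Q"
    and \<phi>: "\<And>p q. \<phi> (p + q) = \<phi> p + \<phi> q" "\<And>c p. \<phi> (smult c p) = c * \<phi> p"
  shows "alternating_form CARD('n) (\<lambda>v. \<phi> (pdet P Q v))"
  unfolding alternating_form_def
proof (intro conjI allI impI)
  fix v w :: "nat \<Rightarrow> 'v"
  assume "\<forall>i<CARD('n). v i = w i"
  then have "pdet P Q v = pdet P Q w" by (simp add: pdet_def index_pos_less)
  then show "\<phi> (pdet P Q v) = \<phi> (pdet P Q w)" by simp
next
  fix v :: "nat \<Rightarrow> 'v" and i assume "i < CARD('n)"
  then obtain k :: 'n where k: "i = index_pos k" using index_pos_surj by blast
  let ?c = "\<lambda>j. \<chi> i. [:P (v (index_pos j)) $ i, Q (v (index_pos j)) $ i:]"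
  show "linear (\<lambda>x. \<phi> (pdet P Q (v(i := x))))"
  proof (rule linearI)
    fix x y
    have row: "(\<chi> i. [:P (x + y) $ i, Q (x + y) $ i:]) = (\<chi> i. [:P x $ i, Q x $ i:]) + (\<chi> i. [:P y $ i, Q y $ i:])"
      using lin by (simp add: vec_eq_iff linear_add)
    show "\<phi> (pdet P Q (v(i := x + y))) = \<phi> (pdet P Q (v(i := x))) + \<phi> (pdet P Q (v(i := y)))"
      unfolding k pdet_upd row
      using det_row_add[of k "\<lambda>_. \<chi> i. [:P x $ i, Q x $ i:]" "\<lambda>_. \<chi> i. [:P y $ i, Q y $ i:]" ?c]
      by (simp add: \<phi>)
  next
    fix c x
    have row: "(\<chi> i. [:P (c *\<^sub>R x) $ i, Q (c *\<^sub>R x) $ i:]) = [:c:] *s (\<chi> i. [:P x $ i, Q x $ i:])"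
      using lin by (simp add: vec_eq_iff linear_scale)
    show "\<phi> (pdet P Q (v(i := c *\<^sub>R x))) = c *\<^sub>R \<phi> (pdet P Q (v(i := x)))"
      unfolding k pdet_upd row
      using det_row_mul[of k "[:c:]" "\<lambda>_. \<chi> i. [:P x $ i, Q x $ i:]" ?c]
      by (simp add: \<phi>)
  qed
next
  fix v :: "nat \<Rightarrow> 'v" and i j
  assume "i < CARD('n)" "j < CARD('n)" and neq: "i \<noteq> j" and eq: "v i = v j"
  then obtain k l :: 'n where "i = index_pos k" "j = index_pos l" by (metis index_pos_surj)
  then have "pdet P Q v = 0" unfolding pdet_def
    using neq eq by (intro det_identical_rows[of k l]) (auto simp: row_def)
  moreover have "\<phi> 0 = 0" using \<phi>(2)[of 0 0] by simp
  ultimately show "\<phi> (pdet P Q v) = 0" by simp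
qed

section \<open>Rank-one updates of determinants\<close>

lemma det_rows_add_multiples:
  fixes a :: "'n::finite \<Rightarrow> real^'n"
  shows "finite S \<Longrightarrow> det (\<chi> i. if i \<in> S then a i + c i *\<^sub>R w else a i) =
    det (\<chi> i. a i) + (\<Sum>k\<in>S. c k * det (\<chi> i. if i = k then w else a i))"
proof (induction S arbitrary: a rule: finite_induct)
  case (insert k S)
  let ?a = "\<lambda>i. if i \<in> S then a i + c i *\<^sub>R w else a i"
  have "(\<chi> i. if i \<in> insert k S then a i + c i *\<^sub>R w else a i) =
      (\<chi> i. if i = k then a i + c i *s w else ?a i)"
    by (auto simp: vec_eq_iff)
  then have "det (\<chi> i. if i \<in> insert k S then a i + c i *\<^sub>R w else a i) =
      det (\<chi> i. if i = k then a i else ?a i) + det (\<chi> i. if i = k then c k *s w else ?a i)"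
    using det_row_add[of k a "\<lambda>i. c i *s w" ?a] by (simp cong: if_cong)
  also have "(\<chi> i. if i = k then a i else ?a i) = (\<chi> i. ?a i)"
    using insert.hyps by (auto simp: vec_eq_iff)
  also have "det (\<chi> i. if i = k then c k *s w else ?a i) = c k * det (\<chi> i. if i = k then w else ?a i)"
    using det_row_mul[of k "c k" "\<lambda>_. w" ?a] by simp
  also have "(\<chi> i. if i = k then w else ?a i) =
      (\<chi> i. if i \<in> S then (a(k := w)) i + c i *\<^sub>R w else (a(k := w)) i)"
    using insert.hyps by (auto simp: vec_eq_iff)
  also have "det \<dots> = det (\<chi> i. (a(k := w)) i) + (\<Sum>l\<in>S. c l * det (\<chi> i. if i = l then w else (a(k := w)) i))"
    by (rule insert.IH)
  \<comment> \<open>The vector \<open>w\<close> now occupies rows \<open>k\<close> and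
    \<open>l\<close>, so the expansion stops at first order.\<close>
  also have "(\<Sum>l\<in>S. c l * det (\<chi> i. if i = l then w else (a(k := w)) i)) = 0"
  proof (intro sum.neutral ballI)
    fix l assume "l \<in> S"
    then have "l \<noteq> k" using insert.hyps by auto
    then have "det (\<chi> i. if i = l then w else (a(k := w)) i) = 0"
      by (intro det_identical_rows[of l k]) (auto simp: row_def)
    then show "c l * det (\<chi> i. if i = l then w else (a(k := w)) i) = 0" by simp
  qed
  also have "(\<chi> i. (a(k := w)) i) = (\<chi> i. if i = k then w else a i)" by (auto simp: vec_eq_iff)
  finally show ?case using insert insert.IH[of a] by (simp add: algebra_simps)
qed simp

lemma det_replace_row_I:
  fixes w :: "real^'n::finite"
  shows "det (\<chi> i. if i = k then w else axis i 1) = w $ k"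
proof -
  have "(\<Sum>i\<in>UNIV. w $ i *s row i (mat 1)) = w"
    by (simp add: vec_eq_iff row_def mat_def if_distrib cong: if_cong)
  moreover have "row i (mat 1 :: real^'n^'n) = axis i 1" for i
    by (simp add: vec_eq_iff row_def mat_def axis_def)
  ultimately show ?thesis using cramer_lemma_transpose[of k w "mat 1"] by (simp cong: if_cong)
qed

lemma det_I_plus_rank_one:
  fixes c w :: "real^'n::finite"
  shows "det (\<chi> i. axis i 1 + c $ i *\<^sub>R w) = 1 + c \<bullet> w"
proof -
  have "(\<chi> i. axis i 1) = (mat 1 :: real^'n^'n)" by (simp add: vec_eq_iff mat_def axis_def)
  then show ?thesis
    using det_rows_add_multiples[of UNIV "\<lambda>i. axis i 1" "\<lambda>i. c $ i" w]
    by (simp add: det_replace_row_I inner_vec_def)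
qed

text \<open>The updated rows are those of the product of the matrix \<open>a\<close> with the
  identity plus the outer product of \<open>c\<close> and \<open>w\<close>.\<close>

lemma det_rank_one_update:
  fixes a :: "'n::finite \<Rightarrow> real^'n"
  shows "det (\<chi> i. a i + (c \<bullet> a i) *\<^sub>R w) = (1 + c \<bullet> w) * det (\<chi> i. a i)"
proof -
  have "(\<chi> i. a i + (c \<bullet> a i) *\<^sub>R w) = (\<chi> i. a i) ** (\<chi> i. axis i 1 + c $ i *\<^sub>R w)"
    by (simp add: vec_eq_iff matrix_matrix_mult_def axis_def inner_vec_def sum.distrib
        distrib_left sum_distrib_left mult_delta_right mult_ac)
  then show ?thesis by (simp add: det_mul det_I_plus_rank_one)
qed

text \<open>Compares the first-order expansion with the product formula. In terms of forms: wedging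
  the contraction of a top form by \<open>w\<close> with the covector \<open>c\<close> multiplies
  the form by \<open>c \<bullet> w\<close>.\<close>

lemma sum_inner_det_replace_row:
  fixes a :: "'n::finite \<Rightarrow> real^'n"
  shows "(\<Sum>k\<in>UNIV. (c \<bullet> a k) * det (\<chi> i. if i = k then w else a i)) = (c \<bullet> w) * det (\<chi> i. a i)"
  using det_rows_add_multiples[of UNIV a "\<lambda>i. c \<bullet> a i" w] det_rank_one_update[of a c w]
  by (simp add: algebra_simps)

lemma det_I_plus_two:
  fixes z\<^sub>1 z\<^sub>2 :: "real^'n::finite"
  shows "det (\<chi> i. axis i 1 + z\<^sub>1 $ i *\<^sub>R z\<^sub>1 + z\<^sub>2 $ i *\<^sub>R z\<^sub>2) =
    (1 + z\<^sub>1 \<bullet> z\<^sub>1) * (1 + z\<^sub>2 \<bullet> z\<^sub>2) - (z\<^sub>1 \<bullet> z\<^sub>2)\<^sup>2"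
proof -
  let ?t = "1 + z\<^sub>1 \<bullet> z\<^sub>1"
  have t: "?t > 0" by (simp add: add_pos_nonneg)
  \<comment> \<open>Sherman-Morrison: \<open>c\<close> solves
    \<open>c + (z\<^sub>1 \<bullet> c) z\<^sub>1 = z\<^sub>2\<close>, so the second update has the
    shape of a rank-one update of the already updated rows.\<close>
  define c where "c = z\<^sub>2 - ((z\<^sub>1 \<bullet> z\<^sub>2) / ?t) *\<^sub>R z\<^sub>1"
  have "c \<bullet> (axis i 1 + z\<^sub>1 $ i *\<^sub>R z\<^sub>1) = z\<^sub>2 $ i" for i
  proof -
    have "c \<bullet> (axis i 1 + z\<^sub>1 $ i *\<^sub>R z\<^sub>1) = z\<^sub>2 $ i + z\<^sub>1 $ i * ((z\<^sub>1 \<bullet> z\<^sub>2) - ((z\<^sub>1 \<bullet> z\<^sub>2) / ?t) * ?t)"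
      unfolding c_def
      by (simp add: inner_add inner_diff inner_axis inner_commute[of z\<^sub>2 z\<^sub>1] algebra_simps add_divide_distrib)
    then show ?thesis using t by simp
  qed
  then have "det (\<chi> i. axis i 1 + z\<^sub>1 $ i *\<^sub>R z\<^sub>1 + z\<^sub>2 $ i *\<^sub>R z\<^sub>2) = (1 + c \<bullet> z\<^sub>2) * ?t"
    using det_rank_one_update[of "\<lambda>i. axis i 1 + z\<^sub>1 $ i *\<^sub>R z\<^sub>1" c z\<^sub>2] det_I_plus_rank_one[of z\<^sub>1 z\<^sub>1]
    by simp
  also have "\<dots> = ?t * (1 + z\<^sub>2 \<bullet> z\<^sub>2) - (z\<^sub>1 \<bullet> z\<^sub>2)\<^sup>2"
    using t by (simp add: c_def inner_diff field_simps power2_eq_square)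
  finally show ?thesis .
qed

section \<open>The operator \<open>\<Psi>\<close>\<close>

text \<open>Represents in the parameter space the inner product of \<open>w\<close> with tangent
  vectors \<open>(u, D u)\<close>; \<open>nor_pairing\<close> does the same for their images under
  \<open>J_op D\<close>. Both are therefore rows of determinants of size \<open>n\<close>.\<close>

definition tan_pairing :: "('a::euclidean_space \<Rightarrow> 'b::euclidean_space) \<Rightarrow> 'a \<times> 'b \<Rightarrow> 'a" where
  "tan_pairing D w = fst w + adjoint D (snd w)"

definition nor_pairing :: "('a::euclidean_space \<Rightarrow> 'b::euclidean_space) \<Rightarrow> 'a \<times> 'b \<Rightarrow> 'a" where
  "nor_pairing D w = adjoint D (snd w - D (fst w))"

lemma frechet_derivative_graph_map:
  assumes "F differentiable (at x)"
  shows "frechet_derivative (graph_map F) (at x) = (\<lambda>u. (u, frechet_derivative F (at x) u))"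
proof -
  have "(graph_map F has_derivative (\<lambda>u. (u, frechet_derivative F (at x) u))) (at x)"
    unfolding graph_map_def
    using assms by (intro has_derivative_Pair has_derivative_ident) (simp add: frechet_derivative_works)
  then show ?thesis by (metis frechet_derivative_at)
qed

lemma tangent_space_graph_map:
  assumes "F differentiable (at x)"
  shows "tangent_space (graph_map F) x = range (\<lambda>u. (u, frechet_derivative F (at x) u))"
  by (simp add: tangent_space_def frechet_derivative_graph_map[OF assms])

context
  fixes D :: "'a::euclidean_space \<Rightarrow> 'b::euclidean_space"
  assumes D: "linear D"
begin

lemma linear_pairing: "linear (tan_pairing D)" "linear (nor_pairing D)"
  unfolding tan_pairing_def nor_pairing_def
  using D adjoint_linear[OF D]
  by (auto intro!: linearI simp: linear_add linear_scale linear_diff algebra_simps)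

lemma linear_G_op: "linear (G_op D)"
  using psd_add_ident[OF psd_adjoint_comp(1)[OF D]] by (simp add: G_op_def psd_def)

lemma inner_tan_pairing: "u \<bullet> tan_pairing D w = (u, D u) \<bullet> w"
  by (simp add: tan_pairing_def inner_prod_def inner_add_right adjoint_inner[OF D])

lemma tan_pairing_graph: "tan_pairing D (u, D u) = G_op D u"
  by (simp add: tan_pairing_def G_op_def)

lemma nor_pairing_graph: "nor_pairing D (u, D u) = 0"
  by (simp add: nor_pairing_def linear_0[OF adjoint_linear[OF D]])

text \<open>The cancellation of the vertical component that singles out the evaluation at
  -1.\<close>

lemma tan_minus_nor_pairing: "tan_pairing D w - nor_pairing D w = G_op D (fst w)"
  by (simp add: tan_pairing_def nor_pairing_def G_op_def linear_diff[OF adjoint_linear[OF D]])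

lemma inner_J_op_graph: "J_op D (u, D u) \<bullet> w = (u, D u) \<bullet> (nor_pairing D w, 0)"
  by (simp add: J_op_graph[OF D] nor_pairing_def inner_prod_def adjoint_inner[OF D]
      inner_diff_right)

end

lemma det_linear_image_rows:
  fixes a :: "'n::finite \<Rightarrow> real^'n"
  assumes "linear f"
  shows "det (\<chi> j. f (a j)) = det (\<chi> i. f (axis i 1)) * det (\<chi> j. a j)"
proof -
  have "f (a j) $ i = (\<Sum>k\<in>UNIV. a j $ k * f (axis k 1) $ i)" for i j
  proof -
    have "f (a j) = f (\<Sum>k\<in>UNIV. (a j $ k) *\<^sub>R axis k 1)"
      using basis_expansion[of "a j"] by (simp add: scalar_mult_eq_scaleR)
    also have "\<dots> = (\<Sum>k\<in>UNIV. (a j $ k) *\<^sub>R f (axis k 1))"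
      using assms by (simp add: linear_sum linear_scale)
    finally show ?thesis by simp
  qed
  then have "(\<chi> j. f (a j)) = (\<chi> j. a j) ** (\<chi> i. f (axis i 1))"
    by (simp add: vec_eq_iff matrix_matrix_mult_def)
  then show ?thesis by (simp add: det_mul mult.commute)
qed

lemma det_inner_rows:
  fixes a b :: "'n::finite \<Rightarrow> real^'n"
  shows "det (\<chi> i j. a i \<bullet> b j) = det (\<chi> i. a i) * det (\<chi> j. b j)"
proof -
  have "(\<chi> i j. a i \<bullet> b j) = (\<chi> i. a i) ** transpose (\<chi> j. b j)"
    by (simp add: vec_eq_iff matrix_matrix_mult_def transpose_def inner_vec_def)
  then show ?thesis by (simp add: det_mul)
qed

context
  fixes F :: "real^'n::{finite,linorder} \<Rightarrow> real^'m" and x :: "real^'n::_"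
    and D :: "real^'n::_ \<Rightarrow> real^'m" and g :: real
  assumes F: "F differentiable (at x)"
  defines D_def: "D \<equiv> frechet_derivative F (at x)"
    and g_def: "g \<equiv> det (\<chi> i. G_op D (axis i 1))"
begin

lemma linear_D: "linear D"
  unfolding D_def by (rule linear_frechet_derivative[OF F])

lemma tangent_space_D: "tangent_space (graph_map F) x = range (\<lambda>u. (u, D u))"
  unfolding D_def by (rule tangent_space_graph_map[OF F])

lemma frame_det:
  assumes "\<And>i j. (u i, D (u i)) \<bullet> (u j, D (u j)) = (if i = j then 1 else (0::real))"
  shows "(det (\<chi> i. u i))\<^sup>2 * g = 1"
proof -
  have "(\<chi> i j. u i \<bullet> G_op D (u j)) = mat 1"
    using assms by (simp add: vec_eq_iff mat_def inner_tan_pairing[OF linear_D]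
        flip: tan_pairing_graph[OF linear_D])
  then have "det (\<chi> i. u i) * det (\<chi> j. G_op D (u j)) = 1"
    by (metis det_inner_rows det_I)
  then show ?thesis
    using det_linear_image_rows[OF linear_G_op[OF linear_D], of u]
    by (simp add: g_def power2_eq_square mult_ac)
qed

lemma positive_frame_exists: "\<exists>e. positive_frame F x e"
proof -
  define R where "R = op_sqrt (G_op D)"
  have G: "G_op D = (\<lambda>v. v + (adjoint D \<circ> D) v)" by (auto simp: G_op_def)
  note psd = psd_adjoint_comp(1)[OF linear_D]
  have R: "R (inv R v) = v" "psd R" and RR: "R (R v) = G_op D v" for v
    using bij_op_sqrt_add_ident[OF psd] psd_op_sqrt[OF psd_add_ident[OF psd]]
      op_sqrt_op_sqrt[OF psd_add_ident[OF psd]]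
    by (simp_all add: R_def G bij_is_surj surj_f_inv_f)
  define u :: "'n \<Rightarrow> real^'n::_" where "u i = inv R (axis i 1)" for i
  have on: "(u i, D (u i)) \<bullet> (u j, D (u j)) = (if i = j then 1 else 0)" for i j
  proof -
    have "(u i, D (u i)) \<bullet> (u j, D (u j)) = u i \<bullet> R (R (u j))"
      by (simp add: RR inner_tan_pairing[OF linear_D] flip: tan_pairing_graph[OF linear_D])
    also have "\<dots> = R (u i) \<bullet> R (u j)" using R(2) unfolding psd_def by metis
    also have "\<dots> = (if i = j then 1 else 0)" by (simp add: u_def R inner_axis_axis)
    finally show ?thesis .
  qed
  have frame: "positive_frame F x (\<lambda>i. (u i, D (u i)))" if "det (\<chi> i. u i) > 0"
    "\<And>i j. (u i, D (u i)) \<bullet> (u j, D (u j)) = (if i = j then 1 else 0)" for u :: "'n \<Rightarrow> real^'n::_"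
    unfolding positive_frame_def tangent_space_D using that by auto
  show ?thesis
  proof (cases "det (\<chi> i. u i) > 0")
    case True
    then show ?thesis using frame[OF True on] by blast
  next
    case False
    moreover have "det (\<chi> i. u i) \<noteq> 0" using frame_det[OF on] by auto
    ultimately have neg: "det (\<chi> i. u i) < 0" by simp
    \<comment> \<open>Any index will do: negating one vector reverses the orientation and preserves
      orthonormality.\<close>
    obtain k :: 'n where True by blast
    define w where "w i = (if i = k then - u i else u i)" for i
    have "(\<chi> i. w i) = (\<chi> i. if i = k then (-1) *s u i else u i)"
      by (simp add: vec_eq_iff w_def)
    then have "det (\<chi> i. w i) = - det (\<chi> i. if i = k then u i else u i)"
      using det_row_mul[of k "-1" u u] by simp
    then have "det (\<chi> i. w i) > 0" using neg by simp
    moreover have "(w i, D (w i)) \<bullet> (w j, D (w j)) = (if i = j then 1 else 0)" for i j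
      using on[of i j] by (auto simp: w_def linear_neg[OF linear_D] split: if_splits)
    ultimately show ?thesis using frame[of w] by blast
  qed
qed

lemma g_pos: "g > 0"
proof -
  obtain e where e: "positive_frame F x e" using positive_frame_exists by blast
  then have "\<exists>u. e i = (u, D u)" for i by (auto simp: positive_frame_def tangent_space_D)
  then have "e i = (fst (e i), D (fst (e i)))" for i by (metis fst_conv)
  then have "(det (\<chi> i. fst (e i)))\<^sup>2 * g = 1"
    using e by (intro frame_det) (metis positive_frame_def)
  then show ?thesis by (smt (verit) zero_le_power2 mult_nonneg_nonpos)
qed

text \<open>Removes the choice of frame: orthonormality fixes the square of the determinant of the
  base components as \<open>1 / g\<close>, and positivity fixes its sign.\<close>

lemma graph_vol_eq:
  "graph_vol F x v = det (\<chi> j. tan_pairing D (v (index_pos j))) / sqrt g"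
proof -
  define e where "e = (SOME e. positive_frame F x e)"
  have e: "positive_frame F x e" unfolding e_def using positive_frame_exists by (rule someI_ex)
  define u where "u i = fst (e i)" for i
  have "\<exists>u. e i = (u, D u)" for i using e by (auto simp: positive_frame_def tangent_space_D)
  then have eu: "e i = (u i, D (u i))" for i by (metis fst_conv u_def)
  have "(det (\<chi> i. u i))\<^sup>2 * g = 1"
    using e by (intro frame_det) (metis positive_frame_def eu)
  moreover have pos: "det (\<chi> i. u i) > 0" using e by (simp add: positive_frame_def u_def)
  ultimately have "det (\<chi> i. u i) * sqrt g = 1"
    using g_pos by (metis abs_of_pos real_sqrt_abs real_sqrt_mult real_sqrt_one)
  then have "det (\<chi> i. u i) = 1 / sqrt g" using g_pos by (simp add: field_simps)
  moreover have "graph_vol F x v = det (\<chi> i j. u i \<bullet> tan_pairing D (v (index_pos j)))"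
    by (simp add: graph_vol_def e_def[symmetric] eu inner_tan_pairing[OF linear_D])
  ultimately show ?thesis by (simp add: det_inner_rows)
qed

text \<open>The adjoint of \<open>J_op D\<close>, extended to the ambient space and written in the
  same chosen basis as \<open>Psi\<close>, so that the sum in \<open>Psi\<close> collapses to
  it.\<close>

definition J_adjoint :: "(real^'n::_) \<times> (real^'m) \<Rightarrow> (real^'n::_) \<times> (real^'m)" where
  "J_adjoint w = (\<Sum>e\<in>some_onb (tangent_space (graph_map F) x). (J_op D e \<bullet> w) *\<^sub>R e)"

lemma some_onb_tangent_space:
  defines "B \<equiv> some_onb (tangent_space (graph_map F) x)"
  shows "finite B" "pairwise orthogonal B" "\<forall>b\<in>B. b \<bullet> b = 1" "span B = range (\<lambda>u. (u, D u))"
proof -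
  have "subspace (range (\<lambda>u. (u, D u)))"
    using linear_D by (auto intro!: linear_subspace_image linearI simp: linear_add linear_scale)
  then have "\<exists>C. pairwise orthogonal C \<and> (\<forall>b\<in>C. norm b = 1) \<and> span C = range (\<lambda>u. (u, D u))"
    using orthonormal_basis_subspace by (metis (no_types, lifting))
  then have B: "pairwise orthogonal B \<and> (\<forall>b\<in>B. norm b = 1) \<and> span B = range (\<lambda>u. (u, D u))"
    unfolding B_def some_onb_def tangent_space_D by (rule someI_ex)
  then have "independent B" by (intro pairwise_orthogonal_independent) auto
  then show "finite B" by (rule independent_imp_finite)
  show "pairwise orthogonal B" "\<forall>b\<in>B. b \<bullet> b = 1" "span B = range (\<lambda>u. (u, D u))"
    using B by (auto simp: norm_eq_1)
qed

text \<open>The two hypotheses of \<open>pderiv_pdet\<close>. Expanding \<open>(u, D u)\<close> in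
  the chosen basis gives the first, and with it independence of that basis. The second holds because
  \<open>J_adjoint w\<close> is tangent and \<open>nor_pairing\<close> vanishes there; it encodes
  that the adjoint squares to zero.\<close>

lemma J_adjoint_pairing:
  "tan_pairing D (J_adjoint w) = nor_pairing D w" "nor_pairing D (J_adjoint w) = 0"
proof -
  define B where "B = some_onb (tangent_space (graph_map F) x)"
  note B = some_onb_tangent_space[folded B_def]
  have BT: "\<exists>u. e = (u, D u)" if "e \<in> B" for e
    using that B(4) span_superset by blast
  let ?z = "(nor_pairing D w, 0)"
  have J: "J_adjoint w = (\<Sum>e\<in>B. (e \<bullet> ?z) *\<^sub>R e)"
    unfolding J_adjoint_def B_def[symmetric]
    using BT inner_J_op_graph[OF linear_D] by (intro sum.cong refl) metis
  have "u \<bullet> tan_pairing D (J_adjoint w) = u \<bullet> nor_pairing D w" for u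
  proof -
    have "(u, D u) \<in> span B" using B(4) by auto
    then have expand: "(u, D u) = (\<Sum>e\<in>B. (e \<bullet> (u, D u)) *\<^sub>R e)"
      by (rule orthonormal_expand[OF B(1-3)])
    have "u \<bullet> tan_pairing D (J_adjoint w) = (\<Sum>e\<in>B. (e \<bullet> (u, D u)) * (e \<bullet> ?z))"
      unfolding inner_tan_pairing[OF linear_D] J
      by (simp add: inner_sum_right inner_commute mult.commute del: inner_Pair)
    also have "\<dots> = (\<Sum>e\<in>B. (e \<bullet> (u, D u)) *\<^sub>R e) \<bullet> ?z"
      by (simp add: inner_sum_left del: inner_Pair)
    also have "\<dots> = u \<bullet> nor_pairing D w" by (simp flip: expand)
    finally show ?thesis .
  qed
  then show "tan_pairing D (J_adjoint w) = nor_pairing D w" by (metis vector_eq_rdot inner_commute)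
  have "J_adjoint w \<in> span B" unfolding J by (intro span_sum span_scale span_base)
  then obtain u where "J_adjoint w = (u, D u)" using B(4) by auto
  then show "nor_pairing D (J_adjoint w) = 0" by (simp add: nor_pairing_graph[OF linear_D])
qed

lemma pderiv_pdet_pairing:
  "pderiv (pdet (tan_pairing D) (nor_pairing D) v) =
    (\<Sum>i<CARD('n). pdet (tan_pairing D) (nor_pairing D) (v(i := J_adjoint (v i))))"
  by (rule pderiv_pdet) (rule J_adjoint_pairing)+

text \<open>Linearity in each slot pulls the sum over the basis into the argument.\<close>

lemma Psi_alternating:
  assumes "alternating_form k \<xi>"
  shows "Psi F x k \<xi> v = (\<Sum>i<k. \<xi> (v(i := J_adjoint (v i))))"
proof -
  define B where "B = some_onb (tangent_space (graph_map F) x)"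
  have "Psi F x k \<xi> v = (\<Sum>e\<in>B. \<Sum>i<k. (J_op D e \<bullet> v i) * \<xi> (v(i := e)))"
    unfolding Psi_def B_def D_def covector_wedge_interior_mult[OF assms] flat_def ..
  also have "\<dots> = (\<Sum>i<k. \<Sum>e\<in>B. (J_op D e \<bullet> v i) * \<xi> (v(i := e)))" by (rule sum.swap)
  also have "\<dots> = (\<Sum>i<k. \<xi> (v(i := J_adjoint (v i))))"
  proof (rule sum.cong[OF refl])
    fix i assume "i \<in> {..<k}"
    then have "linear (\<lambda>y. \<xi> (v(i := y)))" using assms by (simp add: alternating_form_def)
    then show "(\<Sum>e\<in>B. (J_op D e \<bullet> v i) * \<xi> (v(i := e))) = \<xi> (v(i := J_adjoint (v i)))"
      unfolding J_adjoint_def B_def[symmetric]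
      by (simp add: linear_sum[of "\<lambda>y. \<xi> (v(i := y))"] linear_scale[of "\<lambda>y. \<xi> (v(i := y))"])
  qed
  finally show ?thesis .
qed

text \<open>\<open>Psi\<close> acts on the polynomial as differentiation in \<open>t\<close>. The
  equation is between functions of \<open>v\<close>, since the next application of
  \<open>Psi\<close> needs the whole form and needs it to be alternating.\<close>

lemma Psi_pow_eq:
  "Psi_pow F l x = (\<lambda>v. fact l / sqrt g * coeff (pdet (tan_pairing D) (nor_pairing D) v) l)"
proof (induction l)
  case 0
  show ?case
    by (rule ext) (simp add: Psi_pow_def graph_vol_eq poly_pdet flip: poly_0_coeff_0)
next
  case (Suc l)
  let ?p = "pdet (tan_pairing D) (nor_pairing D)"
  have alt: "alternating_form CARD('n) (\<lambda>v. fact l / sqrt g * coeff (?p v) l)"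
    by (rule alternating_form_pdet[OF linear_pairing[OF linear_D]]) (auto simp: algebra_simps)
  show ?case
  proof
    fix v
    have "Psi_pow F (Suc l) x v = Psi F x CARD('n) (\<lambda>v. fact l / sqrt g * coeff (?p v) l) v"
      unfolding Suc.IH[symmetric] by (simp add: Psi_pow_def)
    also have "\<dots> = fact l / sqrt g * coeff (\<Sum>i<CARD('n). ?p (v(i := J_adjoint (v i)))) l"
      unfolding Psi_alternating[OF alt] by (simp add: coeff_sum sum_distrib_left)
    also have "(\<Sum>i<CARD('n). ?p (v(i := J_adjoint (v i)))) = pderiv (?p v)"
      by (rule pderiv_pdet_pairing[symmetric])
    finally show "Psi_pow F (Suc l) x v = fact (Suc l) / sqrt g * coeff (?p v) (Suc l)"
      by (simp add: coeff_pderiv)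
  qed
qed

text \<open>Here \<open>poly q t\<close> is \<open>\<surd>g\<close> times the sum of the \<open>t^\<ell> \<Psi>^\<ell> / \<ell>!\<close>.\<close>

lemma Theta_poly:
  fixes v
  defines "q \<equiv> pdet (tan_pairing D) (nor_pairing D) v"
  shows "Theta F (x, y) v = (poly q (-1) + poly (pderiv q) (-1)) / sqrt g"
proof -
  let ?N = "degree q"
  define c where "c = (\<lambda>l. (-1) ^ l * ((real l - 1) / fact l) * Psi_pow F l x v)"
  have c: "c l = (-1) ^ l * (real l - 1) * coeff q l / sqrt g" for l
    by (simp add: c_def Psi_pow_eq q_def)
  \<comment> \<open>Beyond the degree all coefficients vanish, so no convergence question
    arises.\<close>
  have "infsum c {1..} = infsum c {1..?N}"
    by (rule infsum_cong_neutral) (auto simp: c coeff_eq_0)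
  also have "\<dots> = (\<Sum>l=1..?N. c l)" by simp
  finally have "infsum c {1..} = (\<Sum>l=1..?N. c l)" .
  moreover have "Theta F (x, y) v = Psi_pow F 0 x v - infsum c {1..}"
    by (simp only: Theta_def c_def fst_conv)
  ultimately have "Theta F (x, y) v = coeff q 0 / sqrt g - (\<Sum>l=1..?N. c l)"
    by (simp add: Psi_pow_eq q_def)
  \<comment> \<open>The weight \<open>l - 1\<close> is -1 at \<open>l = 0\<close>, so the separate
    leading term is exactly the missing summand.\<close>
  also have "coeff q 0 / sqrt g = - c 0" by (simp add: c)
  also have "- c 0 - (\<Sum>l=1..?N. c l) = (\<Sum>l\<le>?N. - c l)"
    unfolding sum_negf by (simp add: atMost_atLeast0 sum.atLeast_Suc_atMost)
  \<comment> \<open>The truncated exponent \<open>l - 1\<close> at \<open>l = 0\<close> is harmless: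
    its factor \<open>real l\<close> is zero.\<close>
  also have "\<dots> = (\<Sum>l\<le>?N. coeff q l * (-1) ^ l + real l * coeff q l * (-1) ^ (l - 1)) / sqrt g"
    unfolding sum_divide_distrib
  proof (rule sum.cong[OF refl])
    fix l show "- c l = (coeff q l * (-1) ^ l + real l * coeff q l * (-1) ^ (l - 1)) / sqrt g"
      by (cases l) (simp_all add: c algebra_simps add_divide_distrib diff_divide_distrib)
  qed
  also have "(\<Sum>l\<le>?N. coeff q l * (-1) ^ l + real l * coeff q l * (-1) ^ (l - 1)) =
      poly q (-1) + poly (pderiv q) (-1)"
  proof -
    have "poly q (-1) = (\<Sum>l\<le>?N. coeff q l * (-1) ^ l)" by (rule poly_altdef)
    moreover have "pderiv q = (\<Sum>l\<le>?N. monom (real l * coeff q l) (l - 1))"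
      by (subst (1) poly_as_sum_of_monoms[of q, symmetric])
         (simp only: higher_pderiv_sum[of 1, simplified] pderiv_monom of_nat_id)
    then have "poly (pderiv q) (-1) = (\<Sum>l\<le>?N. real l * coeff q l * (-1) ^ (l - 1))"
      by (simp add: poly_sum poly_monom)
    ultimately show ?thesis by (simp add: sum.distrib)
  qed
  finally show ?thesis .
qed

text \<open>At -1 an ordinary row becomes \<open>G_op D (fst w)\<close>, while a row hit by the
  derivative becomes \<open>nor_pairing D w\<close>. Vertical components thus enter each determinant
  at most once.\<close>

lemma Theta_det:
  fixes v
  defines "a \<equiv> \<lambda>j. G_op D (fst (v (index_pos j)))"
  shows "Theta F (x, y) v = (det (\<chi> j. a j) +
    (\<Sum>k\<in>UNIV. det (\<chi> j. if j = k then nor_pairing D (v (index_pos k)) else a j))) / sqrt g"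
proof -
  have diff: "tan_pairing D w + - 1 *\<^sub>R nor_pairing D w = G_op D (fst w)" for w
    using tan_minus_nor_pairing[OF linear_D, of w] by simp
  have "(\<chi> j. tan_pairing D ((v(index_pos k := J_adjoint (v (index_pos k)))) (index_pos j)) +
      - 1 *\<^sub>R nor_pairing D ((v(index_pos k := J_adjoint (v (index_pos k)))) (index_pos j))) =
      (\<chi> j. if j = k then nor_pairing D (v (index_pos k)) else a j)" for k
    unfolding a_def diff[symmetric]
    by (subst vec_eq_iff) (auto simp: J_adjoint_pairing)
  then show ?thesis
    unfolding Theta_poly pderiv_pdet_pairing poly_sum sum_index_pos[symmetric] poly_pdet
    by (simp only: diff a_def)
qed

lemma Theta_alternating: "alternating_form CARD('n) (Theta F (x, y))"
  unfolding Theta_poly[abs_def]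
  by (rule alternating_form_pdet[OF linear_pairing[OF linear_D]])
     (auto simp: pderiv_add pderiv_smult algebra_simps add_divide_distrib)

text \<open>On tangent vectors \<open>nor_pairing\<close> vanishes: the determinants with a replaced
  row drop out, and the remaining rows coincide with \<open>tan_pairing\<close>.\<close>

lemma Theta_tangent:
  assumes "\<forall>i<CARD('n). v i \<in> tangent_space (graph_map F) x"
  shows "Theta F (x, y) v = graph_vol F x v"
proof -
  have nor: "nor_pairing D (v (index_pos j)) = 0" for j :: 'n
    using assms[rule_format, OF index_pos_less[of j]]
    by (auto simp: tangent_space_D nor_pairing_graph[OF linear_D])
  then have "G_op D (fst (v (index_pos j))) = tan_pairing D (v (index_pos j))" for j :: 'n
    using tan_minus_nor_pairing[OF linear_D, of "v (index_pos j)"] by simp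
  moreover have "det (\<chi> j. if j = k then 0 else a j) = 0" for k and a :: "'n \<Rightarrow> real^'n::_"
    by (rule det_row_0)
  ultimately show ?thesis unfolding Theta_det graph_vol_eq nor by simp
qed

end

section \<open>The comass\<close>

text \<open>The determinant of the identity plus the Gram matrix of \<open>d\<close>,
  \<open>e\<close>; for the gradients of the components it is the squared volume density of the
  graph.\<close>

definition graph_gram :: "'a::real_inner \<Rightarrow> 'a \<Rightarrow> real" where
  "graph_gram d e = (1 + d \<bullet> d) * (1 + e \<bullet> e) - (d \<bullet> e)\<^sup>2"

text \<open>\<open>graph_gram d e\<close> times the solution \<open>w\<close> of
  \<open>w + (d \<bullet> w) d + (e \<bullet> w) e = d\<close>, that is, the inverse metric applied
  to \<open>d\<close> with the denominator cleared.\<close>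

definition flux :: "'a::real_inner \<Rightarrow> 'a \<Rightarrow> 'a" where
  "flux d e = (1 + e \<bullet> e) *\<^sub>R d - (d \<bullet> e) *\<^sub>R e"

lemma graph_gram_pos: "graph_gram d e > 0"
proof -
  have "(d \<bullet> e)\<^sup>2 \<le> (d \<bullet> d) * (e \<bullet> e)" by (rule Cauchy_Schwarz_ineq)
  moreover have "graph_gram d e = 1 + d \<bullet> d + e \<bullet> e + ((d \<bullet> d) * (e \<bullet> e) - (d \<bullet> e)\<^sup>2)"
    by (simp add: graph_gram_def algebra_simps)
  ultimately show ?thesis using inner_ge_zero[of d] inner_ge_zero[of e] by linarith
qed

section \<open>Expansion of the form in coordinates\<close>

lemma linear_det_replace_row:
  fixes a :: "'n::finite \<Rightarrow> real^'n"
  shows "linear (\<lambda>u. det (\<chi> j. if j = k then u else a j))"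
proof (rule linearI)
  fix u w :: "real^'n" and c :: real
  show "det (\<chi> j. if j = k then u + w else a j) =
      det (\<chi> j. if j = k then u else a j) + det (\<chi> j. if j = k then w else a j)"
    using det_row_add[of k "\<lambda>_. u" "\<lambda>_. w" a] by simp
  show "det (\<chi> j. if j = k then c *\<^sub>R u else a j) = c *\<^sub>R det (\<chi> j. if j = k then u else a j)"
    using det_row_mul[of k c "\<lambda>_. u" a] by (simp add: scalar_mult_eq_scaleR cong: if_cong)
qed

lemma adjoint_expand_2:
  fixes D :: "'a::euclidean_space \<Rightarrow> real^2"
  assumes "linear D"
  shows "adjoint D w = (w $ 1) *\<^sub>R adjoint D (axis 1 1) + (w $ 2) *\<^sub>R adjoint D (axis 2 1)"
proof -
  have w: "w = (w $ 1) *\<^sub>R axis 1 1 + (w $ 2) *\<^sub>R axis 2 1"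
    by (simp add: vec_eq_iff forall_2 axis_def)
  show ?thesis
    by (subst w) (simp only: linear_add[OF adjoint_linear[OF assms]] linear_scale[OF adjoint_linear[OF assms]])
qed

lemma linear_nth_eq_adjoint_inner:
  fixes D :: "'a::euclidean_space \<Rightarrow> real^'m"
  assumes "linear D"
  shows "D u $ \<alpha> = adjoint D (axis \<alpha> 1) \<bullet> u"
  by (simp add: adjoint_inner[OF assms] inner_axis inner_commute)

text \<open>Every row lies in the image of \<open>G\<close>, so its determinant \<open>g\<close>
  factors out. The parts of the replaced rows that come from base components contract to multiples
  of the base determinant, and \<open>g - d 1 \<bullet> flux (d 1) (d 2) - d 2 \<bullet> flux (d 2)
  (d 1)\<close> is the coefficient \<open>1 - \<delta>\<close>.\<close>

lemma Theta_coords: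
  fixes F :: "real^'n::{finite,linorder} \<Rightarrow> real^2" and v :: "nat \<Rightarrow> (real^'n::_) \<times> (real^2)"
  assumes F: "F differentiable (at x)"
  defines "d \<equiv> \<lambda>\<alpha>. adjoint (frechet_derivative F (at x)) (axis \<alpha> 1)"
    and "a \<equiv> \<lambda>j. fst (v (index_pos j))" and "b \<equiv> \<lambda>j. snd (v (index_pos j))"
  shows "Theta F (x, y) v =
    ((1 - ((d 1 \<bullet> d 1) * (d 2 \<bullet> d 2) - (d 1 \<bullet> d 2)\<^sup>2)) * det (\<chi> j. a j) +
     (\<Sum>k\<in>UNIV. b k $ 1 * det (\<chi> j. if j = k then flux (d 1) (d 2) else a j)) +
     (\<Sum>k\<in>UNIV. b k $ 2 * det (\<chi> j. if j = k then flux (d 2) (d 1) else a j)))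
    / sqrt (graph_gram (d 1) (d 2))"
proof -
  define D where "D = frechet_derivative F (at x)"
  have D: "linear D" unfolding D_def by (rule linear_frechet_derivative[OF F])
  define G where "G = G_op D"
  define w\<^sub>1 where "w\<^sub>1 = flux (d 1) (d 2)"
  define w\<^sub>2 where "w\<^sub>2 = flux (d 2) (d 1)"
  define g where "g = graph_gram (d 1) (d 2)"
  have g: "g > 0" unfolding g_def by (rule graph_gram_pos)
  have adj: "adjoint D w = (w $ 1) *\<^sub>R d 1 + (w $ 2) *\<^sub>R d 2" for w
    unfolding d_def D_def[symmetric] by (rule adjoint_expand_2[OF D])
  have Du: "D u $ \<alpha> = d \<alpha> \<bullet> u" for u \<alpha>
    unfolding d_def D_def[symmetric] by (rule linear_nth_eq_adjoint_inner[OF D])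
  have G: "G u = u + (d 1 \<bullet> u) *\<^sub>R d 1 + (d 2 \<bullet> u) *\<^sub>R d 2" for u
    by (simp add: G_def G_op_def adj Du)
  have linG: "linear G" unfolding G_def by (rule linear_G_op[OF D])
  have detG: "det (\<chi> i. G (axis i 1)) = g"
    unfolding g_def graph_gram_def G det_I_plus_two[symmetric]
    by (simp add: inner_axis)
  have Gw: "G w\<^sub>1 = g *\<^sub>R d 1" "G w\<^sub>2 = g *\<^sub>R d 2"
    unfolding G w\<^sub>1_def w\<^sub>2_def g_def graph_gram_def flux_def
    by (simp_all add: inner_diff_right inner_commute[of "d 2" "d 1"] algebra_simps power2_eq_square)
  have detGa: "det (\<chi> j. G (a j)) = g * det (\<chi> j. a j)" for a :: "'n \<Rightarrow> real^'n::_"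
    by (subst det_linear_image_rows[OF linG]) (simp only: detG)
  \<comment> \<open>The preimage of the normal row under \<open>G\<close>: that row is a combination
    of \<open>d 1\<close> and \<open>d 2\<close>, whose preimages are the flux vectors divided by
    \<open>g\<close>.\<close>
  define c where "c k = (1 / g) *\<^sub>R ((b k $ 1 - d 1 \<bullet> a k) *\<^sub>R w\<^sub>1 + (b k $ 2 - d 2 \<bullet> a k) *\<^sub>R w\<^sub>2)" for k
  have nor: "nor_pairing D (v (index_pos k)) = G (c k)" for k
  proof -
    have "G (c k) = (1 / g) *\<^sub>R ((b k $ 1 - d 1 \<bullet> a k) *\<^sub>R g *\<^sub>R d 1 + (b k $ 2 - d 2 \<bullet> a k) *\<^sub>R g *\<^sub>R d 2)"
      unfolding c_def linear_scale[OF linG] linear_add[OF linG] Gw ..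
    also have "\<dots> = (b k $ 1 - d 1 \<bullet> a k) *\<^sub>R d 1 + (b k $ 2 - d 2 \<bullet> a k) *\<^sub>R d 2"
      using g by (simp add: scaleR_add_right)
    finally show ?thesis by (simp add: nor_pairing_def adj Du a_def b_def)
  qed
  let ?A = "det (\<chi> j. a j)"
  let ?R = "\<lambda>k u. det (\<chi> j. if j = k then u else a j)"
  have "(\<chi> j. if j = k then G (c k) else G (a j)) = (\<chi> j. G (if j = k then c k else a j))" for k
    by (simp add: vec_eq_iff)
  moreover have "fst (v (index_pos j)) = a j" for j by (simp add: a_def)
  ultimately have "Theta F (x, y) v = (g * ?A + (\<Sum>k\<in>UNIV. g * ?R k (c k))) / sqrt g"
    using Theta_det[OF F, of y v] unfolding D_def[symmetric] nor G_def[symmetric] detG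
    by (simp only: detGa)
  also have "(\<Sum>k\<in>UNIV. g * ?R k (c k)) =
      (\<Sum>k\<in>UNIV. b k $ 1 * ?R k w\<^sub>1) + (\<Sum>k\<in>UNIV. b k $ 2 * ?R k w\<^sub>2)
      - (\<Sum>k\<in>UNIV. (d 1 \<bullet> a k) * ?R k w\<^sub>1) - (\<Sum>k\<in>UNIV. (d 2 \<bullet> a k) * ?R k w\<^sub>2)"
  proof -
    have "g * ?R k (c k) = b k $ 1 * ?R k w\<^sub>1 + b k $ 2 * ?R k w\<^sub>2
        - (d 1 \<bullet> a k) * ?R k w\<^sub>1 - (d 2 \<bullet> a k) * ?R k w\<^sub>2" for k
      unfolding c_def linear_scale[OF linear_det_replace_row] linear_add[OF linear_det_replace_row]
      using g by (simp add: algebra_simps)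
    then show ?thesis by (simp add: sum.distrib sum_subtractf)
  qed
  also have "g * ?A + \<dots> = (g - d 1 \<bullet> w\<^sub>1 - d 2 \<bullet> w\<^sub>2) * ?A +
      (\<Sum>k\<in>UNIV. b k $ 1 * ?R k w\<^sub>1) + (\<Sum>k\<in>UNIV. b k $ 2 * ?R k w\<^sub>2)"
    unfolding sum_inner_det_replace_row by (simp add: algebra_simps)
  also have "g - d 1 \<bullet> w\<^sub>1 - d 2 \<bullet> w\<^sub>2 = 1 - ((d 1 \<bullet> d 1) * (d 2 \<bullet> d 2) - (d 1 \<bullet> d 2)\<^sup>2)"
    unfolding g_def graph_gram_def w\<^sub>1_def w\<^sub>2_def flux_def
    by (simp add: inner_diff_right inner_commute[of "d 2" "d 1"] algebra_simps power2_eq_square)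
  finally show ?thesis unfolding w\<^sub>1_def w\<^sub>2_def g_def .
qed

section \<open>Wirtinger's inequality, with bivectors paired by their Gram determinant\<close>

definition wedge_inner :: "'a::real_inner \<Rightarrow> 'a \<Rightarrow> 'a \<Rightarrow> 'a \<Rightarrow> real" where
  "wedge_inner a b c d = (a \<bullet> c) * (b \<bullet> d) - (a \<bullet> d) * (b \<bullet> c)"

text \<open>For dependent \<open>a\<close>, \<open>b\<close> division by zero makes \<open>e\<close> or \<open>f\<close> vanish; this is why their norms are only
  bounded by \<open>1\<close>.\<close>

lemma orthonormalize_pair:
  fixes a b :: "'a::real_inner"
  obtains e f t where "e \<bullet> e \<le> 1" "f \<bullet> f \<le> 1" "e \<bullet> f = 0" "0 \<le> t"
    "t\<^sup>2 = wedge_inner a b a b" "\<And>c d. wedge_inner a b c d = t * wedge_inner e f c d"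
    "\<And>u. u \<bullet> a = 0 \<Longrightarrow> u \<bullet> b = 0 \<Longrightarrow> u \<bullet> e = 0 \<and> u \<bullet> f = 0"
proof
  define e where "e = a /\<^sub>R norm a"
  define h where "h = b - (e \<bullet> b) *\<^sub>R e"
  define f where "f = h /\<^sub>R norm h"
  have a: "a = norm a *\<^sub>R e" by (cases "a = 0") (simp_all add: e_def)
  have h: "h = norm h *\<^sub>R f" by (cases "h = 0") (simp_all add: f_def)
  have b: "b = (e \<bullet> b) *\<^sub>R e + norm h *\<^sub>R f" using h by (simp add: h_def)
  show e1: "e \<bullet> e \<le> 1" by (simp add: e_def dot_square_norm power2_eq_square divide_simps)
  show f1: "f \<bullet> f \<le> 1" by (simp add: f_def dot_square_norm power2_eq_square divide_simps)
  have "(e \<bullet> e) * (e \<bullet> b) = e \<bullet> b"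
    by (simp add: e_def dot_square_norm power2_eq_square divide_simps)
  then have "e \<bullet> h = 0" by (simp add: h_def inner_diff_right mult.commute)
  then show ef: "e \<bullet> f = 0" by (simp add: f_def)
  show "0 \<le> norm a * norm h" by simp
  show wedge: "wedge_inner a b c d = (norm a * norm h) * wedge_inner e f c d" for c d
  proof -
    have "wedge_inner a b c d =
        wedge_inner (norm a *\<^sub>R e) ((e \<bullet> b) *\<^sub>R e + norm h *\<^sub>R f) c d"
      by (simp only: a[symmetric] b[symmetric])
    also have "\<dots> = (norm a * norm h) * wedge_inner e f c d"
      by (simp add: wedge_inner_def inner_add_left algebra_simps)
    finally show ?thesis .
  qed
  have "e \<bullet> a = norm a" by (cases "a = 0") (simp_all add: e_def dot_square_norm power2_eq_square)
  moreover have "f \<bullet> h = norm h" by (cases "h = 0") (simp_all add: f_def dot_square_norm power2_eq_square)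
  moreover have "f \<bullet> a = 0" using ef a by (metis inner_commute inner_scaleR_right mult_zero_right)
  moreover have "f \<bullet> b = f \<bullet> h" using ef by (simp add: h_def inner_diff_right inner_commute)
  ultimately show "(norm a * norm h)\<^sup>2 = wedge_inner a b a b"
    unfolding wedge by (simp add: wedge_inner_def power2_eq_square)
  show "u \<bullet> e = 0 \<and> u \<bullet> f = 0" if "u \<bullet> a = 0" "u \<bullet> b = 0" for u
    using that by (simp add: e_def f_def h_def inner_diff_right)
qed

lemma bessel_four:
  fixes c :: "'a::real_inner"
  assumes "e \<bullet> e \<le> 1" "f \<bullet> f \<le> 1" "h \<bullet> h \<le> 1" "k \<bullet> k \<le> 1"
    and orth: "e \<bullet> f = 0" "e \<bullet> h = 0" "e \<bullet> k = 0" "f \<bullet> h = 0" "f \<bullet> k = 0" "h \<bullet> k = 0"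
  shows "(e \<bullet> c)\<^sup>2 + (f \<bullet> c)\<^sup>2 + (h \<bullet> c)\<^sup>2 + (k \<bullet> c)\<^sup>2 \<le> c \<bullet> c"
proof -
  let ?r = "c - (e \<bullet> c) *\<^sub>R e - (f \<bullet> c) *\<^sub>R f - (h \<bullet> c) *\<^sub>R h - (k \<bullet> c) *\<^sub>R k"
  have "0 \<le> ?r \<bullet> ?r" by simp
  also have "?r \<bullet> ?r = c \<bullet> c - (e \<bullet> c)\<^sup>2 * (2 - e \<bullet> e) - (f \<bullet> c)\<^sup>2 * (2 - f \<bullet> f)
      - (h \<bullet> c)\<^sup>2 * (2 - h \<bullet> h) - (k \<bullet> c)\<^sup>2 * (2 - k \<bullet> k)"
    using orth
    by (simp add: inner_diff_left inner_diff_right inner_commute power2_eq_square algebra_simps)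
  finally have "(e \<bullet> c)\<^sup>2 * (2 - e \<bullet> e) + (f \<bullet> c)\<^sup>2 * (2 - f \<bullet> f)
      + (h \<bullet> c)\<^sup>2 * (2 - h \<bullet> h) + (k \<bullet> c)\<^sup>2 * (2 - k \<bullet> k) \<le> c \<bullet> c" by simp
  moreover have "t\<^sup>2 \<le> t\<^sup>2 * (2 - s)" if "s \<le> 1" for s t :: real
    using mult_left_mono[of 1 "2 - s" "t\<^sup>2"] that by simp
  ultimately show ?thesis using assms(1-4) by (smt (verit))
qed

text \<open>Euler's four-square identity: the defect is the sum of the squares of the other three
  components of a quaternion product. The absolute values cost one more instance, with coordinates 3
  and 4 exchanged, which flips the sign of the second minor.\<close>

lemma wirtinger_real:
  fixes a\<^sub>1 a\<^sub>2 a\<^sub>3 a\<^sub>4 b\<^sub>1 b\<^sub>2 b\<^sub>3 b\<^sub>4 :: real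
  shows "(\<bar>a\<^sub>1 * b\<^sub>2 - b\<^sub>1 * a\<^sub>2\<bar> + \<bar>a\<^sub>3 * b\<^sub>4 - b\<^sub>3 * a\<^sub>4\<bar>)\<^sup>2 \<le>
    (a\<^sub>1\<^sup>2 + a\<^sub>2\<^sup>2 + a\<^sub>3\<^sup>2 + a\<^sub>4\<^sup>2) * (b\<^sub>1\<^sup>2 + b\<^sub>2\<^sup>2 + b\<^sub>3\<^sup>2 + b\<^sub>4\<^sup>2)"
proof -
  have plus: "(a\<^sub>1 * b\<^sub>2 - b\<^sub>1 * a\<^sub>2 + (a\<^sub>3 * b\<^sub>4 - b\<^sub>3 * a\<^sub>4))\<^sup>2 \<le>
    (a\<^sub>1\<^sup>2 + a\<^sub>2\<^sup>2 + a\<^sub>3\<^sup>2 + a\<^sub>4\<^sup>2) * (b\<^sub>1\<^sup>2 + b\<^sub>2\<^sup>2 + b\<^sub>3\<^sup>2 + b\<^sub>4\<^sup>2)" for a\<^sub>1 a\<^sub>2 a\<^sub>3 a\<^sub>4 b\<^sub>1 b\<^sub>2 b\<^sub>3 b\<^sub>4 :: real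
  proof -
    have "(a\<^sub>1\<^sup>2 + a\<^sub>2\<^sup>2 + a\<^sub>3\<^sup>2 + a\<^sub>4\<^sup>2) * (b\<^sub>1\<^sup>2 + b\<^sub>2\<^sup>2 + b\<^sub>3\<^sup>2 + b\<^sub>4\<^sup>2) -
        (a\<^sub>1 * b\<^sub>2 - b\<^sub>1 * a\<^sub>2 + (a\<^sub>3 * b\<^sub>4 - b\<^sub>3 * a\<^sub>4))\<^sup>2 =
        (a\<^sub>1 * b\<^sub>1 + a\<^sub>2 * b\<^sub>2 + a\<^sub>3 * b\<^sub>3 + a\<^sub>4 * b\<^sub>4)\<^sup>2 +
        (a\<^sub>1 * b\<^sub>3 - a\<^sub>3 * b\<^sub>1 - a\<^sub>2 * b\<^sub>4 + a\<^sub>4 * b\<^sub>2)\<^sup>2 +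
        (a\<^sub>1 * b\<^sub>4 - a\<^sub>4 * b\<^sub>1 + a\<^sub>2 * b\<^sub>3 - a\<^sub>3 * b\<^sub>2)\<^sup>2" by algebra
    then show ?thesis by (smt (verit) zero_le_power2)
  qed
  have "\<bar>p\<bar> + \<bar>q\<bar> = \<bar>p + q\<bar> \<or> \<bar>p\<bar> + \<bar>q\<bar> = \<bar>p + - q\<bar>" for p q :: real
    by (cases "p \<ge> 0"; cases "q \<ge> 0") auto
  from this[of "a\<^sub>1 * b\<^sub>2 - b\<^sub>1 * a\<^sub>2" "a\<^sub>3 * b\<^sub>4 - b\<^sub>3 * a\<^sub>4"] show ?thesis
    using plus[of a\<^sub>1 b\<^sub>2 b\<^sub>1 a\<^sub>2 a\<^sub>3 b\<^sub>4 b\<^sub>3 a\<^sub>4] plus[of a\<^sub>1 b\<^sub>2 b\<^sub>1 a\<^sub>2 a\<^sub>4 b\<^sub>3 b\<^sub>4 a\<^sub>3]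
    by (elim disjE) (simp_all add: algebra_simps)
qed

text \<open>The two bivectors are weights \<open>t\<close> and \<open>s\<close> times bivectors of
  mutually orthogonal planes, with \<open>s \<le> t\<close>. Enlarging the smaller weight to
  \<open>t\<close> leaves Wirtinger's inequality in four coordinates.\<close>

lemma wedge_inner_pair_le:
  fixes a\<^sub>1 a\<^sub>2 b\<^sub>1 b\<^sub>2 c d :: "'a::real_inner"
  assumes orth: "a\<^sub>1 \<bullet> b\<^sub>1 = 0" "a\<^sub>1 \<bullet> b\<^sub>2 = 0" "a\<^sub>2 \<bullet> b\<^sub>1 = 0" "a\<^sub>2 \<bullet> b\<^sub>2 = 0"
    and le: "wedge_inner b\<^sub>1 b\<^sub>2 b\<^sub>1 b\<^sub>2 \<le> wedge_inner a\<^sub>1 a\<^sub>2 a\<^sub>1 a\<^sub>2"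
  shows "(wedge_inner a\<^sub>1 a\<^sub>2 c d - wedge_inner b\<^sub>1 b\<^sub>2 c d)\<^sup>2 \<le>
    wedge_inner a\<^sub>1 a\<^sub>2 a\<^sub>1 a\<^sub>2 * wedge_inner c d c d"
proof -
  obtain e f t where e: "e \<bullet> e \<le> 1" "f \<bullet> f \<le> 1" "e \<bullet> f = 0" "0 \<le> t"
    "t\<^sup>2 = wedge_inner a\<^sub>1 a\<^sub>2 a\<^sub>1 a\<^sub>2" "\<And>c d. wedge_inner a\<^sub>1 a\<^sub>2 c d = t * wedge_inner e f c d"
    "\<And>u. u \<bullet> a\<^sub>1 = 0 \<Longrightarrow> u \<bullet> a\<^sub>2 = 0 \<Longrightarrow> u \<bullet> e = 0 \<and> u \<bullet> f = 0"
    using orthonormalize_pair[of a\<^sub>1 a\<^sub>2] by blast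
  obtain h k s where h: "h \<bullet> h \<le> 1" "k \<bullet> k \<le> 1" "h \<bullet> k = 0" "0 \<le> s"
    "s\<^sup>2 = wedge_inner b\<^sub>1 b\<^sub>2 b\<^sub>1 b\<^sub>2" "\<And>c d. wedge_inner b\<^sub>1 b\<^sub>2 c d = s * wedge_inner h k c d"
    "\<And>u. u \<bullet> b\<^sub>1 = 0 \<Longrightarrow> u \<bullet> b\<^sub>2 = 0 \<Longrightarrow> u \<bullet> h = 0 \<and> u \<bullet> k = 0"
    using orthonormalize_pair[of b\<^sub>1 b\<^sub>2] by blast
  have "a\<^sub>1 \<bullet> h = 0 \<and> a\<^sub>1 \<bullet> k = 0" "a\<^sub>2 \<bullet> h = 0 \<and> a\<^sub>2 \<bullet> k = 0" using h(7) orth by auto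
  then have "h \<bullet> e = 0 \<and> h \<bullet> f = 0" "k \<bullet> e = 0 \<and> k \<bullet> f = 0"
    using e(7)[of h] e(7)[of k] by (simp_all add: inner_commute)
  then have hk: "e \<bullet> h = 0" "e \<bullet> k = 0" "f \<bullet> h = 0" "f \<bullet> k = 0"
    by (simp_all add: inner_commute)
  note bessel = bessel_four[OF e(1,2) h(1,2) e(3) hk(1,2,3,4) h(3)]
  \<comment> \<open>Removing the component along \<open>c\<close> changes no pairing with the
    bivector of \<open>c\<close> and \<open>d\<close>, and turns its Gram determinant into a product
    of squared norms. For \<open>c = 0\<close> the division by zero gives
    \<open>d' = d\<close>.\<close>
  define d' where "d' = d - ((c \<bullet> d) / (c \<bullet> c)) *\<^sub>R c"
  have d': "wedge_inner u w c d = wedge_inner u w c d'" for u w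
    by (simp add: wedge_inner_def d'_def inner_diff_right algebra_simps)
  have cd': "c \<bullet> d' = 0" by (cases "c = 0") (simp_all add: d'_def inner_diff_right)
  have gram: "wedge_inner c d c d = (c \<bullet> c) * (d' \<bullet> d')"
  proof -
    have "wedge_inner c d c d = wedge_inner c d c d'" by (rule d')
    also have "\<dots> = (c \<bullet> c) * (d \<bullet> d')" by (simp add: wedge_inner_def cd')
    also have "d \<bullet> d' = d' \<bullet> d'" using cd' by (simp add: d'_def[of] inner_diff_left)
    finally show ?thesis .
  qed
  have "(\<bar>wedge_inner e f c d\<bar> + \<bar>wedge_inner h k c d\<bar>)\<^sup>2 \<le>
      ((e \<bullet> c)\<^sup>2 + (f \<bullet> c)\<^sup>2 + (h \<bullet> c)\<^sup>2 + (k \<bullet> c)\<^sup>2) *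
      ((e \<bullet> d')\<^sup>2 + (f \<bullet> d')\<^sup>2 + (h \<bullet> d')\<^sup>2 + (k \<bullet> d')\<^sup>2)"
    unfolding d' unfolding wedge_inner_def by (rule wirtinger_real)
  also have "\<dots> \<le> (c \<bullet> c) * (d' \<bullet> d')" using bessel by (intro mult_mono) auto
  also have "\<dots> = wedge_inner c d c d" by (rule gram[symmetric])
  finally have W: "(\<bar>wedge_inner e f c d\<bar> + \<bar>wedge_inner h k c d\<bar>)\<^sup>2 \<le> wedge_inner c d c d" .
  have "s \<le> t" using le e(4,5) h(5) by (metis power2_le_imp_le)
  then have "s * \<bar>wedge_inner h k c d\<bar> \<le> t * \<bar>wedge_inner h k c d\<bar>" by (intro mult_right_mono) auto
  then have "\<bar>t * wedge_inner e f c d - s * wedge_inner h k c d\<bar> \<le>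
      t * (\<bar>wedge_inner e f c d\<bar> + \<bar>wedge_inner h k c d\<bar>)"
    using e(4) h(4) abs_triangle_ineq4[of "t * wedge_inner e f c d" "s * wedge_inner h k c d"]
    by (simp add: abs_mult distrib_left)
  then have "(wedge_inner a\<^sub>1 a\<^sub>2 c d - wedge_inner b\<^sub>1 b\<^sub>2 c d)\<^sup>2 \<le>
      (t * (\<bar>wedge_inner e f c d\<bar> + \<bar>wedge_inner h k c d\<bar>))\<^sup>2"
    unfolding e(6) h(6) by (metis abs_ge_zero power2_abs power_mono)
  also have "\<dots> = t\<^sup>2 * (\<bar>wedge_inner e f c d\<bar> + \<bar>wedge_inner h k c d\<bar>)\<^sup>2" by (simp add: power_mult_distrib)
  also have "\<dots> \<le> t\<^sup>2 * wedge_inner c d c d" using W by (intro mult_left_mono) auto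
  finally show ?thesis by (simp add: e(5))
qed

text \<open>The pairing of the Hodge dual of \<open>\<Theta>\<close> with the normal plane of the graph of
  \<open>(z\<^sub>1, z\<^sub>2)\<close>: the normal plane of the given graph is spanned by \<open>(- d\<^sub>\<alpha>, e\<^sub>\<alpha>)\<close>, and the second pair
  of vectors is tangent to the graph.\<close>

lemma calibration_inequality:
  fixes d\<^sub>1 d\<^sub>2 z\<^sub>1 z\<^sub>2 :: "'a::real_inner"
  defines "\<delta> \<equiv> (d\<^sub>1 \<bullet> d\<^sub>1) * (d\<^sub>2 \<bullet> d\<^sub>2) - (d\<^sub>1 \<bullet> d\<^sub>2)\<^sup>2"
  assumes "\<delta> \<le> 1"
  shows "(1 - \<delta> + z\<^sub>1 \<bullet> flux d\<^sub>1 d\<^sub>2 + z\<^sub>2 \<bullet> flux d\<^sub>2 d\<^sub>1)\<^sup>2 \<le> graph_gram d\<^sub>1 d\<^sub>2 * graph_gram z\<^sub>1 z\<^sub>2"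
proof -
  define \<nu>\<^sub>1 where "\<nu>\<^sub>1 = (- d\<^sub>1, (1::real, 0::real))"
  define \<nu>\<^sub>2 where "\<nu>\<^sub>2 = (- d\<^sub>2, (0::real, 1::real))"
  define \<eta>\<^sub>1 where "\<eta>\<^sub>1 = (d\<^sub>1, (d\<^sub>1 \<bullet> d\<^sub>1, d\<^sub>1 \<bullet> d\<^sub>2))"
  define \<eta>\<^sub>2 where "\<eta>\<^sub>2 = (d\<^sub>2, (d\<^sub>1 \<bullet> d\<^sub>2, d\<^sub>2 \<bullet> d\<^sub>2))"
  define \<zeta>\<^sub>1 where "\<zeta>\<^sub>1 = (- z\<^sub>1, (1::real, 0::real))"
  define \<zeta>\<^sub>2 where "\<zeta>\<^sub>2 = (- z\<^sub>2, (0::real, 1::real))"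
  note defs = \<nu>\<^sub>1_def \<nu>\<^sub>2_def \<eta>\<^sub>1_def \<eta>\<^sub>2_def \<zeta>\<^sub>1_def \<zeta>\<^sub>2_def
  have sym: "d\<^sub>2 \<bullet> d\<^sub>1 = d\<^sub>1 \<bullet> d\<^sub>2" "z\<^sub>2 \<bullet> z\<^sub>1 = z\<^sub>1 \<bullet> z\<^sub>2" "z\<^sub>1 \<bullet> d\<^sub>1 = d\<^sub>1 \<bullet> z\<^sub>1" "z\<^sub>1 \<bullet> d\<^sub>2 = d\<^sub>2 \<bullet> z\<^sub>1"
    "z\<^sub>2 \<bullet> d\<^sub>1 = d\<^sub>1 \<bullet> z\<^sub>2" "z\<^sub>2 \<bullet> d\<^sub>2 = d\<^sub>2 \<bullet> z\<^sub>2" by (simp_all add: inner_commute)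
  have "wedge_inner \<eta>\<^sub>1 \<eta>\<^sub>2 \<eta>\<^sub>1 \<eta>\<^sub>2 = \<delta> * graph_gram d\<^sub>1 d\<^sub>2"
    by (simp add: wedge_inner_def defs \<delta>_def graph_gram_def sym) algebra
  moreover have \<nu>: "wedge_inner \<nu>\<^sub>1 \<nu>\<^sub>2 \<nu>\<^sub>1 \<nu>\<^sub>2 = graph_gram d\<^sub>1 d\<^sub>2"
    by (simp add: wedge_inner_def defs graph_gram_def sym power2_eq_square algebra_simps)
  \<comment> \<open>The only use of the area condition: it makes the tangent bivector no longer than
    the normal one, so the latter dominates the difference.\<close>
  moreover have "\<delta> * graph_gram d\<^sub>1 d\<^sub>2 \<le> graph_gram d\<^sub>1 d\<^sub>2"
    using assms(2) graph_gram_pos[of d\<^sub>1 d\<^sub>2] mult_right_mono[of \<delta> 1 "graph_gram d\<^sub>1 d\<^sub>2"] by simp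
  ultimately have "(wedge_inner \<nu>\<^sub>1 \<nu>\<^sub>2 \<zeta>\<^sub>1 \<zeta>\<^sub>2 - wedge_inner \<eta>\<^sub>1 \<eta>\<^sub>2 \<zeta>\<^sub>1 \<zeta>\<^sub>2)\<^sup>2 \<le>
      graph_gram d\<^sub>1 d\<^sub>2 * wedge_inner \<zeta>\<^sub>1 \<zeta>\<^sub>2 \<zeta>\<^sub>1 \<zeta>\<^sub>2"
    unfolding \<nu>[symmetric] by (intro wedge_inner_pair_le) (simp_all add: defs sym)
  also have "wedge_inner \<zeta>\<^sub>1 \<zeta>\<^sub>2 \<zeta>\<^sub>1 \<zeta>\<^sub>2 = graph_gram z\<^sub>1 z\<^sub>2"
    by (simp add: wedge_inner_def defs graph_gram_def sym power2_eq_square algebra_simps)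
  also have "wedge_inner \<nu>\<^sub>1 \<nu>\<^sub>2 \<zeta>\<^sub>1 \<zeta>\<^sub>2 - wedge_inner \<eta>\<^sub>1 \<eta>\<^sub>2 \<zeta>\<^sub>1 \<zeta>\<^sub>2 =
      1 - \<delta> + z\<^sub>1 \<bullet> flux d\<^sub>1 d\<^sub>2 + z\<^sub>2 \<bullet> flux d\<^sub>2 d\<^sub>1"
    by (simp add: wedge_inner_def defs flux_def \<delta>_def inner_diff_right sym) algebra
  finally show ?thesis .
qed

section \<open>From graphs to arbitrary planes by density\<close>

lemma tendsto_det:
  fixes A :: "'b \<Rightarrow> real^'n::finite^'n"
  assumes "\<And>i j. ((\<lambda>t. A t $ i $ j) \<longlongrightarrow> B $ i $ j) \<F>"
  shows "((\<lambda>t. det (A t)) \<longlongrightarrow> det B) \<F>"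
  unfolding det_def by (intro tendsto_intros assms)

text \<open>The determinant is a polynomial in \<open>t\<close>. It is not the zero polynomial,
  since near 0 the reversed determinant is close to 1 and is a power of \<open>t\<close> times the
  value at \<open>inverse t\<close>; finitely many roots do not accumulate at 0.\<close>

lemma eventually_det_add_ident_nonzero:
  fixes a :: "'n::finite \<Rightarrow> real^'n"
  shows "eventually (\<lambda>t. det (\<chi> j. a j + t *\<^sub>R axis j 1) \<noteq> 0) (at 0)"
proof -
  define p where "p = det (\<chi> j i. [:a j $ i, axis j 1 $ i:])"
  have p: "poly p t = det (\<chi> j. a j + t *\<^sub>R axis j 1)" for t
    unfolding p_def poly_det by (rule arg_cong[where f=det]) (simp add: vec_eq_iff)
  have "((\<lambda>t. det (\<chi> j. axis j 1 + t *\<^sub>R a j)) \<longlongrightarrow> det (\<chi> j. axis j 1 + 0 *\<^sub>R a j)) (at (0::real))"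
    by (intro tendsto_det) (auto intro!: tendsto_eq_intros)
  moreover have "(\<chi> j. axis j 1 + 0 *\<^sub>R a j) = mat 1" by (simp add: vec_eq_iff mat_def axis_def)
  ultimately have "((\<lambda>t. det (\<chi> j. axis j 1 + t *\<^sub>R a j)) \<longlongrightarrow> 1) (at (0::real))" by simp
  then have "eventually (\<lambda>t::real. det (\<chi> j. axis j 1 + t *\<^sub>R a j) > 0) (at 0)"
    by (rule order_tendstoD) simp
  from eventually_conj[OF eventually_neq_at_within[of 0 0 UNIV] this]
  have "eventually (\<lambda>t::real. t \<noteq> 0 \<and> det (\<chi> j. axis j 1 + t *\<^sub>R a j) > 0) (at 0)"
    .
  from eventually_happens'[OF at_neq_bot this]
  obtain t where t: "t \<noteq> 0" "det (\<chi> j. axis j 1 + t *\<^sub>R a j) > 0" by blast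
  have "(\<chi> j. axis j 1 + t *\<^sub>R a j) = (\<chi> j. t *s (a j + inverse t *\<^sub>R axis j 1))"
    using t(1) by (simp add: vec_eq_iff algebra_simps)
  then have "poly p (inverse t) \<noteq> 0"
    using t det_rows_mul[of "\<lambda>_. t" "\<lambda>j. a j + inverse t *\<^sub>R axis j 1"] by (auto simp: p)
  then have "p \<noteq> 0" by auto
  then have "finite {t. poly p t = 0}" by (rule poly_roots_finite)
  then have "\<not> 0 islimpt {t. poly p t = 0}" by (rule islimpt_finite)
  then show ?thesis by (simp add: islimpt_iff_eventually p)
qed

text \<open>Independent base components make the vertical ones linear functions of them, with rows
  \<open>z 1\<close>, \<open>z 2\<close>. Both sides then carry the squared base determinant as a
  factor, and what is left is \<open>calibration_inequality\<close>.\<close>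

lemma Theta_sq_le_gram_generic:
  fixes F :: "real^'n::{finite,linorder} \<Rightarrow> real^2" and v :: "nat \<Rightarrow> (real^'n::_) \<times> (real^2)"
  assumes F: "F differentiable (at x)"
  defines "d \<equiv> \<lambda>\<alpha>. adjoint (frechet_derivative F (at x)) (axis \<alpha> 1)"
  assumes le: "(d 1 \<bullet> d 1) * (d 2 \<bullet> d 2) - (d 1 \<bullet> d 2)\<^sup>2 \<le> 1"
    and nz: "det (\<chi> j. fst (v (index_pos j))) \<noteq> 0"
  shows "(Theta F (x, y) v)\<^sup>2 \<le> det (\<chi> (i :: 'n) (j :: 'n). v (index_pos i) \<bullet> v (index_pos j))"
proof -
  define a where "a = (\<lambda>j :: 'n. fst (v (index_pos j)))"
  define b where "b = (\<lambda>j :: 'n. snd (v (index_pos j)))"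
  let ?A = "\<chi> j. a j"
  have inv: "invertible ?A" using nz by (simp add: invertible_det_nz a_def)
  have "\<exists>z. \<forall>k. b k $ \<alpha> = z \<bullet> a k" for \<alpha>
  proof -
    have "surj ((*v) ?A)" using inv by (simp add: invertible_eq_bij bij_is_surj)
    then obtain z where "?A *v z = (\<chi> k. b k $ \<alpha>)" by (metis surjD)
    then show ?thesis
      by (intro exI[of _ z]) (simp add: vec_eq_iff matrix_vector_mult_def inner_vec_def mult.commute)
  qed
  then obtain z where z: "\<And>\<alpha> k. b k $ \<alpha> = z \<alpha> \<bullet> a k" by metis
  define \<delta> where "\<delta> = (d 1 \<bullet> d 1) * (d 2 \<bullet> d 2) - (d 1 \<bullet> d 2)\<^sup>2"
  let ?c = "1 - \<delta> + z 1 \<bullet> flux (d 1) (d 2) + z 2 \<bullet> flux (d 2) (d 1)"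
  have ab: "fst (v (index_pos j)) = a j" "snd (v (index_pos j)) = b j" for j
    by (simp_all add: a_def b_def)
  have d: "adjoint (frechet_derivative F (at x)) (axis \<alpha> 1) = d \<alpha>" for \<alpha> by (simp add: d_def)
  have "Theta F (x, y) v = det ?A * ?c / sqrt (graph_gram (d 1) (d 2))"
    unfolding Theta_coords[OF F] d ab z sum_inner_det_replace_row \<delta>_def[symmetric]
    by (simp add: algebra_simps)
  then have "(Theta F (x, y) v)\<^sup>2 = (det ?A)\<^sup>2 * (?c\<^sup>2 / graph_gram (d 1) (d 2))"
    using graph_gram_pos[of "d 1" "d 2"] by (simp add: power_divide power_mult_distrib)
  also have "?c\<^sup>2 / graph_gram (d 1) (d 2) \<le> graph_gram (z 1) (z 2)"
    using calibration_inequality[of "d 1" "d 2" "z 1" "z 2"] le graph_gram_pos[of "d 1" "d 2"]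
    by (simp add: \<delta>_def field_simps)
  also have "(det ?A)\<^sup>2 * graph_gram (z 1) (z 2) = det (\<chi> (i :: 'n) (j :: 'n). v (index_pos i) \<bullet> v (index_pos j))"
  proof -
    define M where "M u = u + (z 1 \<bullet> u) *\<^sub>R z 1 + (z 2 \<bullet> u) *\<^sub>R z 2" for u
    have "linear M" by (intro linearI) (simp_all add: M_def inner_add_right algebra_simps)
    have "v (index_pos i) \<bullet> v (index_pos j) = a i \<bullet> M (a j)" for i j
    proof -
      have "v (index_pos i) \<bullet> v (index_pos j) = a i \<bullet> a j + b i \<bullet> b j"
        by (simp add: inner_prod_def a_def b_def)
      also have "b i \<bullet> b j = (z 1 \<bullet> a i) * (z 1 \<bullet> a j) + (z 2 \<bullet> a i) * (z 2 \<bullet> a j)"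
        by (simp add: inner_vec_def sum_2 z)
      finally show ?thesis by (simp add: M_def inner_add_right inner_commute mult.commute)
    qed
    then have "det (\<chi> (i :: 'n) (j :: 'n). v (index_pos i) \<bullet> v (index_pos j)) = det ?A * (det (\<chi> i. M (axis i 1)) * det ?A)"
      by (simp only: det_inner_rows det_linear_image_rows[OF \<open>linear M\<close>, of a])
    also have "det (\<chi> i. M (axis i 1)) = graph_gram (z 1) (z 2)"
      unfolding graph_gram_def M_def det_I_plus_two[symmetric] by (simp add: inner_axis)
    finally show ?thesis by (simp add: power2_eq_square mult_ac)
  qed
  finally show ?thesis by (simp add: mult_left_mono)
qed

lemma Theta_sq_le_gram:
  fixes F :: "real^'n::{finite,linorder} \<Rightarrow> real^2" and v :: "nat \<Rightarrow> (real^'n::_) \<times> (real^2)"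
  assumes F: "F differentiable (at x)"
  defines "d \<equiv> \<lambda>\<alpha>. adjoint (frechet_derivative F (at x)) (axis \<alpha> 1)"
  assumes le: "(d 1 \<bullet> d 1) * (d 2 \<bullet> d 2) - (d 1 \<bullet> d 2)\<^sup>2 \<le> 1"
  shows "(Theta F (x, y) v)\<^sup>2 \<le> det (\<chi> (i :: 'n) (j :: 'n). v (index_pos i) \<bullet> v (index_pos j))"
proof -
  \<comment> \<open>Base components are moved towards the identity matrix. For \<open>i\<close>
    outside the range of \<open>index_pos\<close> the direction is unspecified, but those slots are
    not read and the factor \<open>t\<close> still gives \<open>u 0 = v\<close>.\<close>
  define u where "u t i = v i + t *\<^sub>R (axis (inv index_pos i) 1, 0)" for t i
  have u: "u t (index_pos j) = v (index_pos j) + t *\<^sub>R (axis j 1, 0)" for t and j :: 'n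
    by (simp add: u_def inv_f_f inj_def)
  have lim: "((\<lambda>t. u t i) \<longlongrightarrow> u 0 i) (at 0)" for i
    unfolding u_def by (intro tendsto_intros)
  have nz: "graph_gram d e \<noteq> 0" for d e :: "real^'n::_"
    using graph_gram_pos[of d e] by simp
  have "((\<lambda>t. Theta F (x, y) (u t)) \<longlongrightarrow> Theta F (x, y) (u 0)) (at 0)"
    unfolding Theta_coords[OF F]
    by (intro tendsto_intros tendsto_det) (auto intro!: tendsto_intros lim simp: nz)
  moreover have "((\<lambda>t. u t (index_pos i) \<bullet> u t (index_pos j)) \<longlongrightarrow> u 0 (index_pos i) \<bullet> u 0 (index_pos j)) (at 0)"
    for i j :: 'n unfolding u by (auto intro!: tendsto_eq_intros)
  then have "((\<lambda>t. det (\<chi> (i :: 'n) (j :: 'n). u t (index_pos i) \<bullet> u t (index_pos j))) \<longlongrightarrow>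
      det (\<chi> (i :: 'n) (j :: 'n). u 0 (index_pos i) \<bullet> u 0 (index_pos j))) (at 0)"
    by (intro tendsto_det) simp
  moreover have "eventually (\<lambda>t. (Theta F (x, y) (u t))\<^sup>2 \<le>
      det (\<chi> (i :: 'n) (j :: 'n). u t (index_pos i) \<bullet> u t (index_pos j))) (at 0)"
    using eventually_det_add_ident_nonzero[of "\<lambda>j. fst (v (index_pos j))"]
  proof eventually_elim
    case (elim t)
    then show ?case using le unfolding d_def by (intro Theta_sq_le_gram_generic[OF F]) (simp_all add: u)
  qed
  ultimately have "(Theta F (x, y) (u 0))\<^sup>2 \<le> det (\<chi> (i :: 'n) (j :: 'n). u 0 (index_pos i) \<bullet> u 0 (index_pos j))"
    by (intro tendsto_le[OF _ _ tendsto_power]) simp_all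
  moreover have "u 0 = v" by (rule ext) (simp add: u_def flip: zero_prod_def)
  ultimately show ?thesis by simp
qed

lemma comass_Theta_le:
  fixes F :: "real^'n::{finite,linorder} \<Rightarrow> real^2"
  assumes F: "F differentiable (at x)"
    and le: "singular_value (frechet_derivative F (at x)) 1 * singular_value (frechet_derivative F (at x)) 2 \<le> 1"
  shows "comass CARD('n) (Theta F (x, y)) \<le> 1"
  unfolding comass_def
proof (rule SUP_least)
  fix v :: "nat \<Rightarrow> (real^'n::_) \<times> (real^2)"
  assume "v \<in> {v. orthonormal_tuple CARD('n) v}"
  then have "(\<chi> (i :: 'n) (j :: 'n). v (index_pos i) \<bullet> v (index_pos j)) = (mat 1 :: real^'n::_^'n::_)"
    by (auto simp: orthonormal_tuple_def vec_eq_iff mat_def index_pos_less)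
  then have "(Theta F (x, y) v)\<^sup>2 \<le> 1"
    using Theta_sq_le_gram[OF F, of y v]
      area_non_increasing_gram[OF linear_frechet_derivative[OF F] le] by simp
  then have "Theta F (x, y) v \<le> 1" by (metis abs_le_square_iff abs_le_D1 abs_1 one_power2 power_one)
  then show "ereal (Theta F (x, y) v) \<le> 1" by simp
qed

section \<open>Smooth functions\<close>

lemma times_differentiable_on_cong:
  assumes "open S"
  shows "(\<And>x. x \<in> S \<Longrightarrow> f x = g x) \<Longrightarrow>
    times_differentiable_on k f S \<Longrightarrow> times_differentiable_on k g S"
proof (induction k arbitrary: f g)
  case 0
  then show ?case by (simp cong: continuous_on_cong)
next
  case (Suc k)
  have "g differentiable (at x) \<and> frechet_derivative f (at x) = frechet_derivative g (at x)" if "x \<in> S" for x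
  proof -
    have f: "f differentiable (at x)" using Suc.prems(2) that by simp
    then have "(f has_derivative frechet_derivative f (at x)) (at x)"
      by (simp add: frechet_derivative_works)
    then have "(g has_derivative frechet_derivative f (at x)) (at x)"
      using assms that Suc.prems(1) by (rule has_derivative_transform_within_open)
    then show ?thesis by (metis differentiableI frechet_derivative_at)
  qed
  then show ?case
    using Suc.prems(2) Suc.IH[of "\<lambda>x. frechet_derivative f (at x) v" "\<lambda>x. frechet_derivative g (at x) v" for v]
    by simp
qed

text \<open>Lets any explicit formula for the derivative replace \<open>frechet_derivative\<close>
  in the inductions below.\<close>

lemma times_differentiable_on_SucI:
  assumes S: "open S" and f: "\<And>x. x \<in> S \<Longrightarrow> (f has_derivative f' x) (at x)"
    and f': "\<And>v. times_differentiable_on k (\<lambda>x. f' x v) S"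
  shows "times_differentiable_on (Suc k) f S"
proof -
  have "f' x = frechet_derivative f (at x)" if "x \<in> S" for x
    using f[OF that] by (rule frechet_derivative_at)
  then have "times_differentiable_on k (\<lambda>x. frechet_derivative f (at x) v) S" for v
    by (intro times_differentiable_on_cong[OF S _ f']) simp
  then show ?thesis using f by (auto intro: differentiableI)
qed

lemma times_differentiable_on_has_derivative:
  assumes "times_differentiable_on (Suc k) f S" "x \<in> S"
  shows "(f has_derivative frechet_derivative f (at x)) (at x)"
  using assms by (simp add: frechet_derivative_works)

lemma times_differentiable_on_mono:
  "times_differentiable_on (Suc k) f S \<Longrightarrow> times_differentiable_on k f S"
proof (induction k arbitrary: f)
  case 0
  then show ?case
    by (auto intro!: continuous_at_imp_continuous_on differentiable_imp_continuous_within)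
next
  case (Suc k)
  have "(\<forall>x\<in>S. f differentiable (at x)) \<and>
      (\<forall>v. times_differentiable_on (Suc k) (\<lambda>x. frechet_derivative f (at x) v) S)"
    by (rule times_differentiable_on.simps(2)[THEN iffD1, OF Suc.prems])
  then have f: "\<forall>x\<in>S. f differentiable (at x)"
    and f': "\<And>v. times_differentiable_on (Suc k) (\<lambda>x. frechet_derivative f (at x) v) S" by blast+
  show ?case using f Suc.IH[OF f'] by simp
qed

lemma times_differentiable_on_const:
  assumes "open S"
  shows "times_differentiable_on k (\<lambda>_. c) S"
proof (induction k arbitrary: c)
  case (Suc k)
  show ?case by (rule times_differentiable_on_SucI[OF assms, where f'="\<lambda>_ _. 0"]) (auto intro: Suc.IH)
qed simp

lemma times_differentiable_on_add:
  assumes "open S"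
  shows "times_differentiable_on k f S \<Longrightarrow> times_differentiable_on k g S \<Longrightarrow>
    times_differentiable_on k (\<lambda>x. f x + g x) S"
proof (induction k arbitrary: f g)
  case 0
  then show ?case by (simp add: continuous_on_add)
next
  case (Suc k)
  show ?case
  proof (rule times_differentiable_on_SucI[OF assms])
    show "((\<lambda>x. f x + g x) has_derivative
        (\<lambda>v. frechet_derivative f (at x) v + frechet_derivative g (at x) v)) (at x)" if "x \<in> S" for x
      using that Suc.prems by (intro has_derivative_add times_differentiable_on_has_derivative)
  qed (use Suc in simp)
qed

lemma times_differentiable_on_mult:
  fixes f g :: "'a::real_normed_vector \<Rightarrow> real"
  assumes "open S"
  shows "times_differentiable_on k f S \<Longrightarrow> times_differentiable_on k g S \<Longrightarrow>
    times_differentiable_on k (\<lambda>x. f x * g x) S"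
proof (induction k arbitrary: f g)
  case 0
  then show ?case by (simp add: continuous_on_mult)
next
  case (Suc k)
  show ?case
  proof (rule times_differentiable_on_SucI[OF assms])
    show "((\<lambda>x. f x * g x) has_derivative
        (\<lambda>v. f x * frechet_derivative g (at x) v + frechet_derivative f (at x) v * g x)) (at x)" if "x \<in> S" for x
      using that Suc.prems by (intro has_derivative_mult times_differentiable_on_has_derivative)
    show "times_differentiable_on k
        (\<lambda>x. f x * frechet_derivative g (at x) v + frechet_derivative f (at x) v * g x) S" for v
      using Suc.prems times_differentiable_on_mono[OF Suc.prems(1)] times_differentiable_on_mono[OF Suc.prems(2)]
      by (intro times_differentiable_on_add[OF assms] Suc.IH) auto
  qed
qed

lemma times_differentiable_on_bounded_linear:
  assumes "open S" and h: "bounded_linear h"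
  shows "times_differentiable_on k f S \<Longrightarrow> times_differentiable_on k (\<lambda>x. h (f x)) S"
proof (induction k arbitrary: f)
  case 0
  then show ?case using bounded_linear.continuous_on[OF h] by simp
next
  case (Suc k)
  show ?case
  proof (rule times_differentiable_on_SucI[OF assms(1)])
    show "((\<lambda>x. h (f x)) has_derivative (\<lambda>v. h (frechet_derivative f (at x) v))) (at x)" if "x \<in> S" for x
      using that Suc.prems by (intro bounded_linear.has_derivative[OF h] times_differentiable_on_has_derivative)
  qed (use Suc in simp)
qed

lemma times_differentiable_on_compose_fst:
  assumes "open S"
  shows "times_differentiable_on k f S \<Longrightarrow> times_differentiable_on k (\<lambda>p. f (fst p))
      (S \<times> (UNIV :: 'c::real_normed_vector set))"
proof (induction k arbitrary: f)
  case 0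
  then show ?case
    by (auto intro!: continuous_on_compose2[of S f] continuous_intros)
next
  case (Suc k)
  have "open (S \<times> (UNIV :: 'c set))" using assms by (simp add: open_Times)
  then show ?case
  proof (rule times_differentiable_on_SucI)
    fix p assume "p \<in> S \<times> (UNIV :: 'c set)"
    then have "(f has_derivative frechet_derivative f (at (fst p))) (at (fst p))"
      using Suc.prems by (intro times_differentiable_on_has_derivative) auto
    then show "((\<lambda>p. f (fst p)) has_derivative (\<lambda>v. frechet_derivative f (at (fst p)) (fst v))) (at p)"
      using has_derivative_compose[OF has_derivative_fst[OF has_derivative_ident]] by blast
  next
    fix v :: "'a \<times> 'c"
    show "times_differentiable_on k (\<lambda>p. frechet_derivative f (at (fst p)) (fst v)) (S \<times> (UNIV :: 'c set))"
      using Suc.IH[of "\<lambda>x. frechet_derivative f (at x) (fst v)"] Suc.prems by simp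
  qed
qed

text \<open>The power -3/2 is written as a triple product of \<open>1 / sqrt (g x)\<close>, so that
  the induction on the order of differentiability closes with products alone.\<close>

lemma has_derivative_inverse_sqrt:
  fixes g :: "'a::real_normed_vector \<Rightarrow> real"
  assumes g: "(g has_derivative g') (at x)" and pos: "0 < g x"
  shows "((\<lambda>x. 1 / sqrt (g x)) has_derivative
    (\<lambda>v. - (1 / 2) * (1 / sqrt (g x) * (1 / sqrt (g x) * (1 / sqrt (g x)))) * g' v)) (at x)"
proof -
  have "((\<lambda>t. 1 / sqrt t) has_real_derivative
      - (1 / 2) * (1 / sqrt (g x) * (1 / sqrt (g x) * (1 / sqrt (g x))))) (at (g x))"
    using pos by (auto intro!: derivative_eq_intros simp: field_simps)
  from has_derivative_compose[OF g this[unfolded has_field_derivative_def]]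
  show ?thesis by simp
qed

lemma times_differentiable_on_inverse_sqrt:
  fixes g :: "'a::real_normed_vector \<Rightarrow> real"
  assumes "open S" "\<And>x. x \<in> S \<Longrightarrow> 0 < g x"
  shows "times_differentiable_on k g S \<Longrightarrow> times_differentiable_on k (\<lambda>x. 1 / sqrt (g x)) S"
proof (induction k)
  case 0
  then show ?case using assms(2) by (auto intro!: continuous_intros simp: order_less_imp_not_eq2)
next
  case (Suc k)
  note IH = Suc.IH[OF times_differentiable_on_mono[OF Suc.prems]]
  show ?case
  proof (rule times_differentiable_on_SucI[OF assms(1)])
    show "((\<lambda>x. 1 / sqrt (g x)) has_derivative
      (\<lambda>v. - (1 / 2) * (1 / sqrt (g x) * (1 / sqrt (g x) * (1 / sqrt (g x)))) *
        frechet_derivative g (at x) v)) (at x)" if "x \<in> S" for x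
      using that Suc.prems assms(2)
      by (intro has_derivative_inverse_sqrt times_differentiable_on_has_derivative)
    show "times_differentiable_on k (\<lambda>x. - (1 / 2) * (1 / sqrt (g x) * (1 / sqrt (g x) * (1 / sqrt (g x)))) *
        frechet_derivative g (at x) v) S" for v
      using Suc.prems IH
      by (intro times_differentiable_on_mult[OF assms(1)] times_differentiable_on_const[OF assms(1)]) auto
  qed
qed

lemma smooth_on_cong:
  "open S \<Longrightarrow> (\<And>x. x \<in> S \<Longrightarrow> f x = g x) \<Longrightarrow> smooth_on f S \<Longrightarrow> smooth_on g S"
  unfolding smooth_on_def by (blast intro: times_differentiable_on_cong)

lemma smooth_on_const: "open S \<Longrightarrow> smooth_on (\<lambda>_. c) S"
  by (simp add: smooth_on_def times_differentiable_on_const)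

lemma smooth_on_add: "open S \<Longrightarrow> smooth_on f S \<Longrightarrow> smooth_on g S \<Longrightarrow> smooth_on (\<lambda>x. f x + g x) S"
  by (simp add: smooth_on_def times_differentiable_on_add)

lemma smooth_on_mult:
  fixes f g :: "'a::real_normed_vector \<Rightarrow> real"
  shows "open S \<Longrightarrow> smooth_on f S \<Longrightarrow> smooth_on g S \<Longrightarrow> smooth_on (\<lambda>x. f x * g x) S"
  by (simp add: smooth_on_def times_differentiable_on_mult)

lemma smooth_on_diff:
  fixes f g :: "'a::real_normed_vector \<Rightarrow> real"
  assumes "open S" "smooth_on f S" "smooth_on g S"
  shows "smooth_on (\<lambda>x. f x - g x) S"
  using smooth_on_add[OF assms(1,2) smooth_on_mult[OF assms(1) smooth_on_const[OF assms(1), of "-1"] assms(3)]]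
  by simp

lemma smooth_on_sum:
  assumes "open S"
  shows "finite I \<Longrightarrow> (\<And>i. i \<in> I \<Longrightarrow> smooth_on (f i) S) \<Longrightarrow> smooth_on (\<lambda>x. \<Sum>i\<in>I. f i x) S"
  by (induction I rule: finite_induct) (auto intro: smooth_on_const smooth_on_add assms)

lemma smooth_on_bounded_linear:
  "open S \<Longrightarrow> bounded_linear h \<Longrightarrow> smooth_on f S \<Longrightarrow> smooth_on (\<lambda>x. h (f x)) S"
  by (simp add: smooth_on_def times_differentiable_on_bounded_linear)

lemma smooth_on_compose_fst: "open S \<Longrightarrow> smooth_on f S \<Longrightarrow>
    smooth_on (\<lambda>p. f (fst p)) (S \<times> (UNIV :: 'c::real_normed_vector set))"
  by (simp add: smooth_on_def times_differentiable_on_compose_fst)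

lemma smooth_on_divide_sqrt:
  fixes f g :: "'a::real_normed_vector \<Rightarrow> real"
  assumes "open S" "\<And>x. x \<in> S \<Longrightarrow> 0 < g x" "smooth_on f S" "smooth_on g S"
  shows "smooth_on (\<lambda>x. f x / sqrt (g x)) S"
proof -
  have "smooth_on (\<lambda>x. 1 / sqrt (g x)) S"
    using assms by (simp add: smooth_on_def times_differentiable_on_inverse_sqrt)
  from smooth_on_mult[OF assms(1,3) this] show ?thesis by simp
qed

lemma smooth_on_has_derivative:
  "smooth_on f S \<Longrightarrow> x \<in> S \<Longrightarrow> (f has_derivative frechet_derivative f (at x)) (at x)"
  unfolding smooth_on_def by (blast intro: times_differentiable_on_has_derivative)

lemma smooth_on_differentiable: "smooth_on f S \<Longrightarrow> x \<in> S \<Longrightarrow> f differentiable (at x)"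
  by (blast intro: differentiableI smooth_on_has_derivative)

lemma smooth_on_frechet_derivative:
  "smooth_on f S \<Longrightarrow> smooth_on (\<lambda>x. frechet_derivative f (at x) v) S"
  unfolding smooth_on_def by (metis times_differentiable_on.simps(2))

lemma smooth_on_continuous_on: "smooth_on f S \<Longrightarrow> continuous_on S f"
  unfolding smooth_on_def by (meson times_differentiable_on.simps(1))

section \<open>Symmetry of second derivatives\<close>

lemma has_real_derivative_along_line:
  fixes f :: "'a::real_normed_vector \<Rightarrow> real"
  assumes "(f has_derivative f') (at (a + s *\<^sub>R u))"
  shows "((\<lambda>s. f (a + s *\<^sub>R u)) has_real_derivative f' u) (at s)"
proof -
  have "((\<lambda>s. a + s *\<^sub>R u) has_derivative (\<lambda>h. h *\<^sub>R u)) (at s)"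
    by (auto intro!: derivative_eq_intros)
  from has_derivative_compose[OF this assms]
  have "((\<lambda>s. f (a + s *\<^sub>R u)) has_derivative (\<lambda>h. f' (h *\<^sub>R u))) (at s)" .
  moreover have "f' (h *\<^sub>R u) = f' u * h" for h
    using linear_scale[OF has_derivative_linear[OF assms]] by simp
  ultimately show ?thesis by (simp add: has_field_derivative_def)
qed

text \<open>The mean value theorem twice: along \<open>u\<close> for the increment of
  \<open>f\<close> in direction \<open>v\<close>, then along \<open>v\<close> for the derivative in
  direction \<open>u\<close>.\<close>

lemma second_difference_mvt:
  fixes f :: "'a::real_normed_vector \<Rightarrow> real"
  assumes f: "\<And>y. y \<in> S \<Longrightarrow> (f has_derivative f' y) (at y)"
    and f'': "\<And>y. y \<in> S \<Longrightarrow> ((\<lambda>y. f' y u) has_derivative f'' y) (at y)"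
    and t: "0 < t" and S: "\<And>a b. 0 \<le> a \<Longrightarrow> a \<le> t \<Longrightarrow> 0 \<le> b \<Longrightarrow> b \<le> t \<Longrightarrow> x + a *\<^sub>R u + b *\<^sub>R v \<in> S"
  obtains a b where "0 \<le> a" "a \<le> t" "0 \<le> b" "b \<le> t"
    "f (x + t *\<^sub>R u + t *\<^sub>R v) - f (x + t *\<^sub>R u) - f (x + t *\<^sub>R v) + f x =
      t\<^sup>2 * f'' (x + a *\<^sub>R u + b *\<^sub>R v) v"
proof -
  have "((\<lambda>s. f (x + t *\<^sub>R v + s *\<^sub>R u) - f (x + s *\<^sub>R u)) has_real_derivative
      f' (x + t *\<^sub>R v + s *\<^sub>R u) u - f' (x + s *\<^sub>R u) u) (at s)" if "0 \<le> s" "s \<le> t" for s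
    using f[OF S[of s t]] f[OF S[of s 0]] that t
    by (intro DERIV_diff has_real_derivative_along_line) (auto simp: add_ac)
  from MVT2[OF t this] obtain a where a: "0 < a" "a < t"
    "f (x + t *\<^sub>R v + t *\<^sub>R u) - f (x + t *\<^sub>R u) - (f (x + t *\<^sub>R v + 0 *\<^sub>R u) - f (x + 0 *\<^sub>R u)) =
      (t - 0) * (f' (x + t *\<^sub>R v + a *\<^sub>R u) u - f' (x + a *\<^sub>R u) u)"
    by blast
  have "((\<lambda>s. f' (x + a *\<^sub>R u + s *\<^sub>R v) u) has_real_derivative
      f'' (x + a *\<^sub>R u + s *\<^sub>R v) v) (at s)" if "0 \<le> s" "s \<le> t" for s
    using f''[OF S[of a s]] that a by (intro has_real_derivative_along_line) auto
  from MVT2[OF t this] obtain b where b: "0 < b" "b < t"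
    "f' (x + a *\<^sub>R u + t *\<^sub>R v) u - f' (x + a *\<^sub>R u + 0 *\<^sub>R v) u = (t - 0) * f'' (x + a *\<^sub>R u + b *\<^sub>R v) v"
    by blast
  have "f (x + t *\<^sub>R u + t *\<^sub>R v) - f (x + t *\<^sub>R u) - f (x + t *\<^sub>R v) + f x =
      t * (f' (x + a *\<^sub>R u + t *\<^sub>R v) u - f' (x + a *\<^sub>R u) u)"
    using a(3) by (simp add: add_ac)
  also have "\<dots> = t\<^sup>2 * f'' (x + a *\<^sub>R u + b *\<^sub>R v) v" using b(3) by (simp add: power2_eq_square)
  finally show ?thesis using a b that[of a b] by simp
qed

text \<open>One second difference, evaluated in both orders, gives equal mixed derivatives at two
  points near \<open>x\<close>. By continuity each is within \<open>e\<close>, half the supposed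
  gap, of its value at \<open>x\<close>: a contradiction.\<close>

lemma symmetric_second_derivative:
  fixes f :: "'a::real_normed_vector \<Rightarrow> real"
  assumes S: "open S" "x \<in> S"
    and f: "\<And>y. y \<in> S \<Longrightarrow> (f has_derivative f' y) (at y)"
    and u: "\<And>y. y \<in> S \<Longrightarrow> ((\<lambda>y. f' y u) has_derivative f''\<^sub>u y) (at y)"
    and v: "\<And>y. y \<in> S \<Longrightarrow> ((\<lambda>y. f' y v) has_derivative f''\<^sub>v y) (at y)"
    and cont: "continuous_on S (\<lambda>y. f''\<^sub>u y v)" "continuous_on S (\<lambda>y. f''\<^sub>v y u)"
  shows "f''\<^sub>u x v = f''\<^sub>v x u"
proof (rule ccontr)
  define e where "e = \<bar>f''\<^sub>u x v - f''\<^sub>v x u\<bar> / 2"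
  assume "f''\<^sub>u x v \<noteq> f''\<^sub>v x u"
  then have e: "e > 0" by (simp add: e_def)
  have near_nhds: "eventually (\<lambda>y. dist (g y) (g x) < e) (nhds x)" if "isCont g x" for g :: "'a \<Rightarrow> real"
  proof -
    have "eventually (\<lambda>y. dist (g y) (g x) < e) (at x)"
      using that e by (auto simp: isCont_def intro: tendstoD)
    then have "eventually (\<lambda>y. y \<noteq> x \<longrightarrow> dist (g y) (g x) < e) (nhds x)"
      by (simp add: eventually_at_filter)
    then show ?thesis by (rule eventually_mono) (use e in \<open>metis dist_self\<close>)
  qed
  have isCont: "isCont (\<lambda>y. f''\<^sub>u y v) x" "isCont (\<lambda>y. f''\<^sub>v y u) x"
    using cont S by (simp_all add: continuous_on_eq_continuous_at)
  have "eventually (\<lambda>y. dist (f''\<^sub>u y v) (f''\<^sub>u x v) < e) (nhds x)"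
    by (rule near_nhds[OF isCont(1)])
  moreover have "eventually (\<lambda>y. dist (f''\<^sub>v y u) (f''\<^sub>v x u) < e) (nhds x)"
    by (rule near_nhds[OF isCont(2)])
  moreover have "eventually (\<lambda>y. y \<in> S) (nhds x)" using S by (rule eventually_nhds_in_open)
  ultimately have "eventually (\<lambda>y. y \<in> S \<and> dist (f''\<^sub>u y v) (f''\<^sub>u x v) < e \<and>
      dist (f''\<^sub>v y u) (f''\<^sub>v x u) < e) (nhds x)"
    by eventually_elim simp
  then obtain r where r: "r > 0" and ball: "\<And>y. dist y x < r \<Longrightarrow> y \<in> S \<and>
      dist (f''\<^sub>u y v) (f''\<^sub>u x v) < e \<and> dist (f''\<^sub>v y u) (f''\<^sub>v x u) < e"
    by (auto simp: eventually_nhds_metric)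
  \<comment> \<open>Keeps the whole parallelogram with sides \<open>t\<close> times \<open>u\<close>
    and \<open>t\<close> times \<open>v\<close> inside the ball of radius \<open>r\<close>; the
    summand 1 covers \<open>u = v = 0\<close>.\<close>
  define t where "t = r / (norm u + norm v + 1)"
  have pos: "norm u + norm v + 1 > 0" by (simp add: add_nonneg_pos)
  then have t: "t > 0" using r by (simp add: t_def)
  have near: "dist (x + a *\<^sub>R u + b *\<^sub>R v) x < r" if "0 \<le> a" "a \<le> t" "0 \<le> b" "b \<le> t" for a b
  proof -
    have "dist (x + a *\<^sub>R u + b *\<^sub>R v) x = norm (a *\<^sub>R u + b *\<^sub>R v)" by (simp add: dist_norm)
    also have "\<dots> \<le> a * norm u + b * norm v"
      using norm_triangle_ineq[of "a *\<^sub>R u" "b *\<^sub>R v"] that by simp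
    also have "\<dots> \<le> t * norm u + t * norm v" using that by (intro add_mono mult_right_mono) auto
    also have "\<dots> < t * (norm u + norm v + 1)" using t by (simp add: algebra_simps)
    also have "\<dots> = r" using pos by (simp add: t_def)
    finally show ?thesis .
  qed
  have near': "dist (x + a *\<^sub>R v + b *\<^sub>R u) x < r" if "0 \<le> a" "a \<le> t" "0 \<le> b" "b \<le> t" for a b
    using near[of b a] that by (simp add: add_ac)
  have inS: "x + a *\<^sub>R u + b *\<^sub>R v \<in> S" if "0 \<le> a" "a \<le> t" "0 \<le> b" "b \<le> t" for a b
    using ball[OF near[OF that]] by blast
  have inS': "x + a *\<^sub>R v + b *\<^sub>R u \<in> S" if "0 \<le> a" "a \<le> t" "0 \<le> b" "b \<le> t" for a b
    using ball[OF near'[OF that]] by blast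
  let ?\<Delta> = "f (x + t *\<^sub>R u + t *\<^sub>R v) - f (x + t *\<^sub>R u) - f (x + t *\<^sub>R v) + f x"
  obtain a b where ab: "0 \<le> a" "a \<le> t" "0 \<le> b" "b \<le> t" "?\<Delta> = t\<^sup>2 * f''\<^sub>u (x + a *\<^sub>R u + b *\<^sub>R v) v"
    by (rule second_difference_mvt[OF f u t inS])
  obtain c d where cd: "0 \<le> c" "c \<le> t" "0 \<le> d" "d \<le> t"
    "f (x + t *\<^sub>R v + t *\<^sub>R u) - f (x + t *\<^sub>R v) - f (x + t *\<^sub>R u) + f x = t\<^sup>2 * f''\<^sub>v (x + c *\<^sub>R v + d *\<^sub>R u) u"
    by (rule second_difference_mvt[OF f v t inS'])
  have "x + t *\<^sub>R v + t *\<^sub>R u = x + t *\<^sub>R u + t *\<^sub>R v" by (simp add: add_ac)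
  from cd(5)[unfolded this]
  have "t\<^sup>2 * f''\<^sub>u (x + a *\<^sub>R u + b *\<^sub>R v) v = t\<^sup>2 * f''\<^sub>v (x + c *\<^sub>R v + d *\<^sub>R u) u"
    using ab(5) by linarith
  then have "f''\<^sub>u (x + a *\<^sub>R u + b *\<^sub>R v) v = f''\<^sub>v (x + c *\<^sub>R v + d *\<^sub>R u) u" using t by simp
  moreover have "dist (f''\<^sub>u (x + a *\<^sub>R u + b *\<^sub>R v) v) (f''\<^sub>u x v) < e"
    using ball[OF near] ab by blast
  moreover have "dist (f''\<^sub>v (x + c *\<^sub>R v + d *\<^sub>R u) u) (f''\<^sub>v x u) < e"
    using ball[OF near'] cd by blast
  ultimately have "dist (f''\<^sub>u x v) (f''\<^sub>v x u) < e + e"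
    by (metis dist_commute dist_triangle_less_add)
  then show False by (simp add: e_def dist_real_def)
qed

section \<open>Closedness\<close>

definition base_vol :: "(nat \<Rightarrow> (real^'n::{finite,linorder}) \<times> 'b) \<Rightarrow> real" where
  "base_vol v = det (\<chi> j. fst (v (index_pos j)))"

lemma alternating_form_base_vol:
  "alternating_form CARD('n) (base_vol :: (nat \<Rightarrow> (real^'n::{finite,linorder}) \<times> 'b::real_vector) \<Rightarrow> real)"
proof -
  have "linear (fst :: (real^'n::_) \<times> 'b \<Rightarrow> real^'n::_)" "linear (\<lambda>_ :: (real^'n::_) \<times> 'b. 0 :: real^'n::_)"
    by (auto intro!: linearI)
  then have "alternating_form CARD('n) (\<lambda>v. poly (pdet (fst :: (real^'n::_) \<times> 'b \<Rightarrow> real^'n::_) (\<lambda>_. 0) v) 0)"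
    by (rule alternating_form_pdet) auto
  then show ?thesis by (simp add: poly_pdet base_vol_def[abs_def])
qed

lemma base_vol_upd:
  "base_vol (v(index_pos k := u)) = det (\<chi> j. if j = k then fst u else fst (v (index_pos j)))"
  unfolding base_vol_def by (rule arg_cong[where f=det]) (simp add: vec_eq_iff)

lemma covector_wedge_interior_base_vol:
  fixes v :: "nat \<Rightarrow> (real^'n::{finite,linorder}) \<times> 'b::real_vector"
  shows "covector_wedge CARD('n) \<beta> (interior_mult u base_vol) v =
    (\<Sum>k\<in>UNIV. \<beta> (v (index_pos k)) * det (\<chi> j. if j = k then fst u else fst (v (index_pos j))))"
  unfolding covector_wedge_interior_mult[OF alternating_form_base_vol] sum_index_pos[symmetric]
    base_vol_upd ..

lemma covector_wedge_fst_interior_base_vol: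
  fixes v :: "nat \<Rightarrow> (real^'n::{finite,linorder}) \<times> 'b::real_vector"
  shows "covector_wedge CARD('n) (\<lambda>w. c \<bullet> fst w) (interior_mult u base_vol) v = (c \<bullet> fst u) * base_vol v"
  unfolding covector_wedge_interior_base_vol base_vol_def
  using sum_inner_det_replace_row[of c "\<lambda>j. fst (v (index_pos j))" "fst u"] by simp

lemma covector_wedge_scale: "covector_wedge k \<alpha> (\<lambda>w. c * \<eta> w) v = c * covector_wedge k \<alpha> \<eta> v"
  by (simp add: covector_wedge_def sum_distrib_left mult_ac)

text \<open>For nonzero \<open>c\<close> the volume form is itself \<open>c\<close> wedged with its
  contraction by \<open>c / (c \<bullet> c)\<close>; wedging with \<open>c\<close> a second time
  gives zero by anticommutation.\<close>

lemma covector_wedge_fst_base_vol: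
  fixes v :: "nat \<Rightarrow> (real^'n::{finite,linorder}) \<times> 'b::real_vector"
  shows "covector_wedge (Suc CARD('n)) (\<lambda>w. c \<bullet> fst w) base_vol v = 0"
proof (cases "c = 0")
  case True
  then show ?thesis by (simp add: covector_wedge_def)
next
  case False
  let ?\<eta> = "interior_mult (c /\<^sub>R (c \<bullet> c), 0 :: 'b) base_vol"
  have "base_vol = covector_wedge CARD('n) (\<lambda>w. c \<bullet> fst w) ?\<eta>"
    by (rule ext) (use False in \<open>simp add: covector_wedge_fst_interior_base_vol\<close>)
  then show ?thesis
    using covector_wedge_anticommute[of "CARD('n)" "\<lambda>w. c \<bullet> fst w" "\<lambda>w. c \<bullet> fst w" ?\<eta> v] by simp
qed

text \<open>After exchanging the two covectors, \<open>c\<close> meets the contracted volume form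
  and contributes only \<open>c \<bullet> fst u\<close>.\<close>

lemma covector_wedge_fst_flux:
  fixes v :: "nat \<Rightarrow> (real^'n::{finite,linorder}) \<times> 'b::real_vector"
  shows "covector_wedge (Suc CARD('n)) (\<lambda>w. c \<bullet> fst w)
      (covector_wedge CARD('n) \<beta> (interior_mult u base_vol)) v =
    - (c \<bullet> fst u) * covector_wedge (Suc CARD('n)) \<beta> base_vol v"
proof -
  have "covector_wedge CARD('n) (\<lambda>w. c \<bullet> fst w) (interior_mult u base_vol) =
      (\<lambda>w :: nat \<Rightarrow> (real^'n::_) \<times> 'b. (c \<bullet> fst u) * base_vol w)"
    by (rule ext) (rule covector_wedge_fst_interior_base_vol)
  then show ?thesis
    by (subst covector_wedge_anticommute) (simp add: covector_wedge_scale)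
qed

lemma linear_expand_axis:
  fixes f :: "real^'n \<Rightarrow> 'b::real_vector"
  assumes "linear f"
  shows "f u = (\<Sum>m\<in>UNIV. (u $ m) *\<^sub>R f (axis m 1))"
proof -
  have "f u = f (\<Sum>m\<in>UNIV. (u $ m) *\<^sub>R axis m 1)"
    using basis_expansion[of u] by (simp add: scalar_mult_eq_scaleR)
  then show ?thesis using assms by (simp add: linear_sum linear_scale)
qed

lemma linear_functional_inner:
  fixes f :: "real^'n \<Rightarrow> real"
  assumes "linear f"
  shows "f u = (\<chi> m. f (axis m 1)) \<bullet> u"
  by (subst linear_expand_axis[OF assms]) (simp add: inner_vec_def mult.commute)

section \<open>Divergence of the flux fields\<close>

lemma graph_gram_commute: "graph_gram d e = graph_gram e d"
  by (simp add: graph_gram_def inner_commute mult.commute)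

lemma has_derivative_graph_gram:
  fixes d e :: "'a::real_normed_vector \<Rightarrow> 'b::real_inner"
  assumes d: "(d has_derivative A) (at x)" and e: "(e has_derivative B) (at x)"
  shows "((\<lambda>y. graph_gram (d y) (e y)) has_derivative
    (\<lambda>u. 2 * ((1 + e x \<bullet> e x) * (A u \<bullet> d x) + (1 + d x \<bullet> d x) * (B u \<bullet> e x)
        - (d x \<bullet> e x) * (B u \<bullet> d x + A u \<bullet> e x)))) (at x)"
  unfolding graph_gram_def
  by (rule has_derivative_eq_rhs, (rule derivative_eq_intros d e refl)+)
     (rule ext, simp add: inner_commute algebra_simps)

lemma has_derivative_flux:
  fixes d e :: "'a::real_normed_vector \<Rightarrow> 'b::real_inner"
  assumes d: "(d has_derivative A) (at x)" and e: "(e has_derivative B) (at x)"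
  shows "((\<lambda>y. flux (d y) (e y)) has_derivative
    (\<lambda>u. (1 + e x \<bullet> e x) *\<^sub>R A u + (2 * (B u \<bullet> e x)) *\<^sub>R d x
        - (d x \<bullet> e x) *\<^sub>R B u - (B u \<bullet> d x + A u \<bullet> e x) *\<^sub>R e x)) (at x)"
  unfolding flux_def
  by (rule has_derivative_eq_rhs, (rule derivative_eq_intros d e refl)+)
     (rule ext, simp add: inner_commute algebra_simps)

text \<open>\<open>A\<close> and \<open>B\<close> stand for the Hessians of the two components;
  \<open>minA\<close> and \<open>minB\<close> are the minimal surface system in non-divergence form
  with the denominator \<open>g\<close> cleared. Passing to divergence form uses both equations and
  the symmetry of the Hessians.\<close>

lemma divergence_flux:
  fixes d e :: "real^'n \<Rightarrow> real^'n"
  assumes d: "(d has_derivative A) (at x)" and e: "(e has_derivative B) (at x)"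
    and sym: "\<And>u v. A u \<bullet> v = u \<bullet> A v" "\<And>u v. B u \<bullet> v = u \<bullet> B v"
    and minA: "graph_gram (d x) (e x) * (\<Sum>m\<in>UNIV. A (axis m 1) $ m) =
      A (flux (d x) (e x)) \<bullet> d x + A (flux (e x) (d x)) \<bullet> e x"
    and minB: "graph_gram (d x) (e x) * (\<Sum>m\<in>UNIV. B (axis m 1) $ m) =
      B (flux (d x) (e x)) \<bullet> d x + B (flux (e x) (d x)) \<bullet> e x"
  shows "\<exists>V'. ((\<lambda>y. (1 / sqrt (graph_gram (d y) (e y))) *\<^sub>R flux (d y) (e y)) has_derivative V') (at x) \<and>
    (\<Sum>m\<in>UNIV. V' (axis m 1) $ m) = 0"
proof -
  have lin: "linear A" "linear B" using d e by (auto dest: has_derivative_linear)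
  define D where "D = d x"
  define E where "E = e x"
  define U where "U = flux D E"
  define g where "g = graph_gram D E"
  define k where "k = 1 / sqrt g"
  define g' where "g' u = 2 * ((1 + E \<bullet> E) * (A u \<bullet> D) + (1 + D \<bullet> D) * (B u \<bullet> E)
        - (D \<bullet> E) * (B u \<bullet> D + A u \<bullet> E))" for u
  define U' where "U' u = (1 + E \<bullet> E) *\<^sub>R A u + (2 * (B u \<bullet> E)) *\<^sub>R D
        - (D \<bullet> E) *\<^sub>R B u - (B u \<bullet> D + A u \<bullet> E) *\<^sub>R E" for u
  define V' where "V' u = k *\<^sub>R U' u + (- (1 / 2) * (k * (k * k)) * g' u) *\<^sub>R U" for u
  have g: "g > 0" unfolding g_def by (rule graph_gram_pos)
  have kk: "k * k * g = 1" using g by (simp add: k_def)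
  have "((\<lambda>y. (1 / sqrt (graph_gram (d y) (e y))) *\<^sub>R flux (d y) (e y)) has_derivative V') (at x)"
    unfolding V'_def k_def g_def U_def D_def E_def U'_def g'_def
    by (intro has_derivative_scaleR has_derivative_inverse_sqrt has_derivative_graph_gram
        has_derivative_flux d e graph_gram_pos)
  moreover have "(\<Sum>m\<in>UNIV. V' (axis m 1) $ m) = 0"
  proof -
    \<comment> \<open>Turns the divergence of a scalar times a constant vector into the derivative
      of the scalar along that vector.\<close>
    have trace: "(\<Sum>m\<in>UNIV. f (axis m 1) * w $ m) = f w" if "linear f" for f :: "real^'n \<Rightarrow> real" and w
      using linear_expand_axis[OF that, of w] by (simp add: mult.commute)
    have linA: "linear (\<lambda>u. A u \<bullet> w)" "linear (\<lambda>u. B u \<bullet> w)" for w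
      using lin by (auto intro!: linearI simp: linear_add linear_scale inner_add_left)
    have ling': "linear g'"
      using lin by (auto intro!: linearI simp: g'_def linear_add linear_scale inner_add_left algebra_simps)
    define tA where "tA = (\<Sum>m\<in>UNIV. A (axis m 1) $ m)"
    define tB where "tB = (\<Sum>m\<in>UNIV. B (axis m 1) $ m)"
    have "(\<Sum>m\<in>UNIV. U' (axis m 1) $ m) = (1 + E \<bullet> E) * tA + 2 * (B D \<bullet> E) - (D \<bullet> E) * tB
        - (B E \<bullet> D + A E \<bullet> E)"
      using trace[OF linA(2), of E D] trace[OF linA(2), of D E] trace[OF linA(1), of E E]
      by (simp add: U'_def tA_def tB_def sum.distrib sum_subtractf distrib_right
          mult.assoc flip: sum_distrib_left)
    then have "(\<Sum>m\<in>UNIV. V' (axis m 1) $ m) =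
        k * ((1 + E \<bullet> E) * tA + 2 * (B D \<bullet> E) - (D \<bullet> E) * tB - (B E \<bullet> D + A E \<bullet> E))
        - (1 / 2) * (k * (k * k)) * g' U"
      using trace[OF ling', of U]
      by (simp add: V'_def sum.distrib sum_subtractf sum_negf mult.assoc flip: sum_distrib_left sum_divide_distrib)
    \<comment> \<open>Since \<open>k * k * g = 1\<close>, a factor \<open>k\<close> cubed comes out
      and the bracket is free of square roots; the traces occur there only multiplied by
      \<open>g\<close>, as in the minimality equations.\<close>
    also have "\<dots> = k * (k * k) * (((1 + E \<bullet> E) * (g * tA) + g * (2 * (B D \<bullet> E)) - (D \<bullet> E) * (g * tB)
        - g * (B E \<bullet> D + A E \<bullet> E)) - (1 / 2) * g' U)"
      using kk by algebra
    also have "((1 + E \<bullet> E) * (g * tA) + g * (2 * (B D \<bullet> E)) - (D \<bullet> E) * (g * tB)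
        - g * (B E \<bullet> D + A E \<bullet> E)) - (1 / 2) * g' U = 0"
    proof -
      have sym': "A E \<bullet> D = A D \<bullet> E" "B E \<bullet> D = B D \<bullet> E" "E \<bullet> D = D \<bullet> E"
        using sym by (simp_all add: inner_commute)
      have gt: "g * tA = A (flux D E) \<bullet> D + A (flux E D) \<bullet> E" "g * tB = B (flux D E) \<bullet> D + B (flux E D) \<bullet> E"
        using minA minB by (simp_all add: g_def tA_def tB_def D_def E_def)
      show ?thesis
        unfolding gt g'_def U_def flux_def
        by (simp add: linear_diff[OF lin(1)] linear_diff[OF lin(2)] linear_scale[OF lin(1)]
            linear_scale[OF lin(2)] inner_diff_left sym' g_def graph_gram_def) algebra
    qed
    finally show ?thesis by simp
  qed
  ultimately show ?thesis by blast
qed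

section \<open>The minimal surface system of a graph\<close>

lemma normal_part_diff_mem:
  assumes "subspace T"
  shows "w - normal_part T w \<in> T"
proof -
  have "\<exists>!z. z \<in> orthogonal_comp T \<and> w - z \<in> T"
  proof (rule ex_ex1I)
    obtain y z where "y \<in> span T" "\<And>u. u \<in> span T \<Longrightarrow> orthogonal z u" "w = y + z"
      using orthogonal_subspace_decomp_exists[of T w] by blast
    then show "\<exists>z. z \<in> orthogonal_comp T \<and> w - z \<in> T"
      using assms by (intro exI[of _ z]) (auto simp: orthogonal_comp_def orthogonal_commute span_eq_iff[THEN iffD2])
  next
    fix z z' assume z: "z \<in> orthogonal_comp T \<and> w - z \<in> T" "z' \<in> orthogonal_comp T \<and> w - z' \<in> T"
    then have "(w - z') - (w - z) \<in> T" using subspace_diff[OF assms] by blast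
    then have "z - z' \<in> T" by simp
    moreover have "z - z' \<in> orthogonal_comp T"
      using z by (intro subspace_diff subspace_orthogonal_comp) auto
    ultimately have "(z - z') \<bullet> (z - z') = 0" by (auto simp: orthogonal_comp_def orthogonal_def)
    then show "z = z'" by simp
  qed
  from theI'[OF this] show ?thesis by (simp add: normal_part_def)
qed

lemma matrix_inv_eqI:
  fixes A :: "real^'n^'n"
  assumes "A ** X = mat 1"
  shows "matrix_inv A = X"
proof -
  have XA: "X ** A = mat 1" using assms by (simp add: matrix_left_right_inverse)
  have "\<exists>Y. A ** Y = mat 1 \<and> Y ** A = mat 1" using assms XA by blast
  then have "A ** matrix_inv A = mat 1 \<and> matrix_inv A ** A = mat 1"
    unfolding matrix_inv_def by (rule someI_ex)
  then show ?thesis by (metis XA matrix_mul_assoc matrix_mul_lid matrix_mul_rid)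
qed

definition component_grad :: "(real^'n \<Rightarrow> real^'m) \<Rightarrow> 'm \<Rightarrow> real^'n \<Rightarrow> real^'n" where
  "component_grad F \<alpha> x = adjoint (frechet_derivative F (at x)) (axis \<alpha> 1)"

text \<open>Built from the partial derivatives of \<open>F\<close>, to which
  \<open>smooth_on\<close> applies directly, rather than as the derivative of the adjoint in
  \<open>component_grad\<close>.\<close>

definition component_hess :: "(real^'n \<Rightarrow> real^'m) \<Rightarrow> 'm \<Rightarrow> real^'n \<Rightarrow> real^'n \<Rightarrow> real^'n" where
  "component_hess F \<alpha> x u =
    (\<chi> m. frechet_derivative (\<lambda>y. frechet_derivative F (at y) (axis m 1)) (at x) u $ \<alpha>)"

lemma frechet_derivative_component:
  assumes "F differentiable (at x)"
  shows "frechet_derivative F (at x) u $ \<alpha> = component_grad F \<alpha> x \<bullet> u"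
  unfolding component_grad_def by (rule linear_nth_eq_adjoint_inner[OF linear_frechet_derivative[OF assms]])

context
  fixes F :: "real^'n \<Rightarrow> real^'m" and \<Omega> :: "(real^'n) set"
  assumes \<Omega>: "open \<Omega>" and F: "smooth_on F \<Omega>"
begin

lemma component_grad_nth:
  "x \<in> \<Omega> \<Longrightarrow> component_grad F \<alpha> x $ m = frechet_derivative F (at x) (axis m 1) $ \<alpha>"
  by (simp add: frechet_derivative_component[OF smooth_on_differentiable[OF F]] inner_axis)

lemma smooth_on_component_grad: "smooth_on (\<lambda>x. component_grad F \<alpha> x $ m) \<Omega>"
proof (rule smooth_on_cong[OF \<Omega>])
  show "smooth_on (\<lambda>x. frechet_derivative F (at x) (axis m 1) $ \<alpha>) \<Omega>"
    by (intro smooth_on_bounded_linear[OF \<Omega> bounded_linear_vec_nth] smooth_on_frechet_derivative F)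
qed (simp add: component_grad_nth)

lemma component_grad_has_derivative:
  assumes x: "x \<in> \<Omega>"
  shows "(component_grad F \<alpha> has_derivative component_hess F \<alpha> x) (at x)"
  unfolding has_derivative_componentwise_within[of "component_grad F \<alpha>"]
proof
  fix i :: "real^'n" assume "i \<in> Basis"
  then obtain m where i: "i = axis m 1" by (auto simp: Basis_vec_def)
  have "((\<lambda>y. frechet_derivative F (at y) (axis m 1) $ \<alpha>) has_derivative
      (\<lambda>u. component_hess F \<alpha> x u \<bullet> i)) (at x)"
    unfolding i inner_axis component_hess_def
    by (simp, intro bounded_linear.has_derivative[OF bounded_linear_vec_nth]
        smooth_on_has_derivative[OF smooth_on_frechet_derivative[OF F] x])
  then show "((\<lambda>y. component_grad F \<alpha> y \<bullet> i) has_derivative (\<lambda>u. component_hess F \<alpha> x u \<bullet> i)) (at x)"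
    by (rule has_derivative_transform_within_open[OF _ \<Omega> x]) (simp add: i inner_axis component_grad_nth)
qed

lemma component_hess_symmetric_axis:
  assumes x: "x \<in> \<Omega>"
  shows "component_hess F \<alpha> x (axis i 1) $ j = component_hess F \<alpha> x (axis j 1) $ i"
proof -
  define f'' where "f'' k y u = frechet_derivative (\<lambda>y. frechet_derivative F (at y) (axis k 1)) (at y) u $ \<alpha>"
    for k y u
  note nth = bounded_linear.has_derivative[OF bounded_linear_vec_nth]
  have f: "((\<lambda>y. F y $ \<alpha>) has_derivative (\<lambda>u. frechet_derivative F (at y) u $ \<alpha>)) (at y)"
    if "y \<in> \<Omega>" for y
    by (intro nth smooth_on_has_derivative[OF F that])
  have f': "((\<lambda>y. frechet_derivative F (at y) (axis k 1) $ \<alpha>) has_derivative f'' k y) (at y)"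
    if "y \<in> \<Omega>" for k y
    unfolding f''_def
    by (intro nth smooth_on_has_derivative[OF smooth_on_frechet_derivative[OF F] that])
  have cont: "continuous_on \<Omega> (\<lambda>y. f'' k y u)" for k u
    unfolding f''_def
    by (intro smooth_on_continuous_on smooth_on_bounded_linear[OF \<Omega> bounded_linear_vec_nth]
        smooth_on_frechet_derivative F)
  have "f'' j x (axis i 1) = f'' i x (axis j 1)"
    by (rule symmetric_second_derivative[OF \<Omega> x f f' f' cont cont])
  then show ?thesis by (simp add: component_hess_def f''_def)
qed

lemma linear_component_hess: "x \<in> \<Omega> \<Longrightarrow> linear (component_hess F \<alpha> x)"
  by (rule has_derivative_linear[OF component_grad_has_derivative])

lemma component_hess_nth:
  "x \<in> \<Omega> \<Longrightarrow> component_hess F \<alpha> x u $ j = (\<Sum>i\<in>UNIV. u $ i * component_hess F \<alpha> x (axis i 1) $ j)"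
  by (subst linear_expand_axis[OF linear_component_hess]) simp_all

lemma component_hess_symmetric:
  assumes x: "x \<in> \<Omega>"
  shows "component_hess F \<alpha> x u \<bullet> v = u \<bullet> component_hess F \<alpha> x v"
proof -
  let ?H = "\<lambda>i j. component_hess F \<alpha> x (axis i 1) $ j"
  have "component_hess F \<alpha> x u \<bullet> v = (\<Sum>j\<in>UNIV. \<Sum>i\<in>UNIV. u $ i * ?H i j * v $ j)"
    by (simp add: inner_vec_def component_hess_nth[OF x, of \<alpha> u] sum_distrib_right)
  also have "\<dots> = (\<Sum>i\<in>UNIV. \<Sum>j\<in>UNIV. u $ i * ?H j i * v $ j)"
    by (subst sum.swap) (simp add: component_hess_symmetric_axis[OF x, of \<alpha>])
  also have "\<dots> = u \<bullet> component_hess F \<alpha> x v"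
    by (simp add: inner_vec_def component_hess_nth[OF x, of \<alpha> v] sum_distrib_left mult_ac)
  finally show ?thesis .
qed

lemma graph_map_second_derivative:
  assumes x: "x \<in> \<Omega>"
  shows "frechet_derivative (\<lambda>y. frechet_derivative (graph_map F) (at y) v) (at x) u =
    (0, frechet_derivative (\<lambda>y. frechet_derivative F (at y) v) (at x) u)"
proof -
  let ?F'' = "frechet_derivative (\<lambda>y. frechet_derivative F (at y) v) (at x)"
  have "((\<lambda>y. (v, frechet_derivative F (at y) v)) has_derivative (\<lambda>u. (0, ?F'' u))) (at x)"
    by (intro has_derivative_Pair has_derivative_const
        smooth_on_has_derivative[OF smooth_on_frechet_derivative[OF F] x])
  then have "((\<lambda>y. frechet_derivative (graph_map F) (at y) v) has_derivative (\<lambda>u. (0, ?F'' u))) (at x)"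
    by (rule has_derivative_transform_within_open[OF _ \<Omega> x])
       (simp add: frechet_derivative_graph_map[OF smooth_on_differentiable[OF F]])
  from frechet_derivative_at[OF this] show ?thesis by metis
qed

text \<open>Vanishing mean curvature makes the traced second derivative of the graph map tangent.
  Its horizontal part is zero, and a tangent vector \<open>(u, D u)\<close> with
  \<open>u = 0\<close> vanishes, so the full vector is zero and not merely its normal part.\<close>

lemma minimal_graph_hess:
  assumes x: "x \<in> \<Omega>" and minimal: "mean_curvature (graph_map F) x = 0"
  defines "K \<equiv> matrix_inv (first_fundamental_form (graph_map F) x)"
  shows "(\<Sum>i\<in>UNIV. \<Sum>j\<in>UNIV. K $ i $ j * component_hess F \<alpha> x (axis i 1) $ j) = 0"
proof -
  define D where "D = frechet_derivative F (at x)"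
  note Fx = smooth_on_differentiable[OF F x]
  have D: "linear D" unfolding D_def by (rule linear_frechet_derivative[OF Fx])
  define T where "T = tangent_space (graph_map F) x"
  have T: "T = range (\<lambda>u. (u, D u))"
    unfolding T_def D_def by (rule tangent_space_graph_map[OF Fx])
  have subT: "subspace T" unfolding T
    using D by (auto intro!: linear_subspace_image linearI simp: linear_add linear_scale)
  define F'' where "F'' i j = frechet_derivative (\<lambda>y. frechet_derivative F (at y) (axis j 1)) (at x) (axis i 1)"
    for i j :: 'n
  have sff: "second_fundamental_form (graph_map F) x (axis i 1) (axis j 1) = normal_part T (0, F'' i j)" for i j
    unfolding second_fundamental_form_def graph_map_second_derivative[OF x] T_def F''_def ..
  have "(\<Sum>i\<in>UNIV. \<Sum>j\<in>UNIV. K $ i $ j *\<^sub>R ((0, F'' i j) - normal_part T (0, F'' i j))) \<in> T"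
    by (intro subspace_sum subspace_scale normal_part_diff_mem subT)
  also have "(\<Sum>i\<in>UNIV. \<Sum>j\<in>UNIV. K $ i $ j *\<^sub>R ((0, F'' i j) - normal_part T (0, F'' i j))) =
      (\<Sum>i\<in>UNIV. \<Sum>j\<in>UNIV. K $ i $ j *\<^sub>R (0, F'' i j)) - mean_curvature (graph_map F) x"
    unfolding mean_curvature_def sff K_def[symmetric] by (simp only: scaleR_diff_right sum_subtractf)
  also have "\<dots> = (0, \<Sum>i\<in>UNIV. \<Sum>j\<in>UNIV. K $ i $ j *\<^sub>R F'' i j)"
    by (simp add: minimal prod_eq_iff fst_sum snd_sum)
  finally have "(\<Sum>i\<in>UNIV. \<Sum>j\<in>UNIV. K $ i $ j *\<^sub>R F'' i j) = D 0" by (auto simp: T)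
  then have "(\<Sum>i\<in>UNIV. \<Sum>j\<in>UNIV. K $ i $ j *\<^sub>R F'' i j) $ \<alpha> = 0" by (simp add: linear_0[OF D])
  then show ?thesis by (simp add: component_hess_def F''_def)
qed

end

lemma flux_solves:
  "flux d e + (d \<bullet> flux d e) *\<^sub>R d + (e \<bullet> flux d e) *\<^sub>R e = graph_gram d e *\<^sub>R d"
  unfolding graph_gram_def flux_def
  by (simp add: inner_diff_right inner_commute[of e d] algebra_simps power2_eq_square)

text \<open>The Woodbury formula: the metric is the identity plus the outer squares of
  \<open>d\<close> and \<open>e\<close>, and the flux vectors divided by
  \<open>graph_gram d e\<close> are the images of \<open>d\<close> and \<open>e\<close> under its
  inverse.\<close>

lemma inverse_first_fundamental_form_graph:
  fixes F :: "real^'n \<Rightarrow> real^2"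
  assumes F: "F differentiable (at x)"
  defines "d \<equiv> component_grad F 1 x" and "e \<equiv> component_grad F 2 x"
  shows "matrix_inv (first_fundamental_form (graph_map F) x) =
    (\<chi> i j. (if i = j then 1 else 0) - (flux d e $ i * d $ j + flux e d $ i * e $ j) / graph_gram d e)"
proof (rule matrix_inv_eqI)
  let ?g = "graph_gram d e"
  let ?X = "\<chi> i j. (if i = j then 1 else 0) - (flux d e $ i * d $ j + flux e d $ i * e $ j) / ?g"
  have g: "?g \<noteq> 0" using graph_gram_pos[of d e] by simp
  have comp: "frechet_derivative F (at x) (axis i 1) $ 1 = d $ i"
    "frechet_derivative F (at x) (axis i 1) $ 2 = e $ i" for i
    unfolding frechet_derivative_component[OF F] d_def e_def by (simp_all add: inner_axis)
  have I: "first_fundamental_form (graph_map F) x = (\<chi> i j. (if i = j then 1 else 0) + d $ i * d $ j + e $ i * e $ j)"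
    unfolding first_fundamental_form_def frechet_derivative_graph_map[OF F]
    by (simp add: vec_eq_iff inner_axis_axis inner_vec_def[where 'b=2] sum_2 comp)
  have "(\<Sum>k\<in>UNIV. ((if i = k then 1 else 0) + d $ i * d $ k + e $ i * e $ k) *
      ((if k = j then 1 else 0) - (flux d e $ k * d $ j + flux e d $ k * e $ j) / ?g)) =
      (if i = j then 1 else 0)" for i j
  proof -
    have inner: "(\<Sum>k\<in>UNIV. d $ k * w $ k) = d \<bullet> w" "(\<Sum>k\<in>UNIV. e $ k * w $ k) = e \<bullet> w" for w
      by (simp_all add: inner_vec_def)
    have w1: "flux d e $ i + (d \<bullet> flux d e) * d $ i + (e \<bullet> flux d e) * e $ i = ?g * d $ i"
      using arg_cong[OF flux_solves[of d e], of "\<lambda>w. w $ i"] by simp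
    have w2: "flux e d $ i + (d \<bullet> flux e d) * d $ i + (e \<bullet> flux e d) * e $ i = ?g * e $ i"
      using arg_cong[OF flux_solves[of e d], of "\<lambda>w. w $ i"] graph_gram_commute[of e d] by simp
    define c where "c k = flux d e $ k * d $ j + flux e d $ k * e $ j" for k
    have dc: "(\<Sum>k\<in>UNIV. d $ k * c k) = (d \<bullet> flux d e) * d $ j + (d \<bullet> flux e d) * e $ j"
      and ec: "(\<Sum>k\<in>UNIV. e $ k * c k) = (e \<bullet> flux d e) * d $ j + (e \<bullet> flux e d) * e $ j"
      by (simp_all add: c_def distrib_left sum.distrib inner_vec_def sum_distrib_left mult_ac)
    have "(\<Sum>k\<in>UNIV. ((if i = k then 1 else 0) + d $ i * d $ k + e $ i * e $ k) *
        ((if k = j then 1 else 0) - c k / ?g)) =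
        (\<Sum>k\<in>UNIV. (if i = k then (if k = j then 1 else 0) - c k / ?g else 0)
          + (if k = j then d $ i * d $ k + e $ i * e $ k else 0)
          - d $ i / ?g * (d $ k * c k) - e $ i / ?g * (e $ k * c k))"
      by (intro sum.cong refl) (simp add: algebra_simps add_divide_distrib)
    also have "\<dots> = (if i = j then 1 else 0) - c i / ?g + (d $ i * d $ j + e $ i * e $ j)
        - d $ i / ?g * (\<Sum>k\<in>UNIV. d $ k * c k) - e $ i / ?g * (\<Sum>k\<in>UNIV. e $ k * c k)"
      by (simp add: sum.distrib sum_subtractf sum_distrib_left)
    also have "\<dots> = (if i = j then 1 else 0) + (d $ i * d $ j + e $ i * e $ j)
        - ((flux d e $ i + (d \<bullet> flux d e) * d $ i + (e \<bullet> flux d e) * e $ i) * d $ j +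
           (flux e d $ i + (d \<bullet> flux e d) * d $ i + (e \<bullet> flux e d) * e $ i) * e $ j) / ?g"
      unfolding dc ec unfolding c_def by (simp add: algebra_simps add_divide_distrib)
    also have "\<dots> = (if i = j then 1 else 0)"
      unfolding w1 w2 using g by (simp add: add_divide_distrib)
    finally show ?thesis by (simp add: c_def)
  qed
  then show "first_fundamental_form (graph_map F) x ** ?X = mat 1"
    unfolding I by (simp add: vec_eq_iff matrix_matrix_mult_def mat_def)
qed

text \<open>The explicit inverse metric is inserted into the traced equation, which is then
  multiplied by \<open>graph_gram d e\<close>; the result has the shape that
  \<open>divergence_flux\<close> assumes.\<close>

lemma minimal_graph_laplacian:
  fixes F :: "real^'n \<Rightarrow> real^2"
  assumes \<Omega>: "open \<Omega>" and F: "smooth_on F \<Omega>" and x: "x \<in> \<Omega>"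
    and minimal: "mean_curvature (graph_map F) x = 0"
  defines "d \<equiv> component_grad F 1 x" and "e \<equiv> component_grad F 2 x"
  shows "graph_gram d e * (\<Sum>i\<in>UNIV. component_hess F \<alpha> x (axis i 1) $ i) =
    component_hess F \<alpha> x (flux d e) \<bullet> d + component_hess F \<alpha> x (flux e d) \<bullet> e"
proof -
  let ?g = "graph_gram d e"
  let ?H = "\<lambda>i j. component_hess F \<alpha> x (axis i 1) $ j"
  have g: "?g \<noteq> 0" using graph_gram_pos[of d e] by simp
  have hess: "component_hess F \<alpha> x w \<bullet> z = (\<Sum>i\<in>UNIV. \<Sum>j\<in>UNIV. w $ i * z $ j * ?H i j)" for w z
    unfolding inner_vec_def component_hess_nth[OF \<Omega> F x, of \<alpha> w]
    by (subst sum.swap) (simp add: sum_distrib_left mult_ac)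
  have "0 = (\<Sum>i\<in>UNIV. \<Sum>j\<in>UNIV. ((if i = j then 1 else 0) -
      (flux d e $ i * d $ j + flux e d $ i * e $ j) / ?g) * ?H i j)"
    using minimal_graph_hess[OF \<Omega> F x minimal, of \<alpha>]
    unfolding inverse_first_fundamental_form_graph[OF smooth_on_differentiable[OF F x]] d_def e_def
    by simp
  also have "\<dots> = (\<Sum>i\<in>UNIV. \<Sum>j\<in>UNIV. (if i = j then ?H i j else 0)
      - (1 / ?g) * (flux d e $ i * d $ j * ?H i j) - (1 / ?g) * (flux e d $ i * e $ j * ?H i j))"
    by (intro sum.cong refl) (simp add: algebra_simps add_divide_distrib)
  also have "\<dots> = (\<Sum>i\<in>UNIV. ?H i i) - (1 / ?g) * (component_hess F \<alpha> x (flux d e) \<bullet> d)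
      - (1 / ?g) * (component_hess F \<alpha> x (flux e d) \<bullet> e)"
    unfolding hess by (simp add: sum_subtractf sum_distrib_left)
  finally have "?g * 0 = ?g * ((\<Sum>i\<in>UNIV. ?H i i) - (1 / ?g) * (component_hess F \<alpha> x (flux d e) \<bullet> d)
      - (1 / ?g) * (component_hess F \<alpha> x (flux e d) \<bullet> e))" by simp
  then show ?thesis using g by (simp add: right_diff_distrib)
qed

section \<open>Closedness of the form\<close>

definition calib_field :: "(real^'n \<Rightarrow> real^2) \<Rightarrow> 2 \<Rightarrow> 2 \<Rightarrow> real^'n \<Rightarrow> real^'n" where
  "calib_field F \<alpha> \<beta> x =
    (1 / sqrt (graph_gram (component_grad F \<alpha> x) (component_grad F \<beta> x))) *\<^sub>R
      flux (component_grad F \<alpha> x) (component_grad F \<beta> x)"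

definition calib_coeff :: "(real^'n \<Rightarrow> real^2) \<Rightarrow> real^'n \<Rightarrow> real" where
  "calib_coeff F x =
    (1 - ((component_grad F 1 x \<bullet> component_grad F 1 x) * (component_grad F 2 x \<bullet> component_grad F 2 x)
       - (component_grad F 1 x \<bullet> component_grad F 2 x)\<^sup>2))
    / sqrt (graph_gram (component_grad F 1 x) (component_grad F 2 x))"

text \<open>\<open>calib_field F \<alpha> \<beta>\<close> is the field V of the component
  \<open>\<alpha>\<close>, because \<open>flux\<close> is \<open>graph_gram\<close> times the
  inverse metric applied to the gradient. The Laplacian identity is symmetric in the two components,
  so one argument serves both orders.\<close>

lemma calib_field_divergence:
  fixes F :: "real^'n \<Rightarrow> real^2"
  assumes \<Omega>: "open \<Omega>" and F: "smooth_on F \<Omega>" and x: "x \<in> \<Omega>"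
    and minimal: "mean_curvature (graph_map F) x = 0"
    and \<alpha>\<beta>: "(\<alpha>, \<beta>) = (1, 2) \<or> (\<alpha>, \<beta>) = (2, 1)"
  shows "\<exists>V'. (calib_field F \<alpha> \<beta> has_derivative V') (at x) \<and> (\<Sum>m\<in>UNIV. V' (axis m 1) $ m) = 0"
proof -
  have "graph_gram (component_grad F \<alpha> x) (component_grad F \<beta> x) *
      (\<Sum>m\<in>UNIV. component_hess F \<gamma> x (axis m 1) $ m) =
      component_hess F \<gamma> x (flux (component_grad F \<alpha> x) (component_grad F \<beta> x)) \<bullet> component_grad F \<alpha> x +
      component_hess F \<gamma> x (flux (component_grad F \<beta> x) (component_grad F \<alpha> x)) \<bullet> component_grad F \<beta> x" for \<gamma>
    using minimal_graph_laplacian[OF \<Omega> F x minimal, of \<gamma>] \<alpha>\<beta>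
    by (auto simp: graph_gram_commute add.commute)
  from divergence_flux[OF component_grad_has_derivative[OF \<Omega> F x] component_grad_has_derivative[OF \<Omega> F x]
      component_hess_symmetric[OF \<Omega> F x] component_hess_symmetric[OF \<Omega> F x] this this]
  show ?thesis unfolding calib_field_def[abs_def] .
qed

lemma smooth_on_calib:
  fixes F :: "real^'n \<Rightarrow> real^2"
  assumes \<Omega>: "open \<Omega>" and F: "smooth_on F \<Omega>"
  shows "smooth_on (calib_coeff F) \<Omega>" "smooth_on (\<lambda>x. calib_field F \<alpha> \<beta> x $ m) \<Omega>"
proof -
  note grad = smooth_on_component_grad[OF \<Omega> F]
  have inner: "smooth_on (\<lambda>x. component_grad F \<gamma> x \<bullet> component_grad F \<delta> x) \<Omega>" for \<gamma> \<delta>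
    unfolding inner_vec_def inner_real_def
    by (intro smooth_on_sum[OF \<Omega>] smooth_on_mult[OF \<Omega>] grad) simp_all
  note intros = smooth_on_divide_sqrt[OF \<Omega> graph_gram_pos] smooth_on_add[OF \<Omega>] smooth_on_diff[OF \<Omega>]
    smooth_on_mult[OF \<Omega>] smooth_on_const[OF \<Omega>] inner grad
  have gram: "smooth_on (\<lambda>x. graph_gram (component_grad F \<gamma> x) (component_grad F \<delta> x)) \<Omega>" for \<gamma> \<delta>
    unfolding graph_gram_def power2_eq_square by (intro intros)
  show "smooth_on (calib_coeff F) \<Omega>"
    unfolding calib_coeff_def[abs_def] power2_eq_square by (intro intros gram)
  have "calib_field F \<alpha> \<beta> x $ m =
      ((1 + component_grad F \<beta> x \<bullet> component_grad F \<beta> x) * component_grad F \<alpha> x $ m -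
       (component_grad F \<alpha> x \<bullet> component_grad F \<beta> x) * component_grad F \<beta> x $ m) /
      sqrt (graph_gram (component_grad F \<alpha> x) (component_grad F \<beta> x))" for x
    by (simp add: calib_field_def flux_def)
  then show "smooth_on (\<lambda>x. calib_field F \<alpha> \<beta> x $ m) \<Omega>"
    by (simp only:) (intro intros gram)
qed

text \<open>The \<open>n\<close>-form \<open>dy\<^sub>\<alpha> \<and> \<iota>\<^sub>m (dx\<^sub>1 \<and> \<dots> \<and> dx\<^sub>n)\<close>.\<close>

definition mixed_form :: "2 \<Rightarrow> 'n \<Rightarrow> (nat \<Rightarrow> (real^'n::{finite,linorder}) \<times> (real^2)) \<Rightarrow> real" where
  "mixed_form \<alpha> m = covector_wedge CARD('n) (\<lambda>w. snd w $ \<alpha>) (interior_mult (axis m 1, 0) base_vol)"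

lemma sum_det_replace_row_mixed_form:
  fixes v :: "nat \<Rightarrow> (real^'n::{finite,linorder}) \<times> (real^2)"
  shows "(\<Sum>k\<in>UNIV. snd (v (index_pos k)) $ \<alpha> * det (\<chi> j. if j = k then w else fst (v (index_pos j)))) =
    (\<Sum>m\<in>UNIV. w $ m * mixed_form \<alpha> m v)"
proof -
  let ?R = "\<lambda>k u. det (\<chi> j. if j = k then u else fst (v (index_pos j)))"
  have "(\<Sum>k\<in>UNIV. snd (v (index_pos k)) $ \<alpha> * ?R k w) =
      (\<Sum>k\<in>UNIV. \<Sum>m\<in>UNIV. w $ m * (snd (v (index_pos k)) $ \<alpha> * ?R k (axis m 1)))"
    by (subst linear_expand_axis[OF linear_det_replace_row]) (simp add: sum_distrib_left mult_ac)
  also have "\<dots> = (\<Sum>m\<in>UNIV. w $ m * mixed_form \<alpha> m v)"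
    unfolding mixed_form_def covector_wedge_interior_base_vol sum_distrib_left fst_conv
    by (rule sum.swap)
  finally show ?thesis .
qed

lemma Theta_calib:
  fixes F :: "real^'n::{finite,linorder} \<Rightarrow> real^2"
  assumes "F differentiable (at x)"
  shows "Theta F (x, y) v = calib_coeff F x * base_vol v +
    (\<Sum>m\<in>UNIV. calib_field F 1 2 x $ m * mixed_form 1 m v) +
    (\<Sum>m\<in>UNIV. calib_field F 2 1 x $ m * mixed_form 2 m v)"
  unfolding Theta_coords[OF assms] component_grad_def[symmetric] sum_det_replace_row_mixed_form
  by (simp add: calib_coeff_def calib_field_def base_vol_def graph_gram_commute[of "component_grad F 2 x"]
      add_divide_distrib sum_divide_distrib)

lemma Theta_smooth:
  fixes F :: "real^'n::{finite,linorder} \<Rightarrow> real^2"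
  assumes \<Omega>: "open \<Omega>" and F: "smooth_on F \<Omega>"
  shows "smooth_on (\<lambda>p. Theta F p v) (\<Omega> \<times> UNIV)"
proof -
  have U: "open (\<Omega> \<times> (UNIV :: (real^2) set))" using \<Omega> by (simp add: open_Times)
  show ?thesis
  proof (rule smooth_on_cong[OF U])
    show "smooth_on (\<lambda>p. calib_coeff F (fst p) * base_vol v +
        (\<Sum>m\<in>UNIV. calib_field F 1 2 (fst p) $ m * mixed_form 1 m v) +
        (\<Sum>m\<in>UNIV. calib_field F 2 1 (fst p) $ m * mixed_form 2 m v)) (\<Omega> \<times> (UNIV :: (real^2) set))"
      by (intro smooth_on_add[OF U] smooth_on_mult[OF U] smooth_on_sum[OF U] smooth_on_const[OF U]
          smooth_on_compose_fst[OF \<Omega>] smooth_on_calib[OF \<Omega> F]) simp_all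
  next
    fix p :: "(real^'n::_) \<times> (real^2)" assume "p \<in> \<Omega> \<times> UNIV"
    then have "F differentiable (at (fst p))" using smooth_on_differentiable[OF F] by auto
    from Theta_calib[OF this, of "snd p" v]
    show "calib_coeff F (fst p) * base_vol v +
        (\<Sum>m\<in>UNIV. calib_field F 1 2 (fst p) $ m * mixed_form 1 m v) +
        (\<Sum>m\<in>UNIV. calib_field F 2 1 (fst p) $ m * mixed_form 2 m v) = Theta F p v" by simp
  qed
qed

text \<open>Against the contraction by the \<open>m\<close>-th axis, the differential of the
  \<open>m\<close>-th component sees only its \<open>m\<close>-th partial derivative. The sum is
  therefore minus the divergence times dy wedged with the base volume.\<close>

lemma covector_wedge_divergence_free:
  fixes V' :: "real^'n::{finite,linorder} \<Rightarrow> real^'n::_"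
  assumes "linear V'" "(\<Sum>m\<in>UNIV. V' (axis m 1) $ m) = 0"
  shows "(\<Sum>m\<in>UNIV. covector_wedge (Suc CARD('n)) (\<lambda>w. V' (fst w) $ m) (mixed_form \<alpha> m) v) = 0"
proof -
  have "linear (\<lambda>u. V' u $ m)" for m using assms(1) by (auto intro!: linearI simp: linear_add linear_scale)
  then have inner: "V' u $ m = (\<chi> i. V' (axis i 1) $ m) \<bullet> u" for u m
    by (rule linear_functional_inner)
  have "covector_wedge (Suc CARD('n)) (\<lambda>w. V' (fst w) $ m) (mixed_form \<alpha> m) v =
      - (V' (axis m 1) $ m) * covector_wedge (Suc CARD('n)) (\<lambda>w. snd w $ \<alpha>) base_vol v" for m
    unfolding mixed_form_def
    using covector_wedge_fst_flux[of "\<chi> i. V' (axis i 1) $ m" "\<lambda>w. snd w $ \<alpha>" "(axis m 1, 0)" v]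
    by (simp only: inner[symmetric] fst_conv)
  then show ?thesis using assms(2) by (simp add: sum_negf flip: sum_distrib_right)
qed

lemma Theta_exterior_derivative:
  fixes F :: "real^'n::{finite,linorder} \<Rightarrow> real^2"
  assumes \<Omega>: "open \<Omega>" and F: "smooth_on F \<Omega>" and x: "x \<in> \<Omega>"
    and minimal: "mean_curvature (graph_map F) x = 0"
  shows "exterior_derivative CARD('n) (Theta F) (x, y) v = 0"
proof -
  define h' where "h' = frechet_derivative (calib_coeff F) (at x)"
  have h': "(calib_coeff F has_derivative h') (at x)"
    unfolding h'_def by (rule smooth_on_has_derivative[OF smooth_on_calib(1)[OF \<Omega> F] x])
  obtain V\<^sub>1 where V\<^sub>1: "(calib_field F 1 2 has_derivative V\<^sub>1) (at x)" "(\<Sum>m\<in>UNIV. V\<^sub>1 (axis m 1) $ m) = 0"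
    using calib_field_divergence[OF \<Omega> F x minimal, of 1 2] by blast
  obtain V\<^sub>2 where V\<^sub>2: "(calib_field F 2 1 has_derivative V\<^sub>2) (at x)" "(\<Sum>m\<in>UNIV. V\<^sub>2 (axis m 1) $ m) = 0"
    using calib_field_divergence[OF \<Omega> F x minimal, of 2 1] by blast
  define \<theta>' where "\<theta>' w u = h' (fst u) * base_vol w +
      (\<Sum>m\<in>UNIV. V\<^sub>1 (fst u) $ m * mixed_form 1 m w) + (\<Sum>m\<in>UNIV. V\<^sub>2 (fst u) $ m * mixed_form 2 m w)"
    for w :: "nat \<Rightarrow> (real^'n::_) \<times> (real^2)" and u :: "(real^'n::_) \<times> (real^2)"
  have deriv: "frechet_derivative (\<lambda>q. Theta F q w) (at (x, y)) = \<theta>' w" for w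
  proof -
    have comp: "((\<lambda>q. f (fst q)) has_derivative (\<lambda>u. f' (fst u))) (at (x, y))"
      if "(f has_derivative f') (at x)" for f :: "real^'n::_ \<Rightarrow> 'c::real_normed_vector" and f'
      using has_derivative_compose[OF has_derivative_fst[OF has_derivative_ident], of f f' "(x, y)"] that
      by simp
    note nth = bounded_linear.has_derivative[OF bounded_linear_vec_nth]
    have "((\<lambda>q. calib_coeff F (fst q) * base_vol w +
        (\<Sum>m\<in>UNIV. calib_field F 1 2 (fst q) $ m * mixed_form 1 m w) +
        (\<Sum>m\<in>UNIV. calib_field F 2 1 (fst q) $ m * mixed_form 2 m w)) has_derivative \<theta>' w) (at (x, y))"
      unfolding \<theta>'_def
      by (intro has_derivative_add has_derivative_sum has_derivative_mult_left comp nth h' V\<^sub>1(1) V\<^sub>2(1))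
    then have "((\<lambda>q. Theta F q w) has_derivative \<theta>' w) (at (x, y))"
    proof (rule has_derivative_transform_within_open)
      show "open (\<Omega> \<times> (UNIV :: (real^2) set))" using \<Omega> by (simp add: open_Times)
      show "(x, y) \<in> \<Omega> \<times> UNIV" using x by simp
      fix q :: "(real^'n::_) \<times> (real^2)" assume "q \<in> \<Omega> \<times> UNIV"
      then have "F differentiable (at (fst q))" using smooth_on_differentiable[OF F] by auto
      from Theta_calib[OF this, of "snd q" w]
      show "calib_coeff F (fst q) * base_vol w +
        (\<Sum>m\<in>UNIV. calib_field F 1 2 (fst q) $ m * mixed_form 1 m w) +
        (\<Sum>m\<in>UNIV. calib_field F 2 1 (fst q) $ m * mixed_form 2 m w) = Theta F q w" by simp
    qed
    from frechet_derivative_at[OF this] show ?thesis by simp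
  qed
  let ?n = "Suc CARD('n)"
  \<comment> \<open>The forms multiplying the coefficients are constant, so the alternating sum in
    \<open>exterior_derivative\<close> is the wedge with the differential of each coefficient; these
    differentials involve base directions only.\<close>
  have "exterior_derivative CARD('n) (Theta F) (x, y) v =
      covector_wedge ?n (\<lambda>w. h' (fst w)) base_vol v +
      (\<Sum>m\<in>UNIV. covector_wedge ?n (\<lambda>w. V\<^sub>1 (fst w) $ m) (mixed_form 1 m) v) +
      (\<Sum>m\<in>UNIV. covector_wedge ?n (\<lambda>w. V\<^sub>2 (fst w) $ m) (mixed_form 2 m) v)"
    unfolding exterior_derivative_def deriv \<theta>'_def covector_wedge_def lessThan_Suc_atMost
    by (simp only: distrib_left sum.distrib sum_distrib_left mult.assoc sum.swap[of _ UNIV])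
  also have "covector_wedge ?n (\<lambda>w. h' (fst w)) base_vol v = 0"
    using covector_wedge_fst_base_vol[of "\<chi> m. h' (axis m 1)" v]
    by (simp only: linear_functional_inner[OF has_derivative_linear[OF h'], symmetric])
  finally show ?thesis
    using covector_wedge_divergence_free[OF has_derivative_linear[OF V\<^sub>1(1)] V\<^sub>1(2)]
      covector_wedge_divergence_free[OF has_derivative_linear[OF V\<^sub>2(1)] V\<^sub>2(2)] by simp
qed

theorem theorem1p4:
  fixes \<Omega> :: "(real^'n::{finite,linorder}) set" and F :: "real^'n::_ \<Rightarrow> real^2"
  assumes "open \<Omega>" and "connected \<Omega>" and "\<Omega> \<noteq> {}"
    and "smooth_on F \<Omega>"
    and "minimal_on \<Omega> (graph_map F)"
    and "\<And>x. x \<in> \<Omega> \<Longrightarrow>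
      singular_value (frechet_derivative F (at x)) 1 *
      singular_value (frechet_derivative F (at x)) 2 \<le> 1"
  shows "calibrates_graph (Theta F) \<Omega> F"
proof -
  have diff: "F differentiable (at x)" if "x \<in> \<Omega>" for x
    by (rule smooth_on_differentiable[OF assms(4) that])
  have "closed_form CARD('n) (\<Omega> \<times> UNIV) (Theta F)"
    unfolding closed_form_def differential_form_def
    using Theta_alternating[OF diff] Theta_smooth[OF assms(1,4)]
      Theta_exterior_derivative[OF assms(1,4)] assms(5)
    by (auto simp: minimal_on_def)
  moreover have "comass CARD('n) (Theta F p) \<le> 1" if "p \<in> \<Omega> \<times> UNIV" for p
    using that comass_Theta_le[OF diff assms(6)] by auto
  moreover have "Theta F (x, F x) v = graph_vol F x v"
    if "x \<in> \<Omega>" "\<forall>i<CARD('n). v i \<in> tangent_space (graph_map F) x" for x v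
    using Theta_tangent[OF diff] that by blast
  ultimately show ?thesis unfolding calibrates_graph_def calibration_def by blast
qed

end
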